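(* Let $f:\mathbb{R}^{n+1}\to\mathbb{R}_n$ be a left slice monogenic function with $f|_{\mathbb{R}}\in L^2(\mathbb{R})$ and let $B>0$. Then the following two conditions are equivalent: (i) There exists a constant $C$ such that $|f(u+Iv)|\le Ce^{B|u+Iv|}$ for all $I\in\mathbb{S}$ and $u,v\in\mathbb{R}$. (ii) $\operatorname{supp}\mathscr{F}_I(f|_{\mathbb{R}})\subset[-B,B]$ for all $I\in\mathbb{S}$. Moreover, if one of the conditions (i), (ii) holds, then for all $I\in\mathbb{S}$ and $u,v\in\mathbb{R}$, $$f(u+Iv)=\frac{1}{\sqrt{2\pi}}\int_{-B}^{B}e^{I(u+Iv)w}\,\mathscr{F}_I(f|_{\mathbb{R}})(w)\,dw.$$
   Context: $\mathbb{R}_n$ is the real Clifford algebra generated by $\mathbf{e}_1,\dots,\mathbf{e}_n$ with $\mathbf{e}_r\mathbf{e}_s+\mathbf{e}_s\mathbf{e}_r=-2\delta_{rs}$; its elements are $a=\sum_A a_A\mathbf{e}_A$ ($a_A\in\mathbb{R}$, $A\subseteq\{1,\dots,n\}$ ordered, $\mathbf{e}_A$ the corresponding ordered product, $\mathbf{e}_\varnothing=1$), with norm $|a|=(\sum_A a_A^2)^{1/2}$. $\mathbb{R}^{n+1}$ is identified with the set of paravectors $x_0+x_1\mathbf{e}_1+\dots+x_n\mathbf{e}_n$. $\mathbb{S}=\{x_1\mathbf{e}_1+\dots+x_n\mathbf{e}_n:\ x_1^2+\dots+x_n^2=1\}$, so $I^2=-1$ for $I\in\mathbb{S}$; $L_I=\mathbb{R}+I\mathbb{R}\cong\mathbb{C}$.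 For $U\subseteq\mathbb{R}^{n+1}$ open, a real differentiable $f:U\to\mathbb{R}_n$ is left slice monogenic if for every $I\in\mathbb{S}$, $\frac12\left(\frac{\partial}{\partial u}+I\frac{\partial}{\partial v}\right)f(u+Iv)=0$ on $U\cap L_I$. $f|_{\mathbb{R}}$ is the restriction of $f$ to the real axis. One-dimensional left-sided Clifford Fourier transform: for $I\in\mathbb{S}$ and $g\in L^1(\mathbb{R},\mathbb{R}_n)$, $\mathscr{F}_I(g)(w)=\frac{1}{\sqrt{2\pi}}\int_{\mathbb{R}}e^{-Iuw}g(u)\,du$, extended to $g\in L^2(\mathbb{R},\mathbb{R}_n)$ by continuity (Plancherel). *)

theory Defs
  imports "HOL-Analysis.Analysis"
begin

text \<open>
  The index type \<open>'n\<close> (finite and linearly ordered) plays the role of \<open>{1, ..., n}\<close>, so that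
  \<open>n = CARD('n)\<close>. An element \<open>\<Sum>A. a\<^sub>A e\<^sub>A\<close> of the Clifford algebra is its coefficient family.
\<close>

typedef 'n clifford = "UNIV :: ('n set \<Rightarrow> real) set"
  morphisms coeff Clifford
  by simp

lemmas coeff_Clifford [simp] = Clifford_inverse [OF UNIV_I]

lemma clifford_eq_iff: "a = b \<longleftrightarrow> (\<forall>A. coeff a A = coeff b A)"
  by (metis coeff_inject ext)

instantiation clifford :: (type) real_vector
begin

definition "0 = Clifford (\<lambda>_. 0)"
definition "a + b = Clifford (\<lambda>A. coeff a A + coeff b A)"
definition "- a = Clifford (\<lambda>A. - coeff a A)"
definition "a - b = Clifford (\<lambda>A. coeff a A - coeff b A)"
definition "r *\<^sub>R a = Clifford (\<lambda>A. r * coeff a A)"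

instance
  by standard
    (simp_all add: clifford_eq_iff zero_clifford_def plus_clifford_def uminus_clifford_def
      minus_clifford_def scaleR_clifford_def algebra_simps)

end

lemma coeff_simps [simp]:
  "coeff 0 A = 0" "coeff (a + b) A = coeff a A + coeff b A" "coeff (- a) A = - coeff a A"
  "coeff (a - b) A = coeff a A - coeff b A" "coeff (r *\<^sub>R a) A = r * coeff a A"
  by (simp_all add: zero_clifford_def plus_clifford_def uminus_clifford_def
      minus_clifford_def scaleR_clifford_def)

definition blade :: "'n set \<Rightarrow> 'n clifford" where
  "blade A = Clifford (\<lambda>B. if B = A then 1 else 0)"

lemma coeff_blade [simp]: "coeff (blade A) B = (if B = A then 1 else 0)"
  by (simp add: blade_def)

instantiation clifford :: (finite) real_inner
begin

definition inner_clifford :: "'a clifford \<Rightarrow> 'a clifford \<Rightarrow> real" where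
  "inner_clifford a b = (\<Sum>A\<in>UNIV. coeff a A * coeff b A)"
definition norm_clifford :: "'a clifford \<Rightarrow> real" where
  "norm_clifford a = sqrt (\<Sum>A\<in>UNIV. (coeff a A)\<^sup>2)"
definition sgn_clifford :: "'a clifford \<Rightarrow> 'a clifford" where
  "sgn_clifford a = a /\<^sub>R norm a"
definition dist_clifford :: "'a clifford \<Rightarrow> 'a clifford \<Rightarrow> real" where
  "dist_clifford a b = norm (a - b)"
definition uniformity_clifford :: "('a clifford \<times> 'a clifford) filter" where
  "uniformity_clifford = (INF e\<in>{0<..}. principal {(x, y). dist x y < e})"
definition open_clifford :: "'a clifford set \<Rightarrow> bool" where
  "open_clifford U \<longleftrightarrow> (\<forall>x\<in>U. eventually (\<lambda>(x', y). x' = x \<longrightarrow> y \<in> U) uniformity)"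

instance
proof
  fix x y z :: "'a clifford" and r :: real and U :: "'a clifford set"
  show "sgn x = x /\<^sub>R norm x"
    by (fact sgn_clifford_def)
  show "dist x y = norm (x - y)"
    by (fact dist_clifford_def)
  show "uniformity = (INF e\<in>{0<..}. principal {(x :: 'a clifford, y). dist x y < e})"
    by (fact uniformity_clifford_def)
  show "open U \<longleftrightarrow> (\<forall>x\<in>U. \<forall>\<^sub>F (x', y) in uniformity. x' = x \<longrightarrow> y \<in> U)"
    by (fact open_clifford_def)
  show "inner x y = inner y x"
    by (simp add: inner_clifford_def mult.commute)
  show "inner (x + y) z = inner x z + inner y z"
    by (simp add: inner_clifford_def algebra_simps sum.distrib)
  show "inner (r *\<^sub>R x) y = r * inner x y"
    by (simp add: inner_clifford_def sum_distrib_left mult.assoc)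
  show "0 \<le> inner x x"
    by (simp add: inner_clifford_def sum_nonneg)
  show "inner x x = 0 \<longleftrightarrow> x = 0"
    by (simp add: inner_clifford_def clifford_eq_iff sum_nonneg_eq_0_iff)
  show "norm x = sqrt (inner x x)"
    by (simp add: norm_clifford_def inner_clifford_def power2_eq_square)
qed

end

lemma inner_blade [simp]: "inner a (blade A) = coeff (a :: 'n :: finite clifford) A"
  by (simp add: inner_clifford_def if_distrib [of "\<lambda>x. _ * x"] cong: if_cong)

instantiation clifford :: (finite) euclidean_space
begin

definition Basis_clifford :: "'a clifford set" where
  "Basis_clifford = range blade"

instance
  by standard (auto simp: Basis_clifford_def clifford_eq_iff)

end

text \<open>
  Multiplication: \<open>e\<^sub>A e\<^sub>B\<close> equals \<open>e\<close> of the symmetric difference up to a sign. Bringing the product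
  into increasing order costs a factor \<open>-1\<close> for every \<open>(i, j) \<in> A \<times> B\<close> with \<open>j < i\<close> (a transposition),
  and a factor \<open>-1\<close> for every \<open>i \<in> A \<inter> B\<close> (from \<open>e\<^sub>i\<^sup>2 = -1\<close>).
\<close>

definition blade_sign :: "'n :: linorder set \<Rightarrow> 'n set \<Rightarrow> real" where
  "blade_sign A B = (- 1) ^ card {(i, j). i \<in> A \<and> j \<in> B \<and> j \<le> i}"

lemma blade_sign_prod:
  fixes A B :: "'n :: {finite, linorder} set"
  shows "blade_sign A B = (\<Prod>i\<in>UNIV. \<Prod>j\<in>UNIV. if i \<in> A \<and> j \<in> B \<and> j \<le> i then - 1 else 1)"
proof -
  have "(\<Prod>i\<in>UNIV. \<Prod>j\<in>UNIV. if i \<in> A \<and> j \<in> B \<and> j \<le> i then - 1 else 1 :: real)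
      = (\<Prod>p\<in>UNIV. if p \<in> {(i, j). i \<in> A \<and> j \<in> B \<and> j \<le> i} then - 1 else 1)"
    by (simp add: prod.cartesian_product case_prod_beta UNIV_Times_UNIV)
  also have "\<dots> = (- 1) ^ card {(i, j). i \<in> A \<and> j \<in> B \<and> j \<le> i}"
    by (subst prod.If_cases) simp_all
  finally show ?thesis
    by (simp add: blade_sign_def)
qed

lemma blade_sign_sym_diff:
  fixes A B C :: "'n :: {finite, linorder} set"
  shows "blade_sign (sym_diff A B) C = blade_sign A C * blade_sign B C"
    and "blade_sign A (sym_diff B C) = blade_sign A B * blade_sign A C"
  unfolding blade_sign_prod prod.distrib [symmetric] by (auto intro!: prod.cong)

lemma blade_sign_empty [simp]: "blade_sign {} B = 1" "blade_sign A {} = 1"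
  by (simp_all add: blade_sign_def)

instantiation clifford :: ("{finite, linorder}") "{one, times}"
begin

definition one_clifford :: "'a clifford" where
  "one_clifford = blade {}"
definition times_clifford :: "'a clifford \<Rightarrow> 'a clifford \<Rightarrow> 'a clifford" where
  "times_clifford a b =
    (\<Sum>A\<in>UNIV. \<Sum>B\<in>UNIV. (coeff a A * coeff b B * blade_sign A B) *\<^sub>R blade (sym_diff A B))"

instance ..

end

lemma blade_mult:
  fixes A B :: "'n :: {finite, linorder} set"
  shows "blade A * blade B = blade_sign A B *\<^sub>R blade (sym_diff A B)"
proof -
  have "blade A * blade B = (\<Sum>A'\<in>UNIV. if A' = A then (\<Sum>B'\<in>UNIV. if B' = B then
      blade_sign A' B' *\<^sub>R blade (sym_diff A' B') else 0) else 0)"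
    unfolding times_clifford_def by (intro sum.cong refl) (auto intro!: sum.cong simp del: sum.delta sum.delta')
  then show ?thesis
    by simp
qed

instance clifford :: ("{finite, linorder}") ring_1
proof
  have sum_l: "(\<Sum>A\<in>S. F A) * b = (\<Sum>A\<in>S. F A * b)"
    and sum_r: "b * (\<Sum>A\<in>S. F A) = (\<Sum>A\<in>S. b * F A)"
    if l: "\<And>a b c :: 'a clifford. (a + b) * c = a * c + b * c"
    and r: "\<And>a b c :: 'a clifford. a * (b + c) = a * b + a * c"
    for S :: "'a set set" and F and b :: "'a clifford"
  proof -
    have [simp]: "0 * c = 0" "c * 0 = 0" for c :: "'a clifford"
      by (simp_all add: times_clifford_def)
    show "(\<Sum>A\<in>S. F A) * b = (\<Sum>A\<in>S. F A * b)"
      by (induction S rule: infinite_finite_induct) (simp_all add: l)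
    show "b * (\<Sum>A\<in>S. F A) = (\<Sum>A\<in>S. b * F A)"
      by (induction S rule: infinite_finite_induct) (simp_all add: r)
  qed
  have scale_l: "(r *\<^sub>R a) * b = r *\<^sub>R (a * b)" and scale_r: "a * (r *\<^sub>R b) = r *\<^sub>R (a * b)"
    for r and a b :: "'a clifford"
    by (simp_all add: times_clifford_def scaleR_sum_right mult.assoc mult.left_commute)
  have rep: "a = (\<Sum>A\<in>UNIV. coeff a A *\<^sub>R blade A)" for a :: "'a clifford"
  proof -
    have "a = (\<Sum>b\<in>Basis. inner a b *\<^sub>R b)"
      by (simp add: euclidean_representation)
    also have "\<dots> = (\<Sum>A\<in>UNIV. coeff a A *\<^sub>R blade A)"
      unfolding Basis_clifford_def
      by (subst sum.reindex) (auto simp: inj_on_def clifford_eq_iff split: if_splits)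
    finally show ?thesis .
  qed
  show dl: "(a + b) * c = a * c + b * c" and dr: "a * (b + c) = a * b + a * c" for a b c :: "'a clifford"
    by (simp_all add: times_clifford_def algebra_simps sum.distrib)
  show "1 * a = a" and "a * 1 = a" for a :: "'a clifford"
    by (subst (1 2) rep [of a], simp add: sum_r [OF dl dr] sum_l [OF dl dr] scale_l scale_r
        one_clifford_def blade_mult)+
  show "a * b * c = a * (b * c)" for a b c :: "'a clifford"
  proof -
    have sd: "sym_diff (sym_diff A B) C = sym_diff A (sym_diff B C)" for A B C :: "'a set"
      by blast
    have "blade A * blade B * blade C = blade A * (blade B * blade C)" for A B C :: "'a set"
      by (simp only: blade_mult scale_l scale_r scaleR_scaleR blade_sign_sym_diff sd) (simp add: mult_ac)
    then have "x *\<^sub>R blade A * (y *\<^sub>R blade B) * (z *\<^sub>R blade C) =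
        x *\<^sub>R blade A * (y *\<^sub>R blade B * (z *\<^sub>R blade C))" for A B C :: "'a set" and x y z
      by (simp add: scale_l scale_r)
    then show ?thesis
      by (subst (1 2) rep [of a], subst (1 2) rep [of b], subst (1 2) rep [of c])
        (simp only: sum_l [OF dl dr] sum_r [OF dl dr])
  qed
  show "(0 :: 'a clifford) \<noteq> 1"
    by (auto simp: one_clifford_def clifford_eq_iff)
qed

instance clifford :: ("{finite, linorder}") real_algebra_1
  by standard (simp_all add: times_clifford_def scaleR_sum_right mult.assoc mult.left_commute)

abbreviation gen :: "'n \<Rightarrow> 'n clifford" where
  "gen r \<equiv> blade {r}"

lemma gen_anticommute:
  fixes r s :: "'n :: {finite, linorder}"
  shows "gen r * gen s + gen s * gen r = (if r = s then - 2 else 0)"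
proof -
  have *: "{(i, j). i = x \<and> j = y \<and> j \<le> i} = (if y \<le> x then {(x, y)} else {})" for x y :: 'n
    by auto
  have [simp]: "blade_sign {x} {y} = (if y \<le> x then - 1 else 1)" for x y :: 'n
    by (simp add: blade_sign_def *)
  show ?thesis
  proof (cases "r = s")
    case True
    then show ?thesis
      by (simp add: blade_mult flip: one_clifford_def)
  next
    case False
    then have "sym_diff {r} {s} = {r, s}" "sym_diff {s} {r} = {r, s}"
      by auto
    with False show ?thesis
      by (auto simp: blade_mult)
  qed
qed

lemma blade_eq_ordered_prod:
  fixes A :: "'n :: {finite, linorder} set"
  shows "blade A = prod_list (map gen (sorted_list_of_set A))"
proof -
  have "finite A \<Longrightarrow> ?thesis"
  proof (induction A rule: finite_linorder_min_induct)
    case empty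
    then show ?case
      by (simp add: one_clifford_def)
  next
    case (insert b A)
    then have *: "{(i, j). i \<in> {b} \<and> j \<in> A \<and> j \<le> i} = {}" "sym_diff {b} A = insert b A"
      by auto
    have "gen b * blade A = blade (insert b A)"
      unfolding blade_mult blade_sign_def * by simp
    moreover have "sorted_list_of_set (insert b A) = b # sorted_list_of_set A"
    proof -
      have "A - {b} = A"
        using insert.hyps by auto
      then show ?thesis
        using insert.hyps by (simp add: insort_is_Cons less_imp_le)
    qed
    ultimately show ?case
      using insert.IH by simp
  qed
  then show ?thesis
    by simp
qed

definition paravectors :: "'n :: {finite, linorder} clifford set" where
  "paravectors = {of_real x\<^sub>0 + (\<Sum>i\<in>UNIV. x i *\<^sub>R gen i) | x\<^sub>0 x. True}"

definition imag_sphere :: "'n :: {finite, linorder} clifford set" where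
  "imag_sphere = {(\<Sum>i\<in>UNIV. x i *\<^sub>R gen i) | x. (\<Sum>i\<in>UNIV. (x i)\<^sup>2) = 1}"

text \<open>
  The norm is not submultiplicative, so \<open>exp\<close> of the library (which needs a normed algebra) does not apply.
\<close>

definition clifford_exp :: "'n :: {finite, linorder} clifford \<Rightarrow> 'n clifford" where
  "clifford_exp a = (\<Sum>k. a ^ k /\<^sub>R fact k)"

definition left_slice_monogenic_on ::
  "'n :: {finite, linorder} clifford set \<Rightarrow> ('n clifford \<Rightarrow> 'n clifford) \<Rightarrow> bool" where
  "left_slice_monogenic_on U f \<longleftrightarrow>
    openin (top_of_set paravectors) U \<and> f differentiable_on U \<and>
    (\<forall>I\<in>imag_sphere. \<forall>u v :: real. of_real u + I * of_real v \<in> U \<longrightarrow>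
      (1 / 2) *\<^sub>R
        (vector_derivative (\<lambda>s. f (of_real s + I * of_real v)) (at u) +
         I * vector_derivative (\<lambda>t. f (of_real u + I * of_real t)) (at v)) = 0)"

definition L2_fun :: "(real \<Rightarrow> 'b :: euclidean_space) \<Rightarrow> bool" where
  "L2_fun g \<longleftrightarrow> g \<in> borel_measurable lborel \<and> integrable lborel (\<lambda>x. (norm (g x))\<^sup>2)"

definition L2_tendsto ::
  "(nat \<Rightarrow> real \<Rightarrow> 'b :: euclidean_space) \<Rightarrow> (real \<Rightarrow> 'b) \<Rightarrow> bool" where
  "L2_tendsto G g \<longleftrightarrow> (\<lambda>k. \<integral>\<^sup>+ x. ennreal ((norm (G k x - g x))\<^sup>2) \<partial>lborel) \<longlonglongrightarrow> 0"

definition clifford_fourier_L1 ::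
  "'n :: {finite, linorder} clifford \<Rightarrow> (real \<Rightarrow> 'n clifford) \<Rightarrow> real \<Rightarrow> 'n clifford" where
  "clifford_fourier_L1 I g w =
    (1 / sqrt (2 * pi)) *\<^sub>R (LINT u|lborel. clifford_exp (- (I * of_real (u * w))) * g u)"

text \<open>
  Continuous extension to \<open>L\<^sup>2\<close>: the graph of the extension is the \<open>L\<^sup>2 \<times> L\<^sup>2\<close>-closure of the graph of the
  transform on \<open>L\<^sup>1 \<inter> L\<^sup>2\<close>. The result is an \<open>L\<^sup>2\<close>-class; \<^term>\<open>clifford_fourier I g\<close> is one
  of its representatives, and is to be used only in ways that do not depend on the representative.
\<close>

definition is_clifford_fourier ::
  "'n :: {finite, linorder} clifford \<Rightarrow> (real \<Rightarrow> 'n clifford) \<Rightarrow> (real \<Rightarrow> 'n clifford) \<Rightarrow> bool" where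
  "is_clifford_fourier I g h \<longleftrightarrow> L2_fun h \<and>
    (\<exists>G. (\<forall>k. integrable lborel (G k) \<and> L2_fun (G k)) \<and> L2_tendsto G g \<and>
         L2_tendsto (\<lambda>k. clifford_fourier_L1 I (G k)) h)"

definition clifford_fourier ::
  "'n :: {finite, linorder} clifford \<Rightarrow> (real \<Rightarrow> 'n clifford) \<Rightarrow> real \<Rightarrow> 'n clifford" where
  "clifford_fourier I g = (SOME h. is_clifford_fourier I g h)"

text \<open>The support of a class of functions modulo null sets (not the closure of the non-zero set of
  a representative).\<close>

definition ess_support :: "(real \<Rightarrow> 'b :: real_normed_vector) \<Rightarrow> real set" where
  "ess_support h = - \<Union> {W. open W \<and> (AE w in lborel. w \<in> W \<longrightarrow> h w = 0)}"

end

theory Submission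
  imports Defs "HOL-Complex_Analysis.Complex_Analysis" "HOL-Real_Asymp.Real_Asymp"
begin

text \<open>
  Fix \<open>I\<close> in the sphere. Left multiplication by \<open>I\<close> turns the Clifford algebra into a complex vector
  space, and for each \<open>A\<close> the map sending \<open>a\<close> to \<open>a\<^sub>A - i (I a)\<^sub>A\<close> is a complex-linear functional on
  it; these functionals separate points. Composed with such a functional, the restriction of a slice
  monogenic function to \<open>L\<^sub>I\<close> is an entire function \<open>g\<close> in the usual sense, and the left-sided
  transform becomes the ordinary Fourier transform. The theorem is thereby reduced, uniformly in \<open>I\<close>,
  to the classical theorem of Paley and Wiener for \<open>g\<close>, whose transform on the real axis is \<open>h\<close>.

  From growth to support: by Parseval, the pairing of \<open>h\<close> with the one-sided exponential
  \<open>e\<^bsup>-w\<^esup>\<close> cut off to \<open>[b, \<infinity>)\<close> is, up to a constant, the integral over the real line of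
  \<open>G(z) = g(z) e\<^bsup>-(1 + iz)b\<^esup> / (1 + iz)\<close>. If \<open>b > B\<close>, then \<open>G\<close> decays exponentially down the negative
  imaginary axis, but in oblique directions it is only known to be of exponential type. A
  Phragmen-Lindelof damping by \<open>exp(- \<epsilon> \<zeta>\<^bsup>3/2\<^esup>)\<close>, which beats every exponential in a quadrant
  and tends to \<open>1\<close> as \<open>\<epsilon>\<close> tends to \<open>0\<close>, still permits turning both halves of the real axis onto that ray
  (\<open>quadrant_contour_rotation\<close>), where they cancel. So \<open>h e\<^bsup>-w\<^esup>\<close> has integral zero over \<open>[b, \<infinity>)\<close> for
  all \<open>b > B\<close>, whence \<open>h = 0\<close> almost everywhere beyond \<open>B\<close>. Reflection gives the other side
  (\<open>Paley_Wiener_support\<close>).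

  From support to the formula: \<open>h\<close> is integrable, being square integrable with bounded support.
  Pairing \<open>h\<close> with \<open>e\<^bsup>iaw - \<epsilon>|w|\<^esup>\<close> and \<open>g\<close> with the transform of that function, a Poisson kernel
  concentrated at \<open>a\<close>, and letting \<open>\<epsilon>\<close> tend to \<open>0\<close> gives Fourier inversion at every point of continuity.
  Both sides of the formula are entire in the argument, so they agree on the whole slice
  (\<open>Paley_Wiener_representation\<close>). The formula bounds \<open>|g(z)|\<close> by \<open>e\<^bsup>B|z|\<^esup>\<close> times the \<open>L\<^sup>1\<close> norm of \<open>h\<close>, and
  the latter is bounded in terms of \<open>B\<close> and the \<open>L\<^sup>2\<close> norm of \<open>f\<close> on the real axis, uniformly in \<open>I\<close>.

  The transform of a square integrable function is chosen from the closure of a graph, so all of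
  this says something only once that closure is known to contain a suitable pair. This is the
  inequality half of Plancherel's theorem (\<open>fourier_L1_Plancherel_le\<close>) followed by completeness of
  \<open>L\<^sup>2\<close> (\<open>L2_Riesz_Fischer_geometric\<close>).
\<close>

section \<open>Rotating a ray by a right angle\<close>

text \<open>
  A square root that is holomorphic on the closed first quadrant: the rotation centres the quadrant on the
  positive real axis, and the shift by \<open>1\<close> keeps the branch point of \<open>csqrt\<close> away from the corner.
\<close>

definition quadrant_root :: "complex \<Rightarrow> complex" where
  "quadrant_root z = csqrt (1 + cis (- pi / 4) * z)"

lemma quadrant_root_arg:
  assumes "0 \<le> Re z" "0 \<le> Im z"
  shows "0 < Re (1 + cis (- pi / 4) * z)"
    and "\<bar>Im (1 + cis (- pi / 4) * z)\<bar> \<le> Re (1 + cis (- pi / 4) * z)"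
    and "norm z \<le> norm (1 + cis (- pi / 4) * z)"
proof -
  let ?w = "1 + cis (- pi / 4) * z"
  have re: "Re ?w = 1 + (sqrt 2 / 2) * (Re z + Im z)" and im: "Im ?w = (sqrt 2 / 2) * (Im z - Re z)"
    by (simp_all add: cos_45 sin_45 algebra_simps)
  show "0 < Re ?w"
    unfolding re using assms by (simp add: add_pos_nonneg)
  have "(sqrt 2 / 2) * \<bar>Im z - Re z\<bar> \<le> (sqrt 2 / 2) * (Re z + Im z)"
    using assms by (intro mult_left_mono) auto
  moreover have "\<bar>Im ?w\<bar> = (sqrt 2 / 2) * \<bar>Im z - Re z\<bar>"
    unfolding im abs_mult by simp
  ultimately show "\<bar>Im ?w\<bar> \<le> Re ?w"
    unfolding re by linarith
  have "0 \<le> (sqrt 2 / 2) * (Re z + Im z)"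
    using assms by simp
  then have "(sqrt 2 / 2 * (Re z + Im z))\<^sup>2 \<le> (1 + sqrt 2 / 2 * (Re z + Im z))\<^sup>2"
    by (intro power_mono) auto
  moreover have "(sqrt 2 / 2 * (Re z + Im z))\<^sup>2 + (sqrt 2 / 2 * (Im z - Re z))\<^sup>2 = (Re z)\<^sup>2 + (Im z)\<^sup>2"
    by (simp add: power_mult_distrib power_divide) (simp add: power2_eq_square field_simps)
  ultimately show "norm z \<le> norm ?w"
    unfolding cmod_def re im by (intro real_sqrt_le_mono) linarith
qed

text \<open>
  The cube has order \<open>3/2\<close>, more than an exponential, and its real part is comparable with its modulus:
  the radicand has argument at most \<open>\<pi>/4\<close> in modulus, so the cube of its root has argument at most
  \<open>3\<pi>/8 < \<pi>/2\<close>. The constant is not sharp.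
\<close>

lemma quadrant_root_cube_growth:
  assumes "0 \<le> Re z" "0 \<le> Im z"
  shows "norm z * sqrt (norm z) / 12 \<le> Re (quadrant_root z ^ 3)"
proof -
  define w where "w = 1 + cis (- pi / 4) * z"
  define a b where "a = Re (csqrt w)" and "b = Im (csqrt w)"
  have s: "csqrt w = Complex a b"
    by (simp add: a_def b_def complex_eq_iff)
  have a0: "0 \<le> a"
    using csqrt_principal[of w] by (auto simp: a_def)
  have "w = Complex a b ^ 2"
    by (metis s power2_csqrt)
  then have w: "Re w = a\<^sup>2 - b\<^sup>2" "Im w = 2 * a * b"
    by (simp_all add: power2_eq_square)
  have ab: "2 * a * \<bar>b\<bar> \<le> a\<^sup>2 - b\<^sup>2"
    using quadrant_root_arg(2)[OF assms] a0 unfolding w_def[symmetric] w by (simp add: abs_mult)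
  have apos: "0 < a"
    using quadrant_root_arg(1)[OF assms] a0 unfolding w_def[symmetric] w
    by (cases "a = 0") auto
  \<comment> \<open>a crude form of \<open>tan (\<pi>/8) < 1/2\<close>; any bound below \<open>1 / sqrt 3\<close> makes \<open>a\<^sup>2 - 3 b\<^sup>2\<close> comparable with \<open>a\<^sup>2\<close>\<close>
  have b: "\<bar>b\<bar> \<le> a / 2"
  proof (rule ccontr)
    assume "\<not> ?thesis"
    then have "a < 2 * \<bar>b\<bar>" by simp
    then have "a * a < a * (2 * \<bar>b\<bar>)"
      using apos by (intro mult_strict_left_mono)
    moreover have "0 \<le> b\<^sup>2" "a * a = a\<^sup>2" "a * (2 * \<bar>b\<bar>) = 2 * a * \<bar>b\<bar>"
      by (simp_all add: power2_eq_square)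
    ultimately show False
      using ab by linarith
  qed
  have b2: "b\<^sup>2 \<le> a\<^sup>2 / 4"
    using power_mono[OF b abs_ge_zero, of 2] by (simp add: power_divide)
  have "norm w = a\<^sup>2 + b\<^sup>2"
    by (metis \<open>w = Complex a b ^ 2\<close> norm_power complex_norm real_sqrt_pow2 sum_power2_ge_zero)
  then have zw: "norm z \<le> 2 * a\<^sup>2"
    using quadrant_root_arg(3)[OF assms] b2 zero_le_power2[of a] unfolding w_def[symmetric] by linarith
  then have "sqrt (norm z) \<le> sqrt (2 * a\<^sup>2)" by simp
  then have "sqrt (norm z) \<le> sqrt 2 * a"
    using apos by (simp add: real_sqrt_mult)
  moreover have "sqrt 2 \<le> (3/2 :: real)"
    by (rule real_le_lsqrt) (auto simp: power2_eq_square)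
  ultimately have "sqrt (norm z) \<le> 3/2 * a"
    using apos by (meson mult_right_mono order.trans less_imp_le)
  then have "norm z * sqrt (norm z) \<le> (2 * a\<^sup>2) * (3/2 * a)"
    using zw apos by (intro mult_mono) auto
  then have "norm z * sqrt (norm z) / 12 \<le> a ^ 3 / 4"
    by (simp add: power2_eq_square power3_eq_cube)
  moreover have "Re (csqrt w ^ 3) = a * (a\<^sup>2 - 3 * b\<^sup>2)"
    unfolding s by (simp add: power3_eq_cube power2_eq_square algebra_simps)
  moreover have "a * (a\<^sup>2 - 3 * b\<^sup>2) \<ge> a * (a\<^sup>2 / 4)"
    using b2 apos by (intro mult_left_mono) auto
  ultimately show ?thesis
    unfolding quadrant_root_def w_def[symmetric] by (simp add: power2_eq_square power3_eq_cube)
qed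

lemma quadrant_root_holomorphic:
  "quadrant_root holomorphic_on {z. 0 \<le> Re z \<and> 0 \<le> Im z}"
proof -
  have "1 + cis (- pi / 4) * z \<notin> \<real>\<^sub>\<le>\<^sub>0" if "z \<in> {z. 0 \<le> Re z \<and> 0 \<le> Im z}" for z
    using quadrant_root_arg(1)[of z] that by (auto simp: complex_nonpos_Reals_iff simp del: plus_complex.simps)
  then show ?thesis
    unfolding quadrant_root_def by (intro holomorphic_intros) auto
qed


text \<open>
  Cauchy's theorem for the triangle with vertices \<open>0\<close>, \<open>R\<close> and \<open>iR\<close>: the hypotenuse lies between the
  circles of radius \<open>R/2\<close> and \<open>R\<close> and has length at most \<open>2R\<close>.
\<close>

lemma quadrant_contour_triangle:
  fixes Q :: "complex \<Rightarrow> complex"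
  assumes hol: "Q holomorphic_on {z. 0 \<le> Re z \<and> 0 \<le> Im z}" and R: "0 < R"
    and M: "\<And>z. 0 \<le> Re z \<Longrightarrow> 0 \<le> Im z \<Longrightarrow> R / 2 \<le> norm z \<Longrightarrow> norm z \<le> R \<Longrightarrow> norm (Q z) \<le> M"
  shows "norm ((LBINT x:{0..R}. Q (of_real x)) - \<i> * (LBINT y:{0..R}. Q (\<i> * of_real y))) \<le> 2 * R * M"
proof -
  let ?q = "{z. 0 \<le> Re z \<and> 0 \<le> Im z}"
  let ?r = "complex_of_real R"
  have cvx: "convex ?q"
    using convex_Int[OF convex_halfspace_Re_ge[of 0] convex_halfspace_Im_ge[of 0]]
    by (simp add: Int_def conj_commute)
  have hull: "convex hull {0, ?r, \<i> * ?r} \<subseteq> ?q"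
    using R cvx by (intro hull_minimal) auto
  have seg: "closed_segment ?r (\<i> * ?r) \<subseteq> ?q" "closed_segment 0 ?r \<subseteq> ?q" "closed_segment (\<i> * ?r) 0 \<subseteq> ?q"
    using R cvx by (intro closed_segment_subset; simp)+
  have cont: "continuous_on ?q Q"
    by (rule holomorphic_on_imp_continuous_on[OF hol])
  have "(Q has_contour_integral 0) (linepath 0 ?r +++ linepath ?r (\<i> * ?r) +++ linepath (\<i> * ?r) 0)"
    by (rule Cauchy_theorem_triangle, rule holomorphic_on_subset[OF hol hull])
  then have "contour_integral (linepath 0 ?r) Q + contour_integral (linepath ?r (\<i> * ?r)) Q
      + contour_integral (linepath (\<i> * ?r) 0) Q = 0"
    using has_chain_integral_chain_integral3 by blast
  moreover have "contour_integral (linepath (\<i> * ?r) 0) Q = - contour_integral (linepath 0 (\<i> * ?r)) Q"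
    by (rule contour_integral_reverse_linepath)
       (use seg(3) cont continuous_on_subset in \<open>auto simp: closed_segment_commute\<close>)
  moreover have "contour_integral (linepath 0 ?r) Q = integral {0..R} (\<lambda>x. Q (of_real x))"
    by (subst contour_integral_linepath_Reals_eq) (use R in auto)
  moreover have "contour_integral (linepath 0 (\<i> * ?r)) Q = \<i> * integral {0..R} (\<lambda>y. Q (\<i> * of_real y))"
    by (subst contour_integral_linepath_same_Re[where c = 0 and a = 0 and b = R])
       (use R in \<open>auto simp: Complex_eq\<close>)
  moreover have "(LBINT x:{0..R}. Q (of_real x)) = integral {0..R} (\<lambda>x. Q (of_real x))"
    by (intro set_borel_integral_eq_integral borel_integrable_atLeastAtMost' continuous_on_compose2[OF cont] continuous_intros) auto
  moreover have "(LBINT x:{0..R}. Q (\<i> * of_real x)) = integral {0..R} (\<lambda>x. Q (\<i> * of_real x))"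
    by (intro set_borel_integral_eq_integral borel_integrable_atLeastAtMost' continuous_on_compose2[OF cont] continuous_intros) auto
  ultimately have eq: "(LBINT x:{0..R}. Q (of_real x)) - \<i> * (LBINT y:{0..R}. Q (\<i> * of_real y))
      = - contour_integral (linepath ?r (\<i> * ?r)) Q"
    by (simp add: algebra_simps add_eq_0_iff)
  have "norm (contour_integral (linepath ?r (\<i> * ?r)) Q) \<le> M * norm (\<i> * ?r - ?r)"
  proof (rule contour_integral_bound_linepath)
    show "Q contour_integrable_on linepath ?r (\<i> * ?r)"
      by (rule contour_integrable_continuous_linepath[OF continuous_on_subset[OF cont seg(1)]])
    show "0 \<le> M"
      using M[of ?r] R norm_ge_zero[of "Q ?r"] by (auto simp del: norm_ge_zero)
    fix z assume z: "z \<in> closed_segment ?r (\<i> * ?r)"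
    then have pos: "0 \<le> Re z" "0 \<le> Im z"
      using seg(1) by auto
    obtain u where u: "z = (1 - u) *\<^sub>R ?r + u *\<^sub>R (\<i> * ?r)" "0 \<le> u" "u \<le> 1"
      using z by (auto simp: in_segment)
    have sum: "Re z + Im z = R"
      by (simp add: u(1) algebra_simps)
    have "norm z \<le> R"
      using cmod_le[of z] pos sum by simp
    moreover have "R / 2 \<le> norm z"
      using abs_Re_le_cmod[of z] abs_Im_le_cmod[of z] sum by linarith
    ultimately show "norm (Q z) \<le> M"
      using M pos by blast
  qed
  also have "norm (\<i> * ?r - ?r) \<le> 2 * R"
    using norm_triangle_ineq4[of "\<i> * ?r" ?r] R by (simp add: norm_mult)
  then have "M * norm (\<i> * ?r - ?r) \<le> M * (2 * R)"
    using M[of ?r] R norm_ge_zero[of "Q ?r"] by (intro mult_left_mono) (auto simp del: norm_ge_zero)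
  finally show ?thesis
    unfolding eq by (simp add: mult_ac)
qed

text \<open>
  The hypotenuse of the triangle contributes nothing in the limit, because the term \<open>e |z|\<^bsup>3/2\<^esup>\<close> in the
  exponent eventually dominates \<open>K |z|\<close>.
\<close>

lemma quadrant_rotation_superexponential_decay:
  fixes Q :: "complex \<Rightarrow> complex"
  assumes hol: "Q holomorphic_on {z. 0 \<le> Re z \<and> 0 \<le> Im z}" and e: "0 < e"
    and bound: "\<And>z. 0 \<le> Re z \<Longrightarrow> 0 \<le> Im z \<Longrightarrow>
      norm (Q z) \<le> C * exp (K * norm z - e * (norm z * sqrt (norm z)))"
    and K: "0 \<le> K"
    and int: "set_integrable lborel {0..} (\<lambda>x. Q (of_real x))"
      "set_integrable lborel {0..} (\<lambda>y. Q (\<i> * of_real y))"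
  shows "(LBINT x:{0..}. Q (of_real x)) = \<i> * (LBINT y:{0..}. Q (\<i> * of_real y))"
proof -
  let ?D = "\<lambda>R. (LBINT x:{0..R}. Q (of_real x)) - \<i> * (LBINT y:{0..R}. Q (\<i> * of_real y))"
  let ?b = "\<lambda>R::real. 2 * R * (C * exp (K * R - e * (R / 2 * sqrt (R / 2))))"
  have C: "0 \<le> C"
    using bound[of 0] norm_ge_zero[of "Q 0"] by (auto simp del: norm_ge_zero)
  have lim1: "(?D \<longlongrightarrow> (LBINT x:{0..}. Q (of_real x)) - \<i> * (LBINT y:{0..}. Q (\<i> * of_real y))) at_top"
    by (intro tendsto_intros tendsto_set_lebesgue_integral_at_top int) auto
  have "norm (?D R) \<le> ?b R" if "0 < R" for R
  proof (rule quadrant_contour_triangle[OF hol that])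
    fix z assume z: "0 \<le> Re z" "0 \<le> Im z" "R / 2 \<le> norm z" "norm z \<le> R"
    have "R / 2 * sqrt (R / 2) \<le> norm z * sqrt (norm z)"
      using z that by (intro mult_mono) auto
    then have "K * norm z - e * (norm z * sqrt (norm z)) \<le> K * R - e * (R / 2 * sqrt (R / 2))"
      using K e z(4) by (intro diff_mono mult_left_mono) auto
    then have "C * exp (K * norm z - e * (norm z * sqrt (norm z))) \<le> C * exp (K * R - e * (R / 2 * sqrt (R / 2)))"
      using C by (intro mult_left_mono) auto
    then show "norm (Q z) \<le> C * exp (K * R - e * (R / 2 * sqrt (R / 2)))"
      using bound[OF z(1,2)] by linarith
  qed
  then have "eventually (\<lambda>R. norm (?D R) \<le> ?b R) at_top"
    by (rule eventually_mono[OF eventually_gt_at_top[of 0]])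
  moreover have "(?b \<longlongrightarrow> 0) at_top"
    using e by real_asymp
  ultimately have "(?D \<longlongrightarrow> 0) at_top"
    by (rule Lim_null_comparison)
  from tendsto_unique[OF _ lim1 this] show ?thesis
    by simp
qed

text \<open>
  A form of the Phragmen-Lindelof principle: exponential type inside the quadrant is harmless as soon as
  the two boundary integrals converge absolutely. After damping by \<open>exp(- \<epsilon> q\<^sup>3)\<close>, with \<open>q\<close> the root
  above, the previous lemma applies. The damping factor has modulus at most \<open>1\<close> in the quadrant
  and tends to \<open>1\<close> as \<open>\<epsilon>\<close> tends to \<open>0\<close>, so it disappears by dominated convergence on both rays.
\<close>

lemma quadrant_contour_rotation:
  fixes P :: "complex \<Rightarrow> complex"
  assumes hol: "P holomorphic_on {z. 0 \<le> Re z \<and> 0 \<le> Im z}"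
    and bound: "\<And>z. 0 \<le> Re z \<Longrightarrow> 0 \<le> Im z \<Longrightarrow> norm (P z) \<le> C * exp (K * norm z)"
    and K: "0 \<le> K"
    and int: "set_integrable lborel {0..} (\<lambda>x. P (of_real x))"
      "set_integrable lborel {0..} (\<lambda>y. P (\<i> * of_real y))"
  shows "(LBINT x:{0..}. P (of_real x)) = \<i> * (LBINT y:{0..}. P (\<i> * of_real y))"
proof -
  let ?q = "{z. 0 \<le> Re z \<and> 0 \<le> Im z}"
  define E where "E n z = exp (- (of_real (inverse (Suc n)) * quadrant_root z ^ 3))" for n :: nat and z
  have holE: "E n holomorphic_on ?q" for n
    unfolding E_def by (intro holomorphic_intros quadrant_root_holomorphic)
  have re_scale: "Re (of_real c * z) = c * Re z" for c z
    by simp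
  have normE: "norm (E n z) = exp (- (inverse (Suc n) * Re (quadrant_root z ^ 3)))" for n z
    by (simp only: E_def norm_exp_eq_Re uminus_complex.simps re_scale)
  have Ele: "norm (E n z) \<le> exp (- (inverse (Suc n) / 12 * (norm z * sqrt (norm z))))" if "z \<in> ?q" for n z
    using quadrant_root_cube_growth[of z] that unfolding normE by (simp add: field_simps del: of_nat_Suc)
  have E1: "norm (E n z) \<le> 1" if "z \<in> ?q" for n z
    by (rule order.trans[OF Ele[OF that]]) (simp del: of_nat_Suc)
  have Elim: "(\<lambda>n. E n z) \<longlonglongrightarrow> 1" for z
  proof -
    have "(\<lambda>n. exp (- (of_real (inverse (Suc n)) * quadrant_root z ^ 3))) \<longlonglongrightarrow> exp (- (of_real 0 * quadrant_root z ^ 3))"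
      by (intro tendsto_intros LIMSEQ_inverse_real_of_nat)
    then show ?thesis by (simp add: E_def)
  qed
  have ray: "set_integrable lborel {0..} (\<lambda>x. P (c * of_real x) * E n (c * of_real x))"
    "(\<lambda>n. LBINT x:{0..}. P (c * of_real x) * E n (c * of_real x)) \<longlonglongrightarrow> (LBINT x:{0..}. P (c * of_real x))"
    if c: "c = 1 \<or> c = \<i>" and i: "set_integrable lborel {0..} (\<lambda>x. P (c * of_real x))" for c n
  proof -
    have cq: "c * of_real x \<in> ?q" if "x \<in> {0..}" for x
      using c that by auto
    have comp: "continuous_on {0..} (\<lambda>x. H (c * of_real x))" if "H holomorphic_on ?q" for H
    proof (rule continuous_on_compose2[OF holomorphic_on_imp_continuous_on[OF that]])
      show "continuous_on {0..} (\<lambda>x. c * complex_of_real x)"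
        by (intro continuous_intros)
      show "(\<lambda>x. c * complex_of_real x) ` {0..} \<subseteq> ?q"
        using cq by blast
    qed
    have "continuous_on {0..} (\<lambda>x. P (c * of_real x) * E n (c * of_real x))" for n
      by (intro continuous_on_mult comp hol holE)
    then have m: "set_borel_measurable borel {0..} (\<lambda>x. P (c * of_real x) * E n (c * of_real x))" for n
      unfolding set_borel_measurable_def by (intro borel_measurable_continuous_on_indicator) auto
    have le: "norm (P (c * of_real x) * E n (c * of_real x)) \<le> norm (P (c * of_real x))" if "x \<in> {0..}" for x n
      using E1[OF cq[OF that]] by (simp add: norm_mult mult_left_le)
    show "set_integrable lborel {0..} (\<lambda>x. P (c * of_real x) * E n (c * of_real x))"
      by (rule set_integrable_bound[OF i]) (use m le in \<open>auto simp: set_borel_measurable_def\<close>)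
    show "(\<lambda>n. LBINT x:{0..}. P (c * of_real x) * E n (c * of_real x)) \<longlonglongrightarrow> (LBINT x:{0..}. P (c * of_real x))"
      unfolding set_lebesgue_integral_def
    proof (rule integral_dominated_convergence)
      show "integrable lborel (\<lambda>x. norm (indicator {0..} x *\<^sub>R P (c * of_real x)))"
        using i unfolding set_integrable_def by (rule integrable_norm)
      show "(\<lambda>x. indicator {0..} x *\<^sub>R P (c * of_real x)) \<in> borel_measurable lborel"
        using i unfolding set_integrable_def by (rule borel_measurable_integrable)
      show "(\<lambda>x. indicator {0..} x *\<^sub>R (P (c * of_real x) * E n (c * of_real x))) \<in> borel_measurable lborel" for n
        using m[of n] by (simp add: set_borel_measurable_def)
      show "AE x in lborel. (\<lambda>n. indicator {0..} x *\<^sub>R (P (c * of_real x) * E n (c * of_real x)))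
          \<longlonglongrightarrow> indicator {0..} x *\<^sub>R P (c * of_real x)"
        by (intro AE_I2 tendsto_scaleR tendsto_const tendsto_eq_rhs[OF tendsto_mult[OF tendsto_const Elim]]) simp
      show "AE x in lborel. norm (indicator {0..} x *\<^sub>R (P (c * of_real x) * E n (c * of_real x)))
          \<le> norm (indicator {0..} x *\<^sub>R P (c * of_real x))" for n
        using le[of _ n] by (intro AE_I2) (auto simp: indicator_def)
    qed
  qed
  have "(LBINT x:{0..}. P (of_real x) * E n (of_real x)) = \<i> * (LBINT y:{0..}. P (\<i> * of_real y) * E n (\<i> * of_real y))" for n
  proof (rule quadrant_rotation_superexponential_decay[where e = "inverse (Suc n) / 12", OF _ _ _ K])
    show "(\<lambda>z. P z * E n z) holomorphic_on ?q"
      by (intro holomorphic_intros hol holE)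
    show "0 < inverse (real (Suc n)) / 12" by simp
    fix z assume z: "0 \<le> Re z" "0 \<le> Im z"
    have "norm (P z * E n z) \<le> (C * exp (K * norm z)) * exp (- (inverse (Suc n) / 12 * (norm z * sqrt (norm z))))"
      unfolding norm_mult using z
      by (intro mult_mono bound Ele) (auto intro: order.trans[OF norm_ge_zero bound])
    then show "norm (P z * E n z) \<le> C * exp (K * norm z - inverse (Suc n) / 12 * (norm z * sqrt (norm z)))"
      by (simp only: diff_conv_add_uminus exp_add mult.assoc)
  qed (use ray(1)[of 1 n] ray(1)[of \<i> n] int in simp_all)
  then have "(\<lambda>n. LBINT x:{0..}. P (of_real x) * E n (of_real x)) \<longlonglongrightarrow> \<i> * (LBINT y:{0..}. P (\<i> * of_real y))"
    using tendsto_mult_left[OF ray(2)[of \<i>], of \<i>] int by simp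
  moreover have "(\<lambda>n. LBINT x:{0..}. P (of_real x) * E n (of_real x)) \<longlonglongrightarrow> (LBINT x:{0..}. P (of_real x))"
    using ray(2)[of 1] int by simp
  ultimately show ?thesis
    using LIMSEQ_unique by blast
qed

section \<open>One-sided exponentials and the Poisson kernel\<close>

lemma integral_exp_decay_atLeast:
  fixes c :: complex and b :: real
  assumes c: "0 < Re c"
  shows "set_integrable lborel {b..} (\<lambda>w. exp (- (c * of_real w)))"
    and "(LBINT w:{b..}. exp (- (c * of_real w))) = exp (- (c * of_real b)) / c"
proof -
  have c0: "c \<noteq> 0" using c by auto
  have "(\<integral>\<^sup>+w. ennreal (exp (- (Re c * w))) * indicator {b..} w \<partial>lborel) = ennreal (0 - - (exp (- (Re c * b)) / Re c))"
  proof (rule nn_integral_FTC_atLeast[where F = "\<lambda>w. - (exp (- (Re c * w)) / Re c)"])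
    show "((\<lambda>w. - (exp (- (Re c * w)) / Re c)) \<longlongrightarrow> 0) at_top"
      using c by real_asymp
  qed (use c in \<open>auto intro!: derivative_eq_intros\<close>)
  also have "(\<integral>\<^sup>+w. ennreal (exp (- (Re c * w))) * indicator {b..} w \<partial>lborel)
      = (\<integral>\<^sup>+w. ennreal (norm (indicator {b..} w *\<^sub>R exp (- (c * of_real w)))) \<partial>lborel)"
    by (intro nn_integral_cong) (auto simp: indicator_def)
  finally show int: "set_integrable lborel {b..} (\<lambda>w. exp (- (c * of_real w)))"
    unfolding set_integrable_def by (intro integrableI_bounded) auto
  have fin: "(LBINT w:{b..R}. exp (- (c * of_real w))) = (exp (- (c * of_real b)) - exp (- (c * of_real R))) / c"
    if "b \<le> R" for R
  proof -
    have "(\<integral>w. indicator {b..R} w *\<^sub>R exp (- (c * of_real w)) \<partial>lborel)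
        = - (exp (- (c * of_real R)) / c) - - (exp (- (c * of_real b)) / c)"
    proof (rule integral_FTC_Icc[OF that])
      show "((\<lambda>w. - (exp (- (c * of_real w)) / c)) has_vector_derivative exp (- (c * of_real x))) (at x within {b..R})" for x
        using c0 by (auto intro!: derivative_eq_intros has_vector_derivative_real_field)
    qed (auto intro!: continuous_intros)
    then show ?thesis
      using c0 by (simp add: set_lebesgue_integral_def diff_divide_distrib)
  qed
  have "((\<lambda>R. (exp (- (c * of_real b)) - exp (- (c * of_real R))) / c) \<longlongrightarrow> (exp (- (c * of_real b)) - 0) / c) at_top"
  proof (intro tendsto_intros c0)
    have "((\<lambda>R. exp (- (Re c * R))) \<longlongrightarrow> 0) at_top"
      using c by real_asymp
    then show "((\<lambda>R. exp (- (c * complex_of_real R))) \<longlongrightarrow> 0) at_top"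
      by (subst tendsto_norm_zero_iff[symmetric]) simp
  qed
  then have "((\<lambda>R. LBINT w:{b..R}. exp (- (c * of_real w))) \<longlongrightarrow> exp (- (c * of_real b)) / c) at_top"
    by (subst tendsto_cong[OF eventually_mono[OF eventually_ge_at_top[of b] fin]]) simp_all
  moreover have "((\<lambda>R. LBINT w:{b..R}. exp (- (c * of_real w))) \<longlongrightarrow> (LBINT w:{b..}. exp (- (c * of_real w)))) at_top"
    by (rule tendsto_set_lebesgue_integral_at_top[OF _ int]) simp
  ultimately show "(LBINT w:{b..}. exp (- (c * of_real w))) = exp (- (c * of_real b)) / c"
    using tendsto_unique[OF trivial_limit_at_top_linorder] by blast
qed

text \<open>
  The Poisson kernel of the upper half-plane at height \<open>e\<close>.
\<close>

definition poisson_kernel :: "real \<Rightarrow> real \<Rightarrow> real" where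
  "poisson_kernel e x = e / (pi * (e\<^sup>2 + x\<^sup>2))"

lemma poisson_kernel_nonneg: "0 < e \<Longrightarrow> 0 \<le> poisson_kernel e x"
  by (simp add: poisson_kernel_def)

lemma poisson_kernel_measurable [measurable]: "poisson_kernel e \<in> borel_measurable borel"
  unfolding poisson_kernel_def by measurable

lemma poisson_kernel_commute: "poisson_kernel e (x - y) = poisson_kernel e (y - x)"
  by (simp add: poisson_kernel_def power2_commute)

lemma nn_integral_poisson_kernel:
  assumes e: "0 < e"
  shows "(\<integral>\<^sup>+x. ennreal (poisson_kernel e (x - a)) \<partial>lborel) = 1"
proof -
  have pos: "e\<^sup>2 + x\<^sup>2 > 0" for x :: real
    using e by (simp add: add_pos_nonneg)
  have half: "(\<integral>\<^sup>+x. ennreal (poisson_kernel e x) * indicator {0..} x \<partial>lborel) = ennreal (1 / 2)"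
  proof -
    have "(\<integral>\<^sup>+x. ennreal (poisson_kernel e x) * indicator {0..} x \<partial>lborel) = 1 / 2 - arctan (0 / e) / pi"
    proof (rule nn_integral_FTC_atLeast)
      show "((\<lambda>x. arctan (x / e) / pi) \<longlongrightarrow> 1 / 2) at_top"
        using e by real_asymp
      show "((\<lambda>x. arctan (x / e) / pi) has_real_derivative poisson_kernel e x) (at x)" for x
      proof -
        have "1 + (x / e)\<^sup>2 = (e\<^sup>2 + x\<^sup>2) / e\<^sup>2"
          using e by (simp add: field_simps)
        then have "inverse (1 + (x / e)\<^sup>2) * (1 / e) / pi = poisson_kernel e x"
          using e pos[of x] by (simp add: poisson_kernel_def power2_eq_square)
        moreover have "((\<lambda>x. arctan (x / e) / pi) has_real_derivative inverse (1 + (x / e)\<^sup>2) * (1 / e) / pi) (at x)"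
          using e by (auto intro!: derivative_eq_intros)
        ultimately show ?thesis by simp
      qed
    qed (use e poisson_kernel_nonneg in auto)
    then show ?thesis by simp
  qed
  have "(\<integral>\<^sup>+x. ennreal (poisson_kernel e (x - a)) \<partial>lborel) = (\<integral>\<^sup>+x. ennreal (poisson_kernel e x) \<partial>lborel)"
    using nn_integral_real_affine[of "\<lambda>x. ennreal (poisson_kernel e (x - a))" 1 a] by simp
  also have "\<dots> = (\<integral>\<^sup>+x. ennreal (poisson_kernel e x) * indicator {0..} x + ennreal (poisson_kernel e x) * indicator {..0} x \<partial>lborel)"
    by (rule nn_integral_cong_AE, rule AE_mp[OF AE_lborel_singleton[of 0]], rule AE_I2) (auto simp: indicator_def)
  also have "\<dots> = (\<integral>\<^sup>+x. ennreal (poisson_kernel e x) * indicator {0..} x \<partial>lborel) + (\<integral>\<^sup>+x. ennreal (poisson_kernel e x) * indicator {..0} x \<partial>lborel)"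
    by (rule nn_integral_add) auto
  also have "(\<integral>\<^sup>+x. ennreal (poisson_kernel e x) * indicator {..0} x \<partial>lborel) = (\<integral>\<^sup>+x. ennreal (poisson_kernel e x) * indicator {0..} x \<partial>lborel)"
    by (subst nn_integral_real_affine[where c = "-1" and t = 0])
       (auto intro!: nn_integral_cong simp: poisson_kernel_def indicator_def)
  finally show ?thesis
    unfolding half by (subst (asm) ennreal_plus[symmetric]) auto
qed

lemma integrable_poisson_kernel:
  assumes "0 < e"
  shows "integrable lborel (\<lambda>x. poisson_kernel e (x - a))" and "(LBINT x. poisson_kernel e (x - a)) = 1"
proof -
  show "integrable lborel (\<lambda>x. poisson_kernel e (x - a))"
    using assms by (intro integrableI_nonneg) (auto simp: nn_integral_poisson_kernel poisson_kernel_nonneg)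
  then show "(LBINT x. poisson_kernel e (x - a)) = 1"
    using nn_integral_eq_integral[of lborel "\<lambda>x. poisson_kernel e (x - a)"] assms
    by (simp add: nn_integral_poisson_kernel poisson_kernel_nonneg)
qed

section \<open>The Fourier transform of integrable functions\<close>

definition fourier_L1 :: "(real \<Rightarrow> complex) \<Rightarrow> real \<Rightarrow> complex" where
  "fourier_L1 g w = (1 / sqrt (2 * pi)) *\<^sub>R (LINT u|lborel. exp (- (\<i> * of_real (u * w))) * g u)"

lemma fourier_L1_measurable [measurable]:
  assumes [measurable]: "g \<in> borel_measurable borel"
  shows "fourier_L1 g \<in> borel_measurable borel"
  unfolding fourier_L1_def by measurable

lemma integrable_exp_i_mult:
  assumes "integrable lborel g"
  shows "integrable lborel (\<lambda>u. exp (- (\<i> * of_real (u * w))) * g u)"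
  by (rule Bochner_Integration.integrable_bound[OF assms]) (use assms in \<open>auto simp: norm_mult\<close>)

lemma norm_fourier_L1_le: 
  assumes "integrable lborel g"
  shows "norm (fourier_L1 g w) \<le> (LBINT u. norm (g u))"
proof -
  have "sqrt 1 \<le> sqrt (2 * pi)"
    using pi_gt3 by (intro real_sqrt_le_mono) simp
  then have "1 / sqrt (2 * pi) \<le> 1"
    by simp
  then have "norm (fourier_L1 g w) \<le> norm (LINT u|lborel. exp (- (\<i> * of_real (u * w))) * g u)"
    unfolding fourier_L1_def norm_scaleR by (intro mult_left_le_one_le) auto
  also have "\<dots> \<le> (LBINT u. norm (exp (- (\<i> * of_real (u * w))) * g u))"
    by (rule integral_norm_bound)
  finally show ?thesis
    by (simp add: norm_mult)
qed

lemma integrable_bounded_mult: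
  fixes f g :: "real \<Rightarrow> complex"
  assumes [measurable]: "f \<in> borel_measurable borel" and "\<And>x. norm (f x) \<le> M" and g: "integrable lborel g"
  shows "integrable lborel (\<lambda>x. f x * g x)"
proof (rule Bochner_Integration.integrable_bound)
  show "integrable lborel (\<lambda>x. M * norm (g x))"
    using g by auto
  show "AE x in lborel. norm (f x * g x) \<le> norm (M * norm (g x))"
    using assms(2) by (intro AE_I2) (auto simp: norm_mult abs_mult intro!: mult_right_mono order.trans[OF assms(2)])
qed (use g in auto)

text \<open>
  Fubini: both sides are the double integral of the kernel against \<open>g(u) k(w)\<close>. This identity stands in for
  Parseval's formula throughout, since it survives passage to \<open>L\<^sup>2\<close> limits.
\<close>

lemma fourier_L1_multiplication_formula:
  assumes g: "integrable lborel g" and k: "integrable lborel k"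
  shows "(LBINT w. fourier_L1 g w * k w) = (LBINT u. g u * fourier_L1 k u)"
proof -
  have [measurable]: "g \<in> borel_measurable borel" "k \<in> borel_measurable borel"
    using g k by auto
  let ?f = "\<lambda>u w. exp (- (\<i> * of_real (u * w))) * g u * k w"
  have int: "integrable (lborel \<Otimes>\<^sub>M lborel) (case_prod ?f)"
  proof (rule lborel_pair.Fubini_integrable)
    have "integrable lborel (\<lambda>u. norm (g u) * (LBINT w. norm (k w)))"
      using g by auto
    then show "integrable lborel (\<lambda>u. LBINT w. norm (case (u, w) of (u, w) \<Rightarrow> ?f u w))"
      by (simp add: norm_mult)
    show "AE u in lborel. integrable lborel (\<lambda>w. case (u, w) of (u, w) \<Rightarrow> ?f u w)"
    proof (rule AE_I2)
      fix u
      have "integrable lborel (\<lambda>w. g u * (exp (- (\<i> * of_real (w * u))) * k w))"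
        by (intro integrable_mult_right integrable_exp_i_mult k)
      then show "integrable lborel (\<lambda>w. case (u, w) of (u, w) \<Rightarrow> ?f u w)"
        by (simp add: mult_ac)
    qed
  qed measurable
  have "(LBINT w. fourier_L1 g w * k w) = (1 / sqrt (2 * pi)) *\<^sub>R (LBINT w. LBINT u. ?f u w)"
    unfolding fourier_L1_def by (subst integral_scaleR_right[symmetric]) simp
  also have "(LBINT w. LBINT u. ?f u w) = (LBINT u. LBINT w. ?f u w)"
    by (rule lborel_pair.Fubini_integral[OF int])
  also have "\<dots> = (LBINT u. g u * (LBINT w. exp (- (\<i> * of_real (w * u))) * k w))"
  proof (rule Bochner_Integration.integral_cong[OF refl])
    fix u
    have "(LBINT w. ?f u w) = (LBINT w. g u * (exp (- (\<i> * of_real (w * u))) * k w))"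
      by (simp add: mult_ac)
    then show "(LBINT w. ?f u w) = g u * (LBINT w. exp (- (\<i> * of_real (w * u))) * k w)"
      by simp
  qed
  also have "(1 / sqrt (2 * pi)) *\<^sub>R \<dots> = (LBINT u. g u * fourier_L1 k u)"
    unfolding fourier_L1_def by (subst integral_scaleR_right[symmetric]) simp
  finally show ?thesis .
qed

text \<open>
  Test functions whose transforms are translated Poisson kernels. They serve twice: to prove Plancherel's
  inequality and to invert the transform.
\<close>

definition modulated_exp :: "real \<Rightarrow> real \<Rightarrow> real \<Rightarrow> complex" where
  "modulated_exp e a w = exp (\<i> * of_real (a * w)) * of_real (exp (- e * \<bar>w\<bar>))"

lemma modulated_exp_measurable [measurable]: "modulated_exp e a \<in> borel_measurable borel"
  unfolding modulated_exp_def by measurable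

lemma norm_modulated_exp: "norm (modulated_exp e a w) = exp (- e * \<bar>w\<bar>)"
  by (simp add: modulated_exp_def norm_mult)

text \<open>
  Up to the null set \<open>{0}\<close> the function is a sum of two one-sided exponentials, and
  \<open>1 / (e + it) + 1 / (e - it) = 2e / (e\<^sup>2 + t\<^sup>2)\<close>.
\<close>

lemma modulated_exp_fourier:
  assumes e: "0 < e"
  shows "integrable lborel (modulated_exp e a)"
    and "fourier_L1 (modulated_exp e a) x = of_real (sqrt (2 * pi) * poisson_kernel e (x - a))"
proof -
  define f where "f c w = indicator {0..} w *\<^sub>R exp (- (c * of_real w))" for c :: complex and w :: real
  have f: "integrable lborel (f c)" "integral\<^sup>L lborel (f c) = 1 / c" if "0 < Re c" for c
    using integral_exp_decay_atLeast[OF that, of 0]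
    by (simp_all add: f_def[abs_def] set_integrable_def set_lebesgue_integral_def)
  have fm: "integrable lborel (\<lambda>w. f c (- w))" "(LBINT w. f c (- w)) = 1 / c" if "0 < Re c" for c
    using lborel_integrable_real_affine[OF f(1)[OF that], of "-1" 0]
      lborel_integral_real_affine[of "-1" "f c" 0] f(2)[OF that] by simp_all
  let ?t = "x - a"
  let ?c = "Complex e ?t" and ?d = "Complex e (- ?t)"
  have split: "AE w in lborel. exp (- (\<i> * of_real (w * x))) * modulated_exp e a w = f (Complex e (x - a)) w + f (Complex e (a - x)) (- w)" for x
  proof (rule AE_mp[OF AE_lborel_singleton[of 0]], rule AE_I2, rule impI)
    fix w :: real assume "w \<noteq> 0"
    have "exp (- (\<i> * of_real (w * x))) * modulated_exp e a w = exp (- (\<i> * of_real (w * x)) + \<i> * of_real (a * w) + of_real (- e * \<bar>w\<bar>))"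
      unfolding modulated_exp_def exp_of_real[symmetric] mult_exp_exp by (simp add: algebra_simps)
    also have "\<dots> = f (Complex e (x - a)) w + f (Complex e (a - x)) (- w)"
      using \<open>w \<noteq> 0\<close> by (auto simp: f_def indicator_def Complex_eq algebra_simps)
    finally show "exp (- (\<i> * of_real (w * x))) * modulated_exp e a w = f (Complex e (x - a)) w + f (Complex e (a - x)) (- w)" .
  qed
  have int: "integrable lborel (\<lambda>w. f (Complex e (x - a)) w + f (Complex e (a - x)) (- w))" for x
    using e by (intro Bochner_Integration.integrable_add f fm) auto
  have "integrable lborel (\<lambda>w. exp (- (\<i> * of_real (w * 0))) * modulated_exp e a w)"
    by (subst integrable_cong_AE[OF _ _ split]) (use int[of 0] in auto)
  then show "integrable lborel (modulated_exp e a)" by simp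
  have "(LBINT w. exp (- (\<i> * of_real (w * x))) * modulated_exp e a w) = (LBINT w. f (Complex e (x - a)) w + f (Complex e (a - x)) (- w))"
    by (rule integral_cong_AE[OF _ _ split]) (use int[of x] in auto)
  also have "\<dots> = 1 / Complex e (x - a) + 1 / Complex e (a - x)"
    using e by (subst Bochner_Integration.integral_add) (auto intro!: f fm simp: f(2) fm(2))
  also have "\<dots> = of_real (2 * pi * poisson_kernel e (x - a))"
  proof -
    have nz: "Complex e (x - a) \<noteq> 0" "Complex e (a - x) \<noteq> 0"
      using e by (auto simp: complex_eq_iff)
    have "Complex e (x - a) * Complex e (a - x) = of_real (e\<^sup>2 + (x - a)\<^sup>2)"
      by (simp add: complex_eq_iff power2_eq_square algebra_simps)
    moreover have "Complex e (x - a) + Complex e (a - x) = of_real (2 * e)"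
      by (simp add: complex_eq_iff)
    ultimately have "1 / Complex e (x - a) + 1 / Complex e (a - x) = of_real (2 * e) / of_real (e\<^sup>2 + (x - a)\<^sup>2)"
      using nz by (metis add_frac_eq add.commute mult_1)
    also have "\<dots> = of_real (2 * pi * poisson_kernel e (x - a))"
      by (simp add: poisson_kernel_def)
    finally show ?thesis .
  qed
  finally show "fourier_L1 (modulated_exp e a) x = of_real (sqrt (2 * pi) * poisson_kernel e (x - a))"
    unfolding fourier_L1_def by (simp add: scaleR_conv_of_real real_div_sqrt field_simps flip: of_real_mult)
qed

lemma norm_integral_le_nn_integral:
  fixes f :: "'a \<Rightarrow> 'b :: {banach, second_countable_topology}"
  shows "ennreal (norm (integral\<^sup>L M f)) \<le> (\<integral>\<^sup>+x. ennreal (norm (f x)) \<partial>M)"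
  by (cases "integrable M f") (auto intro: integral_norm_bound_ennreal simp: not_integrable_integral_eq)

lemma cnj_fourier_L1: "cnj (fourier_L1 g w) = fourier_L1 (\<lambda>u. cnj (g u)) (- w)"
proof -
  have "cnj (LINT u|lborel. exp (- (\<i> * of_real (u * w))) * g u) = (LINT u|lborel. cnj (exp (- (\<i> * of_real (u * w))) * g u))"
    by (rule Bochner_Integration.integral_cnj[symmetric])
  then show ?thesis
    unfolding fourier_L1_def by (simp add: exp_cnj)
qed

lemma borel_measurable_cnj [measurable]: "cnj \<in> borel_measurable borel"
  by (intro borel_measurable_continuous_onI continuous_intros)

section \<open>Plancherel's inequality and completeness\<close>

text \<open>
  Two uses of the multiplication formula rewrite the left-hand side as the double integral of
  \<open>g(x) cnj (g(y)) P(y - x)\<close> with a Poisson kernel \<open>P\<close>. Since \<open>|g(x) g(y)| \<le> |g(x)|\<^sup>2/2 + |g(y)|\<^sup>2/2\<close> and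
  \<open>P\<close> has total mass \<open>1\<close> in either variable, this is at most the right-hand side.
\<close>

lemma fourier_L1_Plancherel_damped:
  assumes g: "integrable lborel g" and e: "0 < e"
  shows "(\<integral>\<^sup>+w. ennreal ((norm (fourier_L1 g w))\<^sup>2 * exp (- e * \<bar>w\<bar>)) \<partial>lborel)
    \<le> (\<integral>\<^sup>+x. ennreal ((norm (g x))\<^sup>2) \<partial>lborel)"
proof -
  have [measurable]: "g \<in> borel_measurable borel"
    using g by auto
  let ?F = "fourier_L1 g"
  \<comment> \<open>chosen so that \<open>?F w * k w\<close> is the integrand on the left-hand side\<close>
  define k where "k w = cnj (?F w) * of_real (exp (- e * \<bar>w\<bar>))" for w
  have m0: "integrable lborel (\<lambda>w. of_real (exp (- e * \<bar>w\<bar>)) :: complex)"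
    using modulated_exp_fourier(1)[OF e, of 0] by (simp add: modulated_exp_def[abs_def])
  have int: "integrable lborel k" 
    unfolding k_def by (rule integrable_bounded_mult[OF _ _ m0, where M = "LBINT u. norm (g u)"])
      (auto intro: norm_fourier_L1_le[OF g])
  have Fk: "fourier_L1 k x = (LBINT y. cnj (g y) * of_real (poisson_kernel e (y - x)))" for x
  proof -
    have "(LBINT u. exp (- (\<i> * of_real (u * x))) * k u) = (LBINT u. fourier_L1 (\<lambda>u. cnj (g u)) (- u) * modulated_exp e (- x) u)"
      by (intro Bochner_Integration.integral_cong refl) (simp add: k_def cnj_fourier_L1 modulated_exp_def mult_ac)
    also have "\<dots> = (LBINT u. fourier_L1 (\<lambda>u. cnj (g u)) u * modulated_exp e x u)"
      by (subst lborel_integral_real_affine[where c = "-1" and t = 0]) (auto simp: modulated_exp_def)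
    also have "\<dots> = (LBINT y. cnj (g y) * fourier_L1 (modulated_exp e x) y)"
      using g by (intro fourier_L1_multiplication_formula modulated_exp_fourier e) auto
    also have "\<dots> = (LBINT y. sqrt (2 * pi) *\<^sub>R (cnj (g y) * of_real (poisson_kernel e (y - x))))"
      by (intro Bochner_Integration.integral_cong refl)
         (simp add: modulated_exp_fourier(2)[OF e] scaleR_conv_of_real mult_ac)
    finally show ?thesis
      unfolding fourier_L1_def by simp
  qed
  have "(\<integral>\<^sup>+w. ennreal ((norm (?F w))\<^sup>2 * exp (- e * \<bar>w\<bar>)) \<partial>lborel) = ennreal (norm (LBINT w. ?F w * k w))"
  proof -
    have eq: "?F w * k w = of_real ((norm (?F w))\<^sup>2 * exp (- e * \<bar>w\<bar>))" for w
      by (simp add: k_def flip: mult.assoc) (simp flip: complex_norm_square)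
    have "integrable lborel (\<lambda>w. ?F w * k w)"
      by (rule integrable_bounded_mult[OF _ norm_fourier_L1_le[OF g] int]) auto
    then have int2: "integrable lborel (\<lambda>w. (norm (?F w))\<^sup>2 * exp (- e * \<bar>w\<bar>))"
      unfolding eq by (subst (asm) complex_of_real_integrable_eq)
    then have "(\<integral>\<^sup>+w. ennreal ((norm (?F w))\<^sup>2 * exp (- e * \<bar>w\<bar>)) \<partial>lborel) = ennreal (LBINT w. (norm (?F w))\<^sup>2 * exp (- e * \<bar>w\<bar>))"
      by (intro nn_integral_eq_integral) auto
    also have "(LBINT w. (norm (?F w))\<^sup>2 * exp (- e * \<bar>w\<bar>)) = norm (LBINT w. ?F w * k w)"
      unfolding eq integral_complex_of_real norm_of_real by (intro abs_of_nonneg[symmetric] integral_nonneg_AE) auto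
    finally show ?thesis .
  qed
  also have "(LBINT w. ?F w * k w) = (LBINT x. g x * (LBINT y. cnj (g y) * of_real (poisson_kernel e (y - x))))"
    unfolding fourier_L1_multiplication_formula[OF g int] Fk ..
  also have "ennreal (norm \<dots>) \<le> (\<integral>\<^sup>+x. ennreal (norm (g x * (LBINT y. cnj (g y) * of_real (poisson_kernel e (y - x))))) \<partial>lborel)"
    by (rule norm_integral_le_nn_integral)
  also have "\<dots> \<le> (\<integral>\<^sup>+x. (\<integral>\<^sup>+y. ennreal ((norm (g x))\<^sup>2 / 2) * ennreal (poisson_kernel e (y - x)) + ennreal ((norm (g y))\<^sup>2 / 2) * ennreal (poisson_kernel e (x - y)) \<partial>lborel) \<partial>lborel)"
  proof (rule nn_integral_mono)
    fix x
    have "ennreal (norm (g x * (LBINT y. cnj (g y) * of_real (poisson_kernel e (y - x)))))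
        \<le> ennreal (norm (g x)) * (\<integral>\<^sup>+y. ennreal (norm (cnj (g y) * of_real (poisson_kernel e (y - x)))) \<partial>lborel)"
      unfolding norm_mult[of "g x"] ennreal_mult'[OF norm_ge_zero] by (intro mult_left_mono norm_integral_le_nn_integral) auto
    also have "\<dots> = (\<integral>\<^sup>+y. ennreal (norm (g x)) * ennreal (norm (cnj (g y) * of_real (poisson_kernel e (y - x)))) \<partial>lborel)"
      by (rule nn_integral_cmult[symmetric]) auto
    also have "\<dots> \<le> (\<integral>\<^sup>+y. ennreal ((norm (g x))\<^sup>2 / 2) * ennreal (poisson_kernel e (y - x)) + ennreal ((norm (g y))\<^sup>2 / 2) * ennreal (poisson_kernel e (x - y)) \<partial>lborel)"
    proof (rule nn_integral_mono)
      fix y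
      have "norm (g x) * norm (g y) \<le> (norm (g x))\<^sup>2 / 2 + (norm (g y))\<^sup>2 / 2"
        using sum_squares_bound[of "norm (g x)" "norm (g y)"] by simp
      then have "(norm (g x) * norm (g y)) * poisson_kernel e (y - x) \<le> ((norm (g x))\<^sup>2 / 2 + (norm (g y))\<^sup>2 / 2) * poisson_kernel e (y - x)"
        using e by (intro mult_right_mono poisson_kernel_nonneg)
      then show "ennreal (norm (g x)) * ennreal (norm (cnj (g y) * of_real (poisson_kernel e (y - x))))
        \<le> ennreal ((norm (g x))\<^sup>2 / 2) * ennreal (poisson_kernel e (y - x)) + ennreal ((norm (g y))\<^sup>2 / 2) * ennreal (poisson_kernel e (x - y))"
        using e poisson_kernel_nonneg[OF e] unfolding poisson_kernel_commute[of e x y]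
        by (simp add: norm_mult distrib_right mult.assoc flip: ennreal_mult ennreal_plus)
    qed
    finally show "ennreal (norm (g x * (LBINT y. cnj (g y) * of_real (poisson_kernel e (y - x)))))
      \<le> (\<integral>\<^sup>+y. ennreal ((norm (g x))\<^sup>2 / 2) * ennreal (poisson_kernel e (y - x)) + ennreal ((norm (g y))\<^sup>2 / 2) * ennreal (poisson_kernel e (x - y)) \<partial>lborel)" .
  qed
  also have "\<dots> = (\<integral>\<^sup>+x. (\<integral>\<^sup>+y. ennreal ((norm (g x))\<^sup>2 / 2) * ennreal (poisson_kernel e (y - x)) \<partial>lborel) \<partial>lborel)
      + (\<integral>\<^sup>+x. (\<integral>\<^sup>+y. ennreal ((norm (g y))\<^sup>2 / 2) * ennreal (poisson_kernel e (x - y)) \<partial>lborel) \<partial>lborel)"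
    by (subst nn_integral_add, measurable) (subst nn_integral_add, measurable)
  also have "(\<integral>\<^sup>+x. (\<integral>\<^sup>+y. ennreal ((norm (g y))\<^sup>2 / 2) * ennreal (poisson_kernel e (x - y)) \<partial>lborel) \<partial>lborel)
      = (\<integral>\<^sup>+y. (\<integral>\<^sup>+x. ennreal ((norm (g y))\<^sup>2 / 2) * ennreal (poisson_kernel e (x - y)) \<partial>lborel) \<partial>lborel)"
    by (rule lborel_pair.Fubini') measurable
  also have "(\<integral>\<^sup>+x. (\<integral>\<^sup>+y. ennreal ((norm (g x))\<^sup>2 / 2) * ennreal (poisson_kernel e (y - x)) \<partial>lborel) \<partial>lborel)
      = (\<integral>\<^sup>+x. ennreal ((norm (g x))\<^sup>2 / 2) \<partial>lborel)"
    by (subst nn_integral_cmult) (simp_all add: nn_integral_poisson_kernel[OF e])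
  also have "(\<integral>\<^sup>+x. ennreal ((norm (g x))\<^sup>2 / 2) \<partial>lborel) + (\<integral>\<^sup>+x. ennreal ((norm (g x))\<^sup>2 / 2) \<partial>lborel)
      = (\<integral>\<^sup>+x. ennreal ((norm (g x))\<^sup>2) \<partial>lborel)"
    by (subst nn_integral_add[symmetric]) (auto simp flip: ennreal_plus)
  finally show ?thesis .
qed

text \<open>
  Fatou's lemma removes the damping. The inequality makes the transform continuous for the \<open>L\<^sup>2\<close> norms and
  thus provides its extension to square integrable functions.
\<close>

theorem fourier_L1_Plancherel_le:
  assumes g: "integrable lborel g"
  shows "(\<integral>\<^sup>+w. ennreal ((norm (fourier_L1 g w))\<^sup>2) \<partial>lborel) \<le> (\<integral>\<^sup>+x. ennreal ((norm (g x))\<^sup>2) \<partial>lborel)"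
proof -
  have [measurable]: "g \<in> borel_measurable borel"
    using g by auto
  let ?d = "\<lambda>n w. ennreal ((norm (fourier_L1 g w))\<^sup>2 * exp (- inverse (Suc n) * \<bar>w\<bar>))"
  have lim: "(\<lambda>n. ?d n w) \<longlonglongrightarrow> ennreal ((norm (fourier_L1 g w))\<^sup>2 * exp (- 0 * \<bar>w\<bar>))" for w
    by (intro tendsto_ennrealI tendsto_intros LIMSEQ_inverse_real_of_nat)
  have "(\<integral>\<^sup>+w. ennreal ((norm (fourier_L1 g w))\<^sup>2) \<partial>lborel) = (\<integral>\<^sup>+w. liminf (\<lambda>n. ?d n w) \<partial>lborel)"
    by (subst lim_imp_Liminf[OF _ lim]) auto
  also have "\<dots> \<le> liminf (\<lambda>n. \<integral>\<^sup>+w. ?d n w \<partial>lborel)"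
    by (rule nn_integral_liminf) auto
  also have "\<dots> \<le> (\<integral>\<^sup>+x. ennreal ((norm (g x))\<^sup>2) \<partial>lborel)"
    by (intro Liminf_le always_eventually allI fourier_L1_Plancherel_damped[OF g] trivial_limit_sequentially positive_imp_inverse_positive) simp
  finally show ?thesis .
qed

lemma L2_fun_iff_nn_integral:
  fixes g :: "real \<Rightarrow> 'b :: euclidean_space"
  shows "L2_fun g \<longleftrightarrow> g \<in> borel_measurable borel \<and> (\<integral>\<^sup>+x. ennreal ((norm (g x))\<^sup>2) \<partial>lborel) < \<infinity>"
  by (auto simp: L2_fun_def integrable_iff_bounded)

lemma L2_fun_fourier_L1:
  assumes "integrable lborel g" "L2_fun g"
  shows "L2_fun (fourier_L1 g)"
  using assms fourier_L1_Plancherel_le[OF assms(1)] by (auto simp: L2_fun_iff_nn_integral)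

lemma L2_fun_mult_integrable:
  fixes f g :: "real \<Rightarrow> complex"
  assumes f: "L2_fun f" and g: "L2_fun g"
  shows "integrable lborel (\<lambda>x. f x * g x)"
proof (rule Bochner_Integration.integrable_bound)
  show "integrable lborel (\<lambda>x. (norm (f x))\<^sup>2 + (norm (g x))\<^sup>2)"
    using f g by (auto simp: L2_fun_def)
  show "AE x in lborel. norm (f x * g x) \<le> norm ((norm (f x))\<^sup>2 + (norm (g x))\<^sup>2)"
  proof (rule AE_I2)
    fix x
    have "2 * norm (f x) * norm (g x) \<le> (norm (f x))\<^sup>2 + (norm (g x))\<^sup>2"
      by (rule sum_squares_bound)
    moreover have "0 \<le> norm (f x) * norm (g x)" by simp
    ultimately have "norm (f x) * norm (g x) \<le> (norm (f x))\<^sup>2 + (norm (g x))\<^sup>2"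
      by linarith
    then show "norm (f x * g x) \<le> norm ((norm (f x))\<^sup>2 + (norm (g x))\<^sup>2)"
      by (simp add: norm_mult)
  qed
qed (use f g in \<open>auto simp: L2_fun_def\<close>)

lemma L2_pairing_tendsto:
  fixes k :: "real \<Rightarrow> complex"
  assumes G: "\<And>n. L2_fun (G n)" and g: "L2_fun g" and k: "L2_fun k" and lim: "L2_tendsto G g"
  shows "(\<lambda>n. LBINT x. G n x * k x) \<longlonglongrightarrow> (LBINT x. g x * k x)"
proof -
  have [measurable]: "G n \<in> borel_measurable borel" "g \<in> borel_measurable borel" "k \<in> borel_measurable borel" for n
    using G g k by (auto simp: L2_fun_def)
  let ?K = "\<integral>\<^sup>+x. ennreal ((norm (k x))\<^sup>2) \<partial>lborel"
  let ?D = "\<lambda>n. \<integral>\<^sup>+x. ennreal ((norm (G n x - g x))\<^sup>2) \<partial>lborel"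
  have le: "ennreal ((norm ((LBINT x. G n x * k x) - (LBINT x. g x * k x)))\<^sup>2) \<le> ?D n * ?K" for n
  proof -
    have "(LBINT x. G n x * k x) - (LBINT x. g x * k x) = (LBINT x. (G n x - g x) * k x)"
      by (subst Bochner_Integration.integral_diff[symmetric])
         (auto intro!: L2_fun_mult_integrable G g k simp: left_diff_distrib)
    then have "ennreal (norm ((LBINT x. G n x * k x) - (LBINT x. g x * k x))) \<le> (\<integral>\<^sup>+x. ennreal (norm ((G n x - g x) * k x)) \<partial>lborel)"
      by (simp add: norm_integral_le_nn_integral)
    also have "\<dots> = (\<integral>\<^sup>+x. ennreal (norm (G n x - g x)) * ennreal (norm (k x)) \<partial>lborel)"
      by (simp add: norm_mult ennreal_mult)
    finally have "(ennreal (norm ((LBINT x. G n x * k x) - (LBINT x. g x * k x))))\<^sup>2 \<le> (\<integral>\<^sup>+x. ennreal (norm (G n x - g x)) * ennreal (norm (k x)) \<partial>lborel)\<^sup>2"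
      by (rule power_mono) simp
    also have "\<dots> \<le> (\<integral>\<^sup>+x. (ennreal (norm (G n x - g x)))\<^sup>2 \<partial>lborel) * (\<integral>\<^sup>+x. (ennreal (norm (k x)))\<^sup>2 \<partial>lborel)"
      by (rule Cauchy_Schwarz_nn_integral) auto
    finally show ?thesis
      by (simp add: ennreal_power)
  qed
  have "(\<lambda>n. ?D n * ?K) \<longlonglongrightarrow> 0 * ?K"
    using lim k unfolding L2_tendsto_def L2_fun_iff_nn_integral by (intro tendsto_mult_ennreal tendsto_const) auto
  then have lim0: "(\<lambda>n. ?D n * ?K) \<longlonglongrightarrow> 0"
    by simp
  have "(\<lambda>n. ennreal ((norm ((LBINT x. G n x * k x) - (LBINT x. g x * k x)))\<^sup>2)) \<longlonglongrightarrow> 0"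
    by (rule tendsto_sandwich[OF always_eventually always_eventually tendsto_const lim0])
       (simp_all only: le zero_le simp_thms)
  then have "(\<lambda>n. (norm ((LBINT x. G n x * k x) - (LBINT x. g x * k x)))\<^sup>2) \<longlonglongrightarrow> 0"
    by (subst (asm) ennreal_0[symmetric], subst (asm) tendsto_ennreal_iff) auto
  then show ?thesis
    by (simp add: tendsto_norm_zero_iff LIM_zero_iff)
qed

lemma nn_integral_norm_square_triangle:
  fixes a b :: "real \<Rightarrow> 'b :: euclidean_space"
  assumes [measurable]: "a \<in> borel_measurable borel" "b \<in> borel_measurable borel"
  shows "(\<integral>\<^sup>+x. ennreal ((norm (a x))\<^sup>2) \<partial>lborel)
    \<le> 2 * (\<integral>\<^sup>+x. ennreal ((norm (b x))\<^sup>2) \<partial>lborel) + 2 * (\<integral>\<^sup>+x. ennreal ((norm (b x - a x))\<^sup>2) \<partial>lborel)"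
proof -
  have "(\<integral>\<^sup>+x. ennreal ((norm (a x))\<^sup>2) \<partial>lborel)
      \<le> (\<integral>\<^sup>+x. 2 * ennreal ((norm (b x))\<^sup>2) + 2 * ennreal ((norm (b x - a x))\<^sup>2) \<partial>lborel)"
  proof (rule nn_integral_mono)
    fix x
    have "norm (a x) \<le> norm (b x) + norm (b x - a x)"
      using norm_triangle_ineq4[of "b x" "b x - a x"] by simp
    then have "(norm (a x))\<^sup>2 \<le> (norm (b x) + norm (b x - a x))\<^sup>2"
      by (rule power_mono) simp
    also have "\<dots> \<le> 2 * (norm (b x))\<^sup>2 + 2 * (norm (b x - a x))\<^sup>2"
      using sum_squares_bound[of "norm (b x)" "norm (b x - a x)"] by (simp add: power2_sum)
    finally have "ennreal ((norm (a x))\<^sup>2) \<le> ennreal (2 * (norm (b x))\<^sup>2 + 2 * (norm (b x - a x))\<^sup>2)"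
      by (rule ennreal_leI)
    then show "ennreal ((norm (a x))\<^sup>2) \<le> 2 * ennreal ((norm (b x))\<^sup>2) + 2 * ennreal ((norm (b x - a x))\<^sup>2)"
      by (simp add: ennreal_mult)
  qed
  also have "\<dots> = 2 * (\<integral>\<^sup>+x. ennreal ((norm (b x))\<^sup>2) \<partial>lborel) + 2 * (\<integral>\<^sup>+x. ennreal ((norm (b x - a x))\<^sup>2) \<partial>lborel)"
    by (subst nn_integral_add) (auto simp: nn_integral_cmult)
  finally show ?thesis .
qed

text \<open>
  Riesz-Fischer; geometric convergence takes the place of the usual passage to a subsequence. Almost everywhere the sum of \<open>2\<^sup>n |F\<^sub>n\<^sub>+\<^sub>1 - F\<^sub>n|\<^sup>2\<close> is finite, and as
  \<open>2 |d| \<le> 2\<^bsup>-n\<^esup> + 2\<^sup>n |d|\<^sup>2\<close> the increments are then absolutely summable. Fatou's lemma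
  turns pointwise into \<open>L\<^sup>2\<close> convergence.
\<close>

lemma L2_Riesz_Fischer_geometric:
  fixes F :: "nat \<Rightarrow> real \<Rightarrow> 'b :: euclidean_space"
  assumes F: "\<And>n. L2_fun (F n)"
    and close: "\<And>m n. m \<le> n \<Longrightarrow> (\<integral>\<^sup>+x. ennreal ((norm (F n x - F m x))\<^sup>2) \<partial>lborel) \<le> M * ennreal ((1 / 4) ^ m)"
    and M: "M < \<infinity>"
  shows "\<exists>h. L2_fun h \<and> L2_tendsto F h"
proof -
  have [measurable]: "F n \<in> borel_measurable borel" for n
    using F by (auto simp: L2_fun_def)
  \<comment> \<open>where the sequence diverges, \<open>lim\<close> has one fixed unspecified value, so \<open>h\<close> is measurable\<close>
  define h where "h x = lim (\<lambda>n. F n x)" for x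
  have [measurable]: "h \<in> borel_measurable borel"
    unfolding h_def by measurable
  let ?d = "\<lambda>n x. (norm (F (Suc n) x - F n x))\<^sup>2"
  have "(\<integral>\<^sup>+x. (\<Sum>n. ennreal (2 ^ n * ?d n x)) \<partial>lborel) = (\<Sum>n. \<integral>\<^sup>+x. ennreal (2 ^ n * ?d n x) \<partial>lborel)"
    by (rule nn_integral_suminf) auto
  also have "\<dots> \<le> (\<Sum>n. M * ennreal ((1 / 2) ^ n))"
  proof (intro suminf_le summableI)
    fix n
    have "(\<integral>\<^sup>+x. ennreal (2 ^ n * ?d n x) \<partial>lborel) = ennreal (2 ^ n) * (\<integral>\<^sup>+x. ennreal (?d n x) \<partial>lborel)"
      by (subst nn_integral_cmult[symmetric]) (auto simp: ennreal_mult)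
    also have "\<dots> \<le> ennreal (2 ^ n) * (M * ennreal ((1 / 4) ^ n))"
      by (intro mult_left_mono close) auto
    also have "\<dots> = M * (ennreal (2 ^ n) * ennreal ((1 / 4) ^ n))"
      by (simp add: mult_ac)
    also have "ennreal (2 ^ n) * ennreal ((1 / 4) ^ n) = ennreal ((1 / 2) ^ n)"
      by (simp flip: ennreal_mult power_mult_distrib)
    finally show "(\<integral>\<^sup>+x. ennreal (2 ^ n * ?d n x) \<partial>lborel) \<le> M * ennreal ((1 / 2) ^ n)" .
  qed
  also have "\<dots> = M * (\<Sum>n. ennreal ((1 / 2) ^ n))"
    by simp
  also have "(\<Sum>n. ennreal ((1 / 2) ^ n)) = ennreal (\<Sum>n. (1 / 2) ^ n)"
    by (rule suminf_ennreal2) auto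
  also have "M * \<dots> < \<infinity>"
    using M by (simp add: ennreal_mult_less_top)
  finally have "AE x in lborel. (\<Sum>n. ennreal (2 ^ n * ?d n x)) \<noteq> \<infinity>"
    by (intro nn_integral_noteq_infinite) auto
  then have conv: "AE x in lborel. (\<lambda>n. F n x) \<longlonglongrightarrow> h x"
  proof (rule AE_mp, intro AE_I2 impI)
    fix x assume "(\<Sum>n. ennreal (2 ^ n * ?d n x)) \<noteq> \<infinity>"
    then have s: "summable (\<lambda>n. 2 ^ n * ?d n x)"
      by (intro summable_suminf_not_top) auto
    have "summable (\<lambda>n. norm (F (Suc n) x - F n x))"
    proof (rule summable_comparison_test')
      show "summable (\<lambda>n. (1 / 2) ^ n + 2 ^ n * ?d n x)"
        by (intro summable_add s summable_geometric) simp
      fix n :: nat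
      define a where "a = norm (F (Suc n) x - F n x)"
      have "2 * a \<le> (1 / 2) ^ n + 2 ^ n * a\<^sup>2"
      proof -
        define p :: real where "p = 2 ^ n"
        have p: "p > 0" by (simp add: p_def)
        have "0 \<le> (1 - p * a)\<^sup>2 / p"
          using p by simp
        also have "\<dots> = 1 / p - 2 * a + p * a\<^sup>2"
          using p by (simp add: power2_eq_square field_simps)
        finally show ?thesis
          by (simp add: p_def power_one_over)
      qed
      moreover have "0 \<le> a" by (simp add: a_def)
      ultimately have "a \<le> (1 / 2) ^ n + 2 ^ n * a\<^sup>2"
        by linarith
      then show "norm (norm (F (Suc n) x - F n x)) \<le> (1 / 2) ^ n + 2 ^ n * ?d n x"
        by (simp add: a_def)
    qed
    then have "summable (\<lambda>n. F (Suc n) x - F n x)"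
      by (rule summable_norm_cancel)
    then have "convergent (\<lambda>n. F n x - F 0 x)"
      unfolding summable_iff_convergent sum_lessThan_telescope[of "\<lambda>n. F n x"] .
    then have "convergent (\<lambda>n. (F n x - F 0 x) + F 0 x)"
      by (intro convergent_add convergent_const)
    then have "convergent (\<lambda>n. F n x)"
      by simp
    then show "(\<lambda>n. F n x) \<longlonglongrightarrow> h x"
      unfolding h_def by (rule convergent_LIMSEQ_iff[THEN iffD1])
  qed
  have bnd: "(\<integral>\<^sup>+x. ennreal ((norm (F m x - h x))\<^sup>2) \<partial>lborel) \<le> M * ennreal ((1 / 4) ^ m)" for m
  proof -
    have "(\<integral>\<^sup>+x. ennreal ((norm (F m x - h x))\<^sup>2) \<partial>lborel) = (\<integral>\<^sup>+x. liminf (\<lambda>n. ennreal ((norm (F n x - F m x))\<^sup>2)) \<partial>lborel)"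
    proof (rule nn_integral_cong_AE, rule AE_mp[OF conv], rule AE_I2, rule impI)
      fix x assume "(\<lambda>n. F n x) \<longlonglongrightarrow> h x"
      then have "(\<lambda>n. ennreal ((norm (F n x - F m x))\<^sup>2)) \<longlonglongrightarrow> ennreal ((norm (h x - F m x))\<^sup>2)"
        by (intro tendsto_ennrealI tendsto_intros)
      then show "ennreal ((norm (F m x - h x))\<^sup>2) = liminf (\<lambda>n. ennreal ((norm (F n x - F m x))\<^sup>2))"
        by (subst lim_imp_Liminf) (auto simp: norm_minus_commute)
    qed
    also have "\<dots> \<le> liminf (\<lambda>n. \<integral>\<^sup>+x. ennreal ((norm (F n x - F m x))\<^sup>2) \<partial>lborel)"
      by (rule nn_integral_liminf) auto
    also have "\<dots> \<le> M * ennreal ((1 / 4) ^ m)"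
      by (rule Liminf_le) (auto intro!: eventually_mono[OF eventually_ge_at_top[of m]] close)
    finally show ?thesis .
  qed
  have "L2_tendsto F h"
    unfolding L2_tendsto_def
  proof (rule tendsto_sandwich[OF _ _ tendsto_const])
    have "(\<lambda>m. M * ennreal ((1 / 4) ^ m)) \<longlonglongrightarrow> M * ennreal 0"
      using M by (intro tendsto_mult_ennreal tendsto_ennrealI tendsto_const LIMSEQ_power_zero) auto
    then show "(\<lambda>m. M * ennreal ((1 / 4) ^ m)) \<longlonglongrightarrow> 0" by simp
  qed (use bnd in auto)
  moreover have "L2_fun h"
  proof -
    have "(\<integral>\<^sup>+x. ennreal ((norm (h x))\<^sup>2) \<partial>lborel)
        \<le> 2 * (\<integral>\<^sup>+x. ennreal ((norm (F 0 x))\<^sup>2) \<partial>lborel) + 2 * (\<integral>\<^sup>+x. ennreal ((norm (F 0 x - h x))\<^sup>2) \<partial>lborel)"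
      by (rule nn_integral_norm_square_triangle) measurable
    also have "\<dots> < \<infinity>"
      using F[of 0] le_less_trans[OF bnd[of 0], of top] M
      by (auto simp: L2_fun_iff_nn_integral ennreal_mult_less_top)
    finally show ?thesis
      by (simp add: L2_fun_iff_nn_integral)
  qed
  ultimately show ?thesis by blast
qed

section \<open>Fourier pairs of square integrable functions\<close>

text \<open>
  The positive and the negative part of \<open>q\<close> are densities of two finite measures that agree on all open
  half-lines, a generator of the Borel sets, and hence are equal.
\<close>

lemma AE_zero_if_tail_integrals_zero_real:
  fixes q :: "real \<Rightarrow> real"
  assumes q: "integrable lborel q" and tail: "\<And>b. (LBINT w:{b<..}. q w) = 0"
  shows "AE w in lborel. q w = 0"
proof -
  have [measurable]: "q \<in> borel_measurable borel"
    using q by auto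
  define P where "P b = (\<integral>\<^sup>+w. ennreal (indicator {b<..} w * q w) \<partial>lborel)" for b
  define N where "N b = (\<integral>\<^sup>+w. ennreal (- (indicator {b<..} w * q w)) \<partial>lborel)" for b
  have int: "integrable lborel (\<lambda>w. indicator {b<..} w * q w)" for b
    using integrable_mult_indicator[OF _ q, of "{b<..}"] by simp
  have fin: "P b \<noteq> \<infinity>" "N b \<noteq> \<infinity>" for b
    using int[of b] unfolding P_def N_def real_integrable_def by auto
  have eq: "P b = N b" for b
  proof -
    have "enn2real (P b) - enn2real (N b) = 0"
      using tail[of b] real_lebesgue_integral_def[OF int[of b]]
      by (simp add: set_lebesgue_integral_def P_def N_def)
    then show ?thesis
      using fin[of b] by (metis eq_iff_diff_eq_0 ennreal_enn2real infinity_ennreal_def less_top)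
  qed
  have em: "emeasure (density lborel (\<lambda>w. ennreal (q w))) {b<..} = P b"
    "emeasure (density lborel (\<lambda>w. ennreal (- q w))) {b<..} = N b" for b
    unfolding P_def N_def by (auto simp: emeasure_density indicator_def intro!: nn_integral_cong)
  have "density lborel (\<lambda>w. ennreal (q w)) = density lborel (\<lambda>w. ennreal (- q w))"
    using fin by (intro measure_eqI_lessThan) (auto simp: em eq less_top)
  then have "AE w in lborel. ennreal (q w) = ennreal (- q w)"
    by (intro sigma_finite_measure.density_unique[OF lborel.sigma_finite_measure_axioms]) auto
  moreover have "a = 0" if "ennreal a = ennreal (- a)" for a :: real
    using that by (cases "0 \<le> a") (auto simp: ennreal_neg ennreal_eq_0_iff dest: sym)
  ultimately show ?thesis
    by (auto elim!: eventually_mono)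
qed

lemma AE_zero_if_tail_integrals_zero:
  fixes q :: "real \<Rightarrow> complex"
  assumes q: "integrable lborel q" and tail: "\<And>b. (LBINT w:{b..}. q w) = 0"
  shows "AE w in lborel. q w = 0"
proof -
  have [measurable]: "q \<in> borel_measurable borel"
    using q by auto
  have open_tail: "(LBINT w. indicator {b<..} w *\<^sub>R q w) = 0" for b
  proof -
    have "(LBINT w. indicator {b<..} w *\<^sub>R q w) = (LBINT w. indicator {b..} w *\<^sub>R q w)"
      by (rule integral_cong_AE, simp, simp, rule AE_mp[OF AE_lborel_singleton[of b]], rule AE_I2)
         (auto simp: indicator_def)
    then show ?thesis
      using tail[of b] by (simp add: set_lebesgue_integral_def)
  qed
  have int: "integrable lborel (\<lambda>w. indicator {b<..} w *\<^sub>R q w)" for b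
    using integrable_mult_indicator[OF _ q, of "{b<..}"] by simp
  have "AE w in lborel. Re (q w) = 0"
  proof (rule AE_zero_if_tail_integrals_zero_real)
    show "(LBINT w:{b<..}. Re (q w)) = 0" for b
      using integral_Re[OF int[of b]] open_tail[of b] by (simp add: set_lebesgue_integral_def)
  qed (use q in auto)
  moreover have "AE w in lborel. Im (q w) = 0"
  proof (rule AE_zero_if_tail_integrals_zero_real)
    show "(LBINT w:{b<..}. Im (q w)) = 0" for b
      using integral_Im[OF int[of b]] open_tail[of b] by (simp add: set_lebesgue_integral_def)
  qed (use q in auto)
  ultimately show ?thesis
    by eventually_elim (simp add: complex_eq_iff)
qed

text \<open>
  The scalar counterpart of \<^const>\<open>is_clifford_fourier\<close>, with square integrability of \<open>g\<close> included: the pair lies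
  in the closure of the graph of the transform.
\<close>

definition L2_fourier_pair :: "(real \<Rightarrow> complex) \<Rightarrow> (real \<Rightarrow> complex) \<Rightarrow> bool" where
  "L2_fourier_pair g h \<longleftrightarrow> L2_fun g \<and> L2_fun h \<and>
    (\<exists>G. (\<forall>k. integrable lborel (G k) \<and> L2_fun (G k)) \<and> L2_tendsto G g \<and> L2_tendsto (\<lambda>k. fourier_L1 (G k)) h)"

text \<open>
  The multiplication formula in the limit. Pointwise and support information about \<open>h\<close> is extracted from this
  identity by a suitable choice of \<open>k\<close>.
\<close>

lemma L2_fourier_pair_Parseval:
  assumes p: "L2_fourier_pair g h" and k: "integrable lborel k" "L2_fun k"
  shows "(LBINT w. h w * k w) = (LBINT x. g x * fourier_L1 k x)"
proof -
  obtain G where G: "\<And>n. integrable lborel (G n)" "\<And>n. L2_fun (G n)" "L2_tendsto G g"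
      "L2_tendsto (\<lambda>n. fourier_L1 (G n)) h" and gh: "L2_fun g" "L2_fun h"
    using p by (auto simp: L2_fourier_pair_def)
  have "(\<lambda>n. LBINT w. fourier_L1 (G n) w * k w) \<longlonglongrightarrow> (LBINT w. h w * k w)"
    by (intro L2_pairing_tendsto L2_fun_fourier_L1 G gh k)
  moreover have "(\<lambda>n. LBINT x. G n x * fourier_L1 k x) \<longlonglongrightarrow> (LBINT x. g x * fourier_L1 k x)"
    by (intro L2_pairing_tendsto L2_fun_fourier_L1 G gh k)
  ultimately show ?thesis
    unfolding fourier_L1_multiplication_formula[OF G(1) k(1)] by (rule LIMSEQ_unique)
qed

text \<open>
  Plancherel's inequality in the limit. The constant \<open>4\<close> comes from using
  \<open>|a|\<^sup>2 \<le> 2|b|\<^sup>2 + 2|b - a|\<^sup>2\<close> once for \<open>h\<close> and once for \<open>g\<close>.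
\<close>

lemma L2_fourier_pair_norm_bound:
  assumes p: "L2_fourier_pair g h"
  shows "(\<integral>\<^sup>+w. ennreal ((norm (h w))\<^sup>2) \<partial>lborel) \<le> 4 * (\<integral>\<^sup>+x. ennreal ((norm (g x))\<^sup>2) \<partial>lborel)"
proof -
  obtain G where G: "\<And>n. integrable lborel (G n)" "\<And>n. L2_fun (G n)" "L2_tendsto G g"
      "L2_tendsto (\<lambda>n. fourier_L1 (G n)) h" and gh: "L2_fun g" "L2_fun h"
    using p by (auto simp: L2_fourier_pair_def)
  have [measurable]: "g \<in> borel_measurable borel" "h \<in> borel_measurable borel" "G n \<in> borel_measurable borel" for n
    using G gh by (auto simp: L2_fun_def)
  let ?N = "\<lambda>f. \<integral>\<^sup>+x. ennreal ((norm (f x))\<^sup>2) \<partial>lborel"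
  let ?a = "\<lambda>n. \<integral>\<^sup>+x. ennreal ((norm (fourier_L1 (G n) x - h x))\<^sup>2) \<partial>lborel"
  let ?b = "\<lambda>n. \<integral>\<^sup>+x. ennreal ((norm (G n x - g x))\<^sup>2) \<partial>lborel"
  have "?N h \<le> 2 * (2 * ?N g + 2 * ?b n) + 2 * ?a n" for n
  proof -
    have "?N h \<le> 2 * ?N (fourier_L1 (G n)) + 2 * ?a n"
      by (rule nn_integral_norm_square_triangle) auto
    also have "?N (fourier_L1 (G n)) \<le> ?N (G n)"
      by (rule fourier_L1_Plancherel_le[OF G(1)])
    also have "?N (G n) \<le> 2 * ?N g + 2 * (\<integral>\<^sup>+x. ennreal ((norm (g x - G n x))\<^sup>2) \<partial>lborel)"
      by (rule nn_integral_norm_square_triangle) auto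
    finally show ?thesis
      by (simp add: norm_minus_commute mult_left_mono add_right_mono)
  qed
  moreover have "(\<lambda>n. 2 * (2 * ?N g + 2 * ?b n) + 2 * ?a n) \<longlonglongrightarrow> 2 * (2 * ?N g + 2 * 0) + 2 * 0"
    using G(3,4) unfolding L2_tendsto_def
    by (intro tendsto_add ennreal_tendsto_cmult tendsto_const) auto
  ultimately have "?N h \<le> 2 * (2 * ?N g + 2 * 0) + 2 * 0"
    by (intro Lim_bounded2) auto
  then show ?thesis
    by (simp flip: mult.assoc)
qed

lemma L2_fun_reflect: "L2_fun g \<Longrightarrow> L2_fun (\<lambda>x. g (- x))"
  unfolding L2_fun_def using lborel_integrable_real_affine[of "\<lambda>x. (norm (g x))\<^sup>2" "-1" 0] by auto

lemma L2_tendsto_reflect: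
  assumes "\<And>n. L2_fun (G n)" "L2_fun g" "L2_tendsto G g"
  shows "L2_tendsto (\<lambda>n x. G n (- x)) (\<lambda>x. g (- x))"
proof -
  have [measurable]: "G n \<in> borel_measurable borel" "g \<in> borel_measurable borel" for n
    using assms by (auto simp: L2_fun_def)
  have "(\<integral>\<^sup>+x. ennreal ((norm (G n x - g x))\<^sup>2) \<partial>lborel) = (\<integral>\<^sup>+x. ennreal ((norm (G n (- x) - g (- x)))\<^sup>2) \<partial>lborel)" for n
    by (subst nn_integral_real_affine[where c = "-1" and t = 0]) auto
  then show ?thesis
    using assms(3) by (simp add: L2_tendsto_def)
qed

lemma fourier_L1_reflect: "fourier_L1 (\<lambda>x. g (- x)) w = fourier_L1 g (- w)"
  unfolding fourier_L1_def by (subst lborel_integral_real_affine[where c = "-1" and t = 0]) auto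

lemma L2_fourier_pair_reflect:
  assumes "L2_fourier_pair g h"
  shows "L2_fourier_pair (\<lambda>x. g (- x)) (\<lambda>w. h (- w))"
proof -
  obtain G where G: "\<And>n. integrable lborel (G n)" "\<And>n. L2_fun (G n)" "L2_tendsto G g"
      "L2_tendsto (\<lambda>n. fourier_L1 (G n)) h" and gh: "L2_fun g" "L2_fun h"
    using assms by (auto simp: L2_fourier_pair_def)
  have "integrable lborel (\<lambda>x. G n (- x))" for n
    using lborel_integrable_real_affine[OF G(1)[of n], of "-1" 0] by simp
  moreover have "L2_tendsto (\<lambda>n. fourier_L1 (\<lambda>x. G n (- x))) (\<lambda>w. h (- w))"
    unfolding fourier_L1_reflect[abs_def] by (intro L2_tendsto_reflect L2_fun_fourier_L1 G gh)
  ultimately show ?thesis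
    unfolding L2_fourier_pair_def
    using L2_fun_reflect[OF gh(1)] L2_fun_reflect[OF gh(2)] L2_fun_reflect[OF G(2)] L2_tendsto_reflect[OF G(2) gh(1) G(3)]
    by (intro conjI exI[of _ "\<lambda>n x. G n (- x)"]) auto
qed

section \<open>Exponential type bounds the support of the transform\<close>

lemma integral_eq_half_line_sum:
  fixes F :: "real \<Rightarrow> complex"
  assumes F: "integrable lborel F"
  shows "set_integrable lborel {0..} F" "set_integrable lborel {0..} (\<lambda>x. F (- x))"
    and "(LBINT x. F x) = (LBINT x:{0..}. F x) + (LBINT x:{0..}. F (- x))"
proof -
  have F': "integrable lborel (\<lambda>x. F (- x))"
    using lborel_integrable_real_affine[OF F, of "-1" 0] by simp
  show int: "set_integrable lborel {0..} F" "set_integrable lborel {0..} (\<lambda>x. F (- x))"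
    unfolding set_integrable_def by (intro integrable_mult_indicator F F', simp)+
  have int2: "integrable lborel (\<lambda>x. indicator {..0} x *\<^sub>R F x)"
    by (intro integrable_mult_indicator F) simp
  have "(LBINT x. F x) = (LBINT x. indicator {0..} x *\<^sub>R F x + indicator {..0} x *\<^sub>R F x)"
    by (rule integral_cong_AE) (use F int int2 in \<open>auto simp: set_integrable_def\<close>,
        rule AE_mp[OF AE_lborel_singleton[of 0]], rule AE_I2, auto simp: indicator_def)
  also have "\<dots> = (LBINT x:{0..}. F x) + (LBINT x. indicator {..0} x *\<^sub>R F x)"
    unfolding set_lebesgue_integral_def using int int2
    by (intro Bochner_Integration.integral_add) (auto simp: set_integrable_def)
  also have "(LBINT x. indicator {..0} x *\<^sub>R F x) = (LBINT x:{0..}. F (- x))"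
    unfolding set_lebesgue_integral_def
    by (subst lborel_integral_real_affine[where c = "-1" and t = 0]) (auto intro!: Bochner_Integration.integral_cong simp: indicator_def)
  finally show "(LBINT x. F x) = (LBINT x:{0..}. F x) + (LBINT x:{0..}. F (- x))" .
qed

text \<open>
  The maps \<open>z \<mapsto> - i z\<close> and \<open>z \<mapsto> - z\<close> carry the first quadrant to the fourth and the third. With \<open>A\<close> the
  integral of \<open>G\<close> over the positive half-axis, rotation expresses the integral over the negative imaginary axis as
  \<open>i A\<close> and the one over the negative half-axis as \<open>i\<close> times that, which is \<open>- A\<close>.
\<close>

lemma integral_real_line_eq_0_if_lower_half_plane:
  fixes G :: "complex \<Rightarrow> complex"
  assumes hol: "G holomorphic_on {z. Im z \<le> 0}"
    and bound: "\<And>z. Im z \<le> 0 \<Longrightarrow> norm (G z) \<le> C * exp (K * norm z)" and K: "0 \<le> K"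
    and real: "integrable lborel (\<lambda>x. G (of_real x))"
    and imag: "set_integrable lborel {0..} (\<lambda>y. G (- \<i> * of_real y))"
  shows "(LBINT x. G (of_real x)) = 0"
proof -
  note split = integral_eq_half_line_sum[OF real]
  have comp: "(\<lambda>z. G (c * z)) holomorphic_on {z. 0 \<le> Re z \<and> 0 \<le> Im z}"
    if "c = - \<i> \<or> c = - 1" for c
    using that by (intro holomorphic_on_compose_gen[OF _ hol, unfolded o_def] holomorphic_intros) auto
  have "(LBINT x:{0..}. G (- \<i> * of_real x)) = \<i> * (LBINT y:{0..}. G (- \<i> * (\<i> * of_real y)))"
  proof (rule quadrant_contour_rotation[OF comp _ K imag])
    show "norm (G (- \<i> * z)) \<le> C * exp (K * norm z)" if "0 \<le> Re z" "0 \<le> Im z" for z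
      using bound[of "- \<i> * z"] that by (simp add: norm_mult)
    show "set_integrable lborel {0..} (\<lambda>y. G (- \<i> * (\<i> * of_real y)))"
      using split(1) by (simp flip: mult.assoc)
  qed simp
  moreover have "(LBINT x:{0..}. G (- 1 * of_real x)) = \<i> * (LBINT y:{0..}. G (- 1 * (\<i> * of_real y)))"
  proof (rule quadrant_contour_rotation[OF comp _ K])
    show "norm (G (- 1 * z)) \<le> C * exp (K * norm z)" if "0 \<le> Re z" "0 \<le> Im z" for z
      using bound[of "- 1 * z"] that by simp
    show "set_integrable lborel {0..} (\<lambda>x. G (- 1 * of_real x))"
      using split(2) by simp
    show "set_integrable lborel {0..} (\<lambda>y. G (- 1 * (\<i> * of_real y)))"
      using imag by simp
  qed simp
  ultimately show ?thesis
    unfolding split(3) by (simp flip: mult.assoc)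
qed

text \<open>
  The test functions that detect the tail of a transform. The factor \<open>e\<^bsup>-w\<^esup>\<close> makes the
  indicator of \<open>[b, \<infinity>)\<close> integrable.
\<close>

definition cut_exp :: "real \<Rightarrow> real \<Rightarrow> complex" where
  "cut_exp b w = indicator {b..} w *\<^sub>R exp (- of_real w)"

lemma cut_exp_fourier:
  shows "integrable lborel (cut_exp b)" and "L2_fun (cut_exp b)"
    and "fourier_L1 (cut_exp b) x = (1 / sqrt (2 * pi)) *\<^sub>R (exp (- ((1 + \<i> * of_real x) * of_real b)) / (1 + \<i> * of_real x))"
proof -
  have [measurable]: "cut_exp b \<in> borel_measurable borel"
    unfolding cut_exp_def by measurable
  show "integrable lborel (cut_exp b)"
    using integral_exp_decay_atLeast(1)[of 1 b] by (simp add: cut_exp_def[abs_def] set_integrable_def)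
  have "(norm (cut_exp b w))\<^sup>2 = norm (indicator {b..} w *\<^sub>R exp (- (2 * of_real w :: complex)))" for w
    by (auto simp: cut_exp_def indicator_def power2_eq_square simp flip: exp_add)
  moreover have "integrable lborel (\<lambda>w. norm (indicator {b..} w *\<^sub>R exp (- (2 * of_real w :: complex))))"
    using integral_exp_decay_atLeast(1)[of 2 b] unfolding set_integrable_def by (intro integrable_norm) simp
  ultimately show "L2_fun (cut_exp b)"
    unfolding L2_fun_def by simp
  have "(LBINT u. exp (- (\<i> * of_real (u * x))) * cut_exp b u) = (LBINT w:{b..}. exp (- ((1 + \<i> * of_real x) * of_real w)))"
    unfolding set_lebesgue_integral_def
    by (intro Bochner_Integration.integral_cong refl) (simp add: cut_exp_def indicator_def mult_exp_exp algebra_simps)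
  then show "fourier_L1 (cut_exp b) x = (1 / sqrt (2 * pi)) *\<^sub>R (exp (- ((1 + \<i> * of_real x) * of_real b)) / (1 + \<i> * of_real x))"
    unfolding fourier_L1_def using integral_exp_decay_atLeast(2)[of "1 + \<i> * of_real x" b] by simp
qed

text \<open>
  The transform of the cut exponential is \<open>e\<^bsup>-(1 + ix)b\<^esup> / (1 + ix)\<close> up to a constant. It extends
  holomorphically to the lower half-plane, the pole being at \<open>i\<close>, and there it has modulus at most
  \<open>e\<^bsup>b Im z\<^esup>\<close>. Down the imaginary axis the product with \<open>g\<close> is therefore at most a multiple of \<open>e\<^bsup>-(b - B)y\<^esup>\<close>.
\<close>

lemma Paley_Wiener_tail_vanishes:
  fixes g :: "complex \<Rightarrow> complex"
  assumes hol: "g holomorphic_on UNIV" and growth: "\<And>z. norm (g z) \<le> C * exp (B * norm z)"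
    and B: "0 < B" and b: "B < b" and p: "L2_fourier_pair (\<lambda>x. g (of_real x)) h"
  shows "(LBINT w. h w * cut_exp b w) = 0"
proof -
  define G where "G z = g z * (exp (- ((1 + \<i> * z) * of_real b)) / (1 + \<i> * z))" for z
  have C: "0 \<le> C"
    using growth[of 0] norm_ge_zero[of "g 0"] by (auto simp del: norm_ge_zero)
  have den: "1 \<le> norm (1 + \<i> * z)" if "Im z \<le> 0" for z
    using complex_Re_le_cmod[of "1 + \<i> * z"] that by simp
  have bound: "norm (G z) \<le> C * exp (B * norm z + b * Im z)" if "Im z \<le> 0" for z
  proof -
    have "norm (G z) = norm (g z) * exp (- b + b * Im z) / norm (1 + \<i> * z)"
      by (simp add: G_def norm_mult norm_divide algebra_simps)
    also have "\<dots> \<le> norm (g z) * exp (- b + b * Im z) / 1"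
      using den[OF that] by (intro divide_left_mono) auto
    also have "\<dots> \<le> (C * exp (B * norm z)) * exp (b * Im z)"
      using B b growth[of z] unfolding div_by_1 by (intro mult_mono) (auto intro!: mult_nonneg_nonneg C)
    finally show ?thesis
      by (simp add: exp_add mult.assoc)
  qed
  have holG: "G holomorphic_on {z. Im z \<le> 0}"
  proof -
    have "1 + \<i> * z \<noteq> 0" if "z \<in> {z. Im z \<le> 0}" for z
      using den[of z] that by auto
    then show ?thesis
      unfolding G_def by (intro holomorphic_intros holomorphic_on_subset[OF hol]) auto
  qed
  have int: "integrable lborel (\<lambda>x. G (of_real x))"
  proof -
    have "integrable lborel (\<lambda>x. g (of_real x) * fourier_L1 (cut_exp b) x)"
      using p by (intro L2_fun_mult_integrable L2_fun_fourier_L1 cut_exp_fourier) (simp add: L2_fourier_pair_def)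
    then have "integrable lborel (\<lambda>x. (1 / sqrt (2 * pi)) *\<^sub>R G (of_real x))"
      by (simp add: cut_exp_fourier(3) G_def)
    then have "integrable lborel (\<lambda>x. sqrt (2 * pi) *\<^sub>R (1 / sqrt (2 * pi)) *\<^sub>R G (of_real x))"
      by (rule integrable_scaleR_right)
    then show ?thesis
      by simp
  qed
  have "(LBINT x. G (of_real x)) = 0"
  proof (rule integral_real_line_eq_0_if_lower_half_plane[OF holG _ less_imp_le[OF B] int])
    show "norm (G z) \<le> C * exp (B * norm z)" if "Im z \<le> 0" for z
    proof -
      have "C * exp (B * norm z + b * Im z) \<le> C * exp (B * norm z)"
        using B b that C by (intro mult_left_mono) (auto simp: mult_nonneg_nonpos)
      then show ?thesis
        using bound[OF that] by linarith
    qed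
    have dom: "set_integrable lborel {0..} (\<lambda>y. of_real C * exp (- (of_real (b - B) * of_real y)) :: complex)"
      using b by (intro set_integrable_mult_right integral_exp_decay_atLeast(1)) auto
    have cont: "continuous_on {0..} (\<lambda>y. G (- \<i> * of_real y))"
      by (rule continuous_on_compose2[OF holomorphic_on_imp_continuous_on[OF holG]]) (auto intro!: continuous_intros)
    show "set_integrable lborel {0..} (\<lambda>y. G (- \<i> * of_real y))"
    proof (rule set_integrable_bound[OF dom])
      show "set_borel_measurable lborel {0..} (\<lambda>y. G (- \<i> * of_real y))"
        unfolding set_borel_measurable_def using borel_measurable_continuous_on_indicator[OF _ cont] by simp
      show "AE y in lborel. y \<in> {0..} \<longrightarrow> norm (G (- \<i> * of_real y)) \<le> norm (of_real C * exp (- (of_real (b - B) * of_real y)) :: complex)"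
      proof (intro AE_I2 impI)
        fix y :: real assume "y \<in> {0..}"
        then have "norm (G (- \<i> * of_real y)) \<le> C * exp (B * y - b * y)"
          using bound[of "- \<i> * of_real y"] by (simp add: norm_mult)
        then show "norm (G (- \<i> * of_real y)) \<le> norm (of_real C * exp (- (of_real (b - B) * of_real y)) :: complex)"
          using C by (simp add: norm_mult algebra_simps)
      qed
    qed
  qed
  moreover have "(LBINT w. h w * cut_exp b w) = (LBINT x. (1 / sqrt (2 * pi)) *\<^sub>R G (of_real x))"
    unfolding L2_fourier_pair_Parseval[OF p cut_exp_fourier(1,2)] by (simp add: cut_exp_fourier(3) G_def)
  ultimately show ?thesis
    by simp
qed

lemma Paley_Wiener_support_right:
  fixes g :: "complex \<Rightarrow> complex"
  assumes hol: "g holomorphic_on UNIV" and growth: "\<And>z. norm (g z) \<le> C * exp (B * norm z)"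
    and B: "0 < B" and p: "L2_fourier_pair (\<lambda>x. g (of_real x)) h"
  shows "AE w in lborel. B < w \<longrightarrow> h w = 0"
proof -
  have "AE w in lborel. B + inverse (Suc n) \<le> w \<longrightarrow> h w = 0" for n :: nat
  proof -
    \<comment> \<open>tails are controlled only beyond a point larger than \<open>B\<close>; the gap is closed by the union over \<open>n\<close>\<close>
    define c where "c = B + inverse (real (Suc n))"
    have c: "B < c"
      by (simp add: c_def)
    have "AE w in lborel. h w * cut_exp c w = 0"
    proof (rule AE_zero_if_tail_integrals_zero)
      show "integrable lborel (\<lambda>w. h w * cut_exp c w)"
        using p by (intro L2_fun_mult_integrable cut_exp_fourier) (simp add: L2_fourier_pair_def)
      fix b
      have "(LBINT w:{b..}. h w * cut_exp c w) = (LBINT w. h w * cut_exp (max b c) w)"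
        unfolding set_lebesgue_integral_def
        by (intro Bochner_Integration.integral_cong refl) (auto simp: cut_exp_def indicator_def)
      also have "\<dots> = 0"
        using c by (intro Paley_Wiener_tail_vanishes[OF hol growth B _ p]) auto
      finally show "(LBINT w:{b..}. h w * cut_exp c w) = 0" .
    qed
    then show ?thesis
      unfolding c_def[symmetric] by eventually_elim (auto simp: cut_exp_def indicator_def split: if_splits)
  qed
  then have "AE w in lborel. \<forall>n::nat. B + inverse (Suc n) \<le> w \<longrightarrow> h w = 0"
    by (subst AE_all_countable) blast
  then show ?thesis
  proof eventually_elim
    case (elim w)
    show ?case
    proof
      assume "B < w"
      then obtain n where "inverse (real (Suc n)) < w - B"
        using reals_Archimedean[of "w - B"] by auto
      then show "h w = 0"
        using elim[rule_format, of n] by simp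
    qed
  qed
qed

text \<open>
  The transform of \<open>x \<mapsto> g(-x)\<close> is \<open>w \<mapsto> h(-w)\<close>, so the bound from above yields the one from below.
\<close>

theorem Paley_Wiener_support:
  fixes g :: "complex \<Rightarrow> complex"
  assumes hol: "g holomorphic_on UNIV" and growth: "\<And>z. norm (g z) \<le> C * exp (B * norm z)"
    and B: "0 < B" and p: "L2_fourier_pair (\<lambda>x. g (of_real x)) h"
  shows "AE w in lborel. w \<notin> {-B..B} \<longrightarrow> h w = 0"
proof -
  have r: "AE w in lborel. B < w \<longrightarrow> h w = 0"
    by (rule Paley_Wiener_support_right[OF assms])
  have "AE w in lborel. B < w \<longrightarrow> h (- w) = 0"
  proof (rule Paley_Wiener_support_right[OF _ _ B])
    show "(\<lambda>z. g (- z)) holomorphic_on UNIV"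
      by (intro holomorphic_on_compose_gen[OF _ hol, unfolded o_def] holomorphic_intros) auto
    show "norm (g (- z)) \<le> C * exp (B * norm z)" for z
      using growth[of "- z"] by simp
    show "L2_fourier_pair (\<lambda>x. g (- of_real x)) (\<lambda>w. h (- w))"
      using L2_fourier_pair_reflect[OF p] by simp
  qed
  moreover have [measurable]: "h \<in> borel_measurable borel"
    using p by (simp add: L2_fourier_pair_def L2_fun_def)
  ultimately have "AE w in distr lborel borel (uminus :: real \<Rightarrow> real). B < - w \<longrightarrow> h w = 0"
    by (subst AE_distr_iff) simp_all
  then have "AE w in lborel. B < - w \<longrightarrow> h w = 0"
    by (simp only: lborel_distr_uminus)
  with r show ?thesis
    by eventually_elim auto
qed

section \<open>Fourier inversion and the integral representation\<close>

lemma L2_fun_modulated_exp: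
  assumes "0 < e"
  shows "L2_fun (modulated_exp e a)"
proof -
  have "(norm (modulated_exp e a w))\<^sup>2 = norm (modulated_exp (2 * e) a w)" for w
    by (simp add: norm_modulated_exp power2_eq_square flip: exp_add)
  moreover have "integrable lborel (\<lambda>w. norm (modulated_exp (2 * e) a w))"
    using assms by (intro integrable_norm modulated_exp_fourier) simp
  ultimately show ?thesis
    by (simp add: L2_fun_def)
qed

text \<open>
  The kernel is itself a transform, so Plancherel's inequality applies.
\<close>

lemma L2_fun_poisson_kernel:
  assumes e: "0 < e"
  shows "L2_fun (\<lambda>x. of_real (poisson_kernel e (x - a)) :: complex)"
proof -
  have "L2_fun (fourier_L1 (modulated_exp e a))"
    by (intro L2_fun_fourier_L1 modulated_exp_fourier L2_fun_modulated_exp e)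
  then have "integrable lborel (\<lambda>x. 2 * pi * (poisson_kernel e (x - a))\<^sup>2)"
    by (simp add: L2_fun_def modulated_exp_fourier(2)[OF e] norm_mult power_mult_distrib)
  then show ?thesis
    by (simp add: L2_fun_def)
qed

text \<open>
  Away from the diagonal the kernel tends to \<open>0\<close> linearly in \<open>e\<close>, relative to the fixed kernel with \<open>e = 1\<close>.
  As the latter is square integrable, this is what allows an unbounded \<open>g\<close> in the next lemma.
\<close>

lemma poisson_kernel_off_diagonal:
  assumes e: "0 < e" and d: "0 < d" and t: "d \<le> \<bar>t\<bar>"
  shows "poisson_kernel e t \<le> e * (1 + 1 / d\<^sup>2) * poisson_kernel 1 t"
proof -
  have t2: "d\<^sup>2 \<le> t\<^sup>2"
    using d t by (simp add: abs_le_square_iff[symmetric])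
  have tpos: "0 < t\<^sup>2"
    using d t by auto
  have "1 \<le> t\<^sup>2 / d\<^sup>2"
    using t2 d by simp
  then have "1 + t\<^sup>2 \<le> (1 + 1 / d\<^sup>2) * t\<^sup>2"
    by (simp add: algebra_simps)
  then have "1 / t\<^sup>2 \<le> (1 + 1 / d\<^sup>2) / (1 + t\<^sup>2)"
    using tpos by (simp add: divide_simps add_pos_pos)
  then have "e / pi * (1 / t\<^sup>2) \<le> e / pi * ((1 + 1 / d\<^sup>2) / (1 + t\<^sup>2))"
    using e by (intro mult_left_mono) auto
  moreover have "poisson_kernel e t \<le> e / (pi * t\<^sup>2)"
    unfolding poisson_kernel_def using e tpos by (intro divide_left_mono mult_left_mono mult_pos_pos add_pos_pos) auto
  ultimately show ?thesis
    by (simp add: poisson_kernel_def)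
qed

text \<open>
  Within distance \<open>d\<close> of \<open>a\<close> continuity makes \<open>|g - g(a)|\<close> small, against a kernel of mass \<open>1\<close>. Farther out, the
  previous lemma bounds the integrand by \<open>e\<close> times a fixed integrable function.
\<close>

lemma poisson_kernel_approximate_identity:
  fixes g :: "real \<Rightarrow> complex"
  assumes g: "L2_fun g" and cont: "isCont g a"
  shows "(\<lambda>n. LBINT x. g x * of_real (poisson_kernel (inverse (Suc n)) (x - a))) \<longlonglongrightarrow> g a"
proof -
  let ?P = "\<lambda>e x. poisson_kernel e (x - a)"
  have int: "integrable lborel (\<lambda>x. g x * of_real (?P e x))" if "0 < e" for e
    by (intro L2_fun_mult_integrable g L2_fun_poisson_kernel that)
  have P1: "integrable lborel (\<lambda>x. norm (g x) * ?P 1 x)"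
    using integrable_norm[OF int[of 1]] poisson_kernel_nonneg[of 1] by (simp add: norm_mult)
  define W where "W = (LBINT x. norm (g x) * ?P 1 x + norm (g a) * ?P 1 x)"
  have intW: "integrable lborel (\<lambda>x. norm (g x) * ?P 1 x + norm (g a) * ?P 1 x)"
    by (intro Bochner_Integration.integrable_add P1 integrable_mult_right integrable_poisson_kernel) simp
  show ?thesis
  proof (rule LIMSEQ_I)
    fix r :: real assume r: "0 < r"
    obtain d where d: "0 < d" "\<And>x. \<bar>x - a\<bar> < d \<Longrightarrow> norm (g x - g a) < r / 2"
      using cont r unfolding continuous_at_eps_delta dist_norm by (metis half_gt_zero real_norm_def)
    define K where "K = (1 + 1 / d\<^sup>2) * W"
    have bound: "norm ((LBINT x. g x * of_real (?P e x)) - g a) \<le> r / 2 + e * K" if e: "0 < e" for e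
    proof -
      have inta: "integrable lborel (\<lambda>x. g a * of_real (?P e x))"
        by (intro integrable_mult_right integrable_of_real integrable_poisson_kernel e)
      have "(LBINT x. g a * of_real (?P e x)) = g a"
        using integrable_poisson_kernel(2)[OF e, of a] by simp
      then have "(LBINT x. g x * of_real (?P e x)) - g a = (LBINT x. (g x - g a) * of_real (?P e x))"
        by (subst left_diff_distrib, subst Bochner_Integration.integral_diff[OF int[OF e] inta]) simp
      also have "norm \<dots> \<le> (LBINT x. norm ((g x - g a) * of_real (?P e x)))"
        by (rule integral_norm_bound)
      also have "\<dots> \<le> (LBINT x. r / 2 * ?P e x + e * (1 + 1 / d\<^sup>2) * (norm (g x) * ?P 1 x + norm (g a) * ?P 1 x))"
      proof (rule integral_mono)
        show "integrable lborel (\<lambda>x. norm ((g x - g a) * of_real (?P e x)))"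
          using Bochner_Integration.integrable_diff[OF int[OF e] inta] by (intro integrable_norm) (simp add: left_diff_distrib)
        show "integrable lborel (\<lambda>x. r / 2 * ?P e x + e * (1 + 1 / d\<^sup>2) * (norm (g x) * ?P 1 x + norm (g a) * ?P 1 x))"
          by (intro Bochner_Integration.integrable_add integrable_mult_right intW integrable_poisson_kernel e P1) simp
        fix x
        have eq: "norm ((g x - g a) * of_real (?P e x)) = norm (g x - g a) * ?P e x"
          using poisson_kernel_nonneg[OF e] by (simp add: norm_mult)
        have nn: "0 \<le> e * (1 + 1 / d\<^sup>2) * (norm (g x) * ?P 1 x + norm (g a) * ?P 1 x)"
          using e poisson_kernel_nonneg[of 1] by (intro mult_nonneg_nonneg add_nonneg_nonneg) auto
        have nn': "0 \<le> r / 2 * ?P e x"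
          using r poisson_kernel_nonneg[OF e] by simp
        show "norm ((g x - g a) * of_real (?P e x)) \<le> r / 2 * ?P e x + e * (1 + 1 / d\<^sup>2) * (norm (g x) * ?P 1 x + norm (g a) * ?P 1 x)"
        proof (cases "\<bar>x - a\<bar> < d")
          case True
          then have "norm (g x - g a) * ?P e x \<le> r / 2 * ?P e x"
            using d(2) poisson_kernel_nonneg[OF e] by (intro mult_right_mono) (auto simp: less_imp_le)
          then show ?thesis
            using nn eq by linarith
        next
          case False
          then have "norm (g x - g a) * ?P e x \<le> (norm (g x) + norm (g a)) * (e * (1 + 1 / d\<^sup>2) * ?P 1 x)"
            using e d(1) poisson_kernel_nonneg[OF e]
            by (intro mult_mono norm_triangle_ineq4 poisson_kernel_off_diagonal) auto
          also have "\<dots> = e * (1 + 1 / d\<^sup>2) * (norm (g x) * ?P 1 x + norm (g a) * ?P 1 x)"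
            by (simp only: distrib_left distrib_right mult_ac)
          finally show ?thesis
            using nn' eq by linarith
        qed
      qed
      also have "\<dots> = (LBINT x. r / 2 * ?P e x) + (LBINT x. e * (1 + 1 / d\<^sup>2) * (norm (g x) * ?P 1 x + norm (g a) * ?P 1 x))"
        by (intro Bochner_Integration.integral_add integrable_mult_right intW integrable_poisson_kernel e)
      also have "\<dots> = r / 2 + e * K"
        by (simp add: integrable_poisson_kernel(2)[OF e] W_def K_def)
      finally show ?thesis .
    qed
    have "(\<lambda>n. r / 2 + inverse (real (Suc n)) * K) \<longlonglongrightarrow> r / 2 + 0 * K"
      by (intro tendsto_intros LIMSEQ_inverse_real_of_nat)
    from order_tendstoD(2)[OF this, of r] r
    have "eventually (\<lambda>n. r / 2 + inverse (real (Suc n)) * K < r) sequentially"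
      by simp
    then show "\<exists>no. \<forall>n\<ge>no. norm ((LBINT x. g x * of_real (?P (inverse (Suc n)) x)) - g a) < r"
      unfolding eventually_sequentially using bound by (meson inverse_positive_iff_positive le_less_trans of_nat_0_less_iff zero_less_Suc)
  qed
qed

lemma integrable_if_L2_AE_supported:
  fixes h :: "real \<Rightarrow> 'b :: euclidean_space"
  assumes h: "L2_fun h" and supp: "AE w in lborel. w \<notin> {- B..B} \<longrightarrow> h w = 0"
  shows "integrable lborel h"
proof (rule Bochner_Integration.integrable_bound)
  show "integrable lborel (\<lambda>w. indicator {- B..B} w + (norm (h w))\<^sup>2)"
    using h by (intro Bochner_Integration.integrable_add integrable_real_indicator) (auto simp: L2_fun_def emeasure_lborel_Icc_eq)
  show "AE w in lborel. norm (h w) \<le> norm (indicator {- B..B} w + (norm (h w))\<^sup>2)"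
    using supp
  proof eventually_elim
    case (elim w)
    have "2 * 1 * norm (h w) \<le> 1\<^sup>2 + (norm (h w))\<^sup>2"
      by (rule sum_squares_bound)
    then have "norm (h w) \<le> 1 + (norm (h w))\<^sup>2"
      using norm_ge_zero[of "h w"] by (simp del: norm_ge_zero)
    then show ?case
      using elim by (auto simp: indicator_def)
  qed
qed (use h in \<open>simp add: L2_fun_def\<close>)

text \<open>
  Parseval with a modulated exponential as test function. As its damping is removed, the side of \<open>h\<close> converges by
  dominated convergence and the side of \<open>g\<close> because Poisson kernels are an approximate identity.
\<close>

lemma L2_fourier_pair_inversion:
  assumes p: "L2_fourier_pair g h" and h: "integrable lborel h" and cont: "isCont g a"
  shows "g a = (1 / sqrt (2 * pi)) *\<^sub>R (LBINT w. exp (\<i> * of_real (a * w)) * h w)"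
proof -
  have [measurable]: "h \<in> borel_measurable borel"
    using h by auto
  let ?e = "\<lambda>n. inverse (real (Suc n))"
  have "(\<lambda>n. LBINT w. h w * modulated_exp (?e n) a w) \<longlonglongrightarrow> (LBINT w. h w * exp (\<i> * of_real (a * w)))"
  proof (rule integral_dominated_convergence[where w = "\<lambda>w. norm (h w)"])
    show "AE w in lborel. (\<lambda>n. h w * modulated_exp (?e n) a w) \<longlonglongrightarrow> h w * exp (\<i> * of_real (a * w))"
    proof (rule AE_I2)
      fix w
      have "(\<lambda>n. h w * modulated_exp (?e n) a w) \<longlonglongrightarrow> h w * (exp (\<i> * of_real (a * w)) * of_real (exp (- 0 * \<bar>w\<bar>)))"
        unfolding modulated_exp_def by (intro tendsto_intros LIMSEQ_inverse_real_of_nat)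
      then show "(\<lambda>n. h w * modulated_exp (?e n) a w) \<longlonglongrightarrow> h w * exp (\<i> * of_real (a * w))"
        by simp
    qed
    show "AE w in lborel. norm (h w * modulated_exp (?e n) a w) \<le> norm (h w)" for n
      by (intro AE_I2) (simp add: norm_mult norm_modulated_exp mult_left_le del: of_nat_Suc)
  qed (use h in auto)
  moreover have "(LBINT w. h w * modulated_exp (?e n) a w) = sqrt (2 * pi) *\<^sub>R (LBINT x. g x * of_real (poisson_kernel (?e n) (x - a)))" for n
  proof -
    have e: "0 < ?e n" by simp
    have "(LBINT w. h w * modulated_exp (?e n) a w) = (LBINT x. g x * fourier_L1 (modulated_exp (?e n) a) x)"
      by (intro L2_fourier_pair_Parseval[OF p] modulated_exp_fourier L2_fun_modulated_exp e)
    also have "\<dots> = (LBINT x. sqrt (2 * pi) *\<^sub>R (g x * of_real (poisson_kernel (?e n) (x - a))))"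
      unfolding modulated_exp_fourier(2)[OF e] by (simp add: scaleR_conv_of_real mult_ac)
    finally show ?thesis by simp
  qed
  moreover have "(\<lambda>n. sqrt (2 * pi) *\<^sub>R (LBINT x. g x * of_real (poisson_kernel (?e n) (x - a)))) \<longlonglongrightarrow> sqrt (2 * pi) *\<^sub>R g a"
    using p by (intro tendsto_intros poisson_kernel_approximate_identity cont) (simp add: L2_fourier_pair_def)
  ultimately have "(LBINT w. h w * exp (\<i> * of_real (a * w))) = sqrt (2 * pi) *\<^sub>R g a"
    using LIMSEQ_unique by simp
  then show ?thesis
    by (simp add: mult.commute)
qed

text \<open>
  Expanding the exponential and integrating term by term gives a power series in \<open>z\<close> whose coefficients are
  \<open>i\<^sup>n / n!\<close> times the moments of \<open>h\<close>; the moments are at most \<open>|B|\<^sup>n\<close> times the \<open>L\<^sup>1\<close> norm of \<open>h\<close>, so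
  the series converges everywhere.
\<close>

lemma entire_fourier_integral:
  fixes h :: "real \<Rightarrow> complex"
  assumes h: "integrable lborel h" and supp: "AE w in lborel. w \<notin> {- B..B} \<longrightarrow> h w = 0"
  shows "(\<lambda>z. LBINT w. exp (\<i> * z * of_real w) * h w) holomorphic_on UNIV"
proof -
  have [measurable]: "h \<in> borel_measurable borel"
    using h by auto
  \<comment> \<open>the Taylor coefficients at \<open>0\<close>\<close>
  define m where "m n = (\<i> ^ n /\<^sub>R fact n) * (LBINT w. of_real w ^ n * h w)" for n :: nat
  have sums: "(\<lambda>n. m n * (z - 0) ^ n) sums (LBINT w. exp (\<i> * z * of_real w) * h w)" for z
  proof -
    define t where "t n w = (\<i> * z * of_real w) ^ n /\<^sub>R fact n * h w" for n :: nat and w :: real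
    have tm [measurable]: "t n \<in> borel_measurable borel" for n
      unfolding t_def by measurable
    have le: "AE w in lborel. norm (t n w) \<le> (norm z * \<bar>B\<bar>) ^ n /\<^sub>R fact n * norm (h w)" for n
      using supp
    proof eventually_elim
      case (elim w)
      show ?case
      proof (cases "w \<in> {- B..B}")
        case True
        then have "(norm z * \<bar>w\<bar>) ^ n \<le> (norm z * \<bar>B\<bar>) ^ n"
          by (intro power_mono mult_left_mono) auto
        then show ?thesis
          unfolding t_def by (simp add: norm_mult norm_power mult_right_mono divide_right_mono)
      next
        case False
        then show ?thesis
          using elim by (simp add: t_def)
      qed
    qed
    have intb: "integrable lborel (\<lambda>w. (norm z * \<bar>B\<bar>) ^ n /\<^sub>R fact n * norm (h w))" for n
      using h by auto
    have t: "integrable lborel (t n)" for n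
    proof (rule Bochner_Integration.integrable_bound[OF intb])
      show "AE w in lborel. norm (t n w) \<le> norm ((norm z * \<bar>B\<bar>) ^ n /\<^sub>R fact n * norm (h w))"
        using le[of n] by eventually_elim simp
    qed simp
    have "(\<lambda>n. integral\<^sup>L lborel (t n)) sums (LBINT w. (\<Sum>n. t n w))"
    proof (rule sums_integral[OF t])
      show "AE w in lborel. summable (\<lambda>n. norm (t n w))"
        unfolding t_def norm_mult by (intro AE_I2 summable_mult2 summable_norm_exp)
      show "summable (\<lambda>n. LBINT w. norm (t n w))"
      proof (rule summable_comparison_test')
        show "summable (\<lambda>n. (norm z * \<bar>B\<bar>) ^ n /\<^sub>R fact n * (LBINT w. norm (h w)))"
          by (intro summable_mult2 summable_exp_generic)
        fix n
        have "(LBINT w. norm (t n w)) \<le> (LBINT w. (norm z * \<bar>B\<bar>) ^ n /\<^sub>R fact n * norm (h w))"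
          by (intro integral_mono_AE integrable_norm t intb le)
        then show "norm (LBINT w. norm (t n w)) \<le> (norm z * \<bar>B\<bar>) ^ n /\<^sub>R fact n * (LBINT w. norm (h w))"
          by simp
      qed
    qed
    moreover have "(\<Sum>n. t n w) = exp (\<i> * z * of_real w) * h w" for w
      unfolding t_def exp_def by (rule suminf_mult2[symmetric, OF summable_exp_generic])
    moreover have "integral\<^sup>L lborel (t n) = m n * (z - 0) ^ n" for n
    proof -
      have "integral\<^sup>L lborel (t n) = (LBINT w. (\<i> ^ n /\<^sub>R fact n * z ^ n) * (of_real w ^ n * h w))"
        unfolding t_def by (intro Bochner_Integration.integral_cong refl) (simp add: power_mult_distrib mult_ac)
      also have "\<dots> = (\<i> ^ n /\<^sub>R fact n * z ^ n) * (LBINT w. of_real w ^ n * h w)"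
        by (rule integral_mult_right_zero)
      finally show ?thesis
        by (simp only: m_def diff_zero mult_ac)
    qed
    ultimately show ?thesis by simp
  qed
  have "(\<lambda>z. LBINT w. exp (\<i> * z * of_real w) * h w) holomorphic_on ball 0 r" for r
    by (rule power_series_holomorphic) (rule sums)
  then have "(\<lambda>z. LBINT w. exp (\<i> * z * of_real w) * h w) holomorphic_on (\<Union>r. ball 0 r)"
    by (subst holomorphic_on_UN_open) auto
  moreover have "(\<Union>r. ball 0 r) = (UNIV :: complex set)"
    by (auto intro: gt_ex)
  ultimately show ?thesis by simp
qed

text \<open>
  On the real axis this is Fourier inversion; both sides are entire, so the identity theorem extends it.
\<close>

theorem Paley_Wiener_representation:
  fixes g :: "complex \<Rightarrow> complex"
  assumes hol: "g holomorphic_on UNIV" and p: "L2_fourier_pair (\<lambda>x. g (of_real x)) h"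
    and supp: "AE w in lborel. w \<notin> {- B..B} \<longrightarrow> h w = 0"
  shows "g z = (1 / sqrt (2 * pi)) *\<^sub>R (LBINT w. exp (\<i> * z * of_real w) * h w)"
proof -
  have h: "integrable lborel h"
    using p by (intro integrable_if_L2_AE_supported[OF _ supp]) (simp add: L2_fourier_pair_def)
  define d where "d z = g z - (1 / sqrt (2 * pi)) *\<^sub>R (LBINT w. exp (\<i> * z * of_real w) * h w)" for z
  have "d z = 0"
  proof (rule analytic_continuation[of d UNIV "\<real>" 0])
    show "d holomorphic_on UNIV"
      unfolding d_def scaleR_conv_of_real by (intro holomorphic_intros hol entire_fourier_integral[OF h supp])
    show "0 islimpt (\<real> :: complex set)"
      unfolding islimpt_approachable
    proof (intro allI impI)
      fix e :: real assume "0 < e"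
      then show "\<exists>x'\<in>\<real>. x' \<noteq> 0 \<and> dist x' (0::complex) < e"
        by (intro bexI[of _ "of_real (e / 2)"]) auto
    qed
    fix x :: complex assume "x \<in> \<real>"
    then obtain a :: real where x: "x = of_real a"
      by (auto elim: Reals_cases)
    have "isCont g (of_real a)"
      using holomorphic_on_imp_continuous_on[OF hol] by (simp add: continuous_on_eq_continuous_at)
    then have "isCont (\<lambda>x. g (of_real x)) a"
      by (rule isCont_o2[rotated]) (auto intro!: continuous_intros)
    from L2_fourier_pair_inversion[OF p h this] show "d x = 0"
      by (simp add: d_def x mult.assoc)
  qed auto
  then show ?thesis
    by (simp add: d_def)
qed


section \<open>Complex slices of the Clifford algebra\<close>

lemma coeff_sum: "coeff (\<Sum>i\<in>S. F i) A = (\<Sum>i\<in>S. coeff (F i) A)"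
  by (induction S rule: infinite_finite_induct) auto

text \<open>
  Averaging the double sum for \<open>I\<^sup>2\<close> with its transpose brings in the anticommutators, which kill the mixed terms.
\<close>

lemma imag_sphere_square:
  assumes "I \<in> imag_sphere"
  shows "I * I = -1"
proof -
  obtain x where I: "I = (\<Sum>i\<in>UNIV. x i *\<^sub>R gen i)" and x: "(\<Sum>i\<in>UNIV. (x i)\<^sup>2) = 1"
    using assms by (auto simp: imag_sphere_def)
  have prod: "I * I = (\<Sum>i\<in>UNIV. \<Sum>j\<in>UNIV. (x i * x j) *\<^sub>R (gen i * gen j))"
    unfolding I by (simp add: sum_product) (intro sum.cong refl arg_cong2[where f = scaleR] mult.commute)
  also have "\<dots> = (\<Sum>j\<in>UNIV. \<Sum>i\<in>UNIV. (x i * x j) *\<^sub>R (gen i * gen j))"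
    by (rule sum.swap)
  also have "\<dots> = (\<Sum>i\<in>UNIV. \<Sum>j\<in>UNIV. (x i * x j) *\<^sub>R (gen j * gen i))"
    by (intro sum.cong refl arg_cong2[where f = scaleR] mult.commute)
  finally have swapped: "I * I = (\<Sum>i\<in>UNIV. \<Sum>j\<in>UNIV. (x i * x j) *\<^sub>R (gen j * gen i))" .
  have "2 *\<^sub>R (I * I) = (\<Sum>i\<in>UNIV. \<Sum>j\<in>UNIV. (x i * x j) *\<^sub>R (gen i * gen j + gen j * gen i))"
    unfolding scaleR_2 scaleR_add_right sum.distrib prod[symmetric] swapped[symmetric] ..
  also have "\<dots> = (\<Sum>i\<in>UNIV. \<Sum>j\<in>UNIV. if i = j then (x i * x j) *\<^sub>R (- 2) else 0)"
    by (intro sum.cong refl) (simp add: gen_anticommute)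
  also have "\<dots> = (\<Sum>i\<in>UNIV. (x i)\<^sup>2) *\<^sub>R (- 2)"
    by (simp add: power2_eq_square scaleR_sum_left sum_negf)
  finally have "2 *\<^sub>R (I * I) = 2 *\<^sub>R (- 1)"
    unfolding x by (simp add: scaleR_2)
  then show ?thesis
    by (simp only: scaleR_cancel_left) simp
qed

lemma imag_sphere_orthonormal:
  assumes "I \<in> imag_sphere"
  shows "inner I 1 = 0" and "norm I = 1"
proof -
  obtain x where I: "I = (\<Sum>i\<in>UNIV. x i *\<^sub>R gen i)" and x: "(\<Sum>i\<in>UNIV. (x i)\<^sup>2) = 1"
    using assms by (auto simp: imag_sphere_def)
  show "inner I 1 = 0"
    by (simp add: I one_clifford_def coeff_sum)
  have "coeff I {j} = x j" for j
    by (simp add: I coeff_sum if_distrib cong: if_cong)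
  then have "inner I I = (\<Sum>j\<in>UNIV. x j * x j)"
    by (subst (2) I) (simp add: inner_sum_right)
  also have "\<dots> = 1"
    using x by (simp add: power2_eq_square)
  finally show "norm I = 1"
    by (simp add: norm_eq_sqrt_inner)
qed

text \<open>
  The algebra isomorphism of the complex numbers with \<open>L\<^sub>I\<close>.
\<close>

definition slice_embed :: "'n :: {finite, linorder} clifford \<Rightarrow> complex \<Rightarrow> 'n clifford" where
  "slice_embed I z = of_real (Re z) + I * of_real (Im z)"

lemma slice_embed_alt: "slice_embed I z = Re z *\<^sub>R 1 + Im z *\<^sub>R I"
  by (simp add: slice_embed_def of_real_def)

lemma slice_embed_mult_left: "slice_embed I z * a = Re z *\<^sub>R a + Im z *\<^sub>R (I * a)"
  by (simp add: slice_embed_alt distrib_right)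

lemma bounded_linear_slice_embed: "bounded_linear (slice_embed I)"
  unfolding linear_conv_bounded_linear[symmetric]
  by (rule linearI) (simp_all add: slice_embed_alt algebra_simps)

lemma norm_slice_embed:
  assumes "I \<in> imag_sphere"
  shows "norm (slice_embed I z) = norm z"
proof -
  have "(norm (slice_embed I z))\<^sup>2 = (Re z)\<^sup>2 * inner (1 :: 'a clifford) 1 + (Im z)\<^sup>2 * inner I I"
    unfolding power2_norm_eq_inner slice_embed_alt using imag_sphere_orthonormal(1)[OF assms]
    by (simp add: inner_add_left inner_add_right inner_commute power2_eq_square)
  also have "\<dots> = (norm z)\<^sup>2"
    using imag_sphere_orthonormal(2)[OF assms] by (simp add: norm_eq_1[symmetric] cmod_power2 one_clifford_def)
  finally show ?thesis
    by simp
qed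

lemma slice_embed_mult:
  assumes "I \<in> imag_sphere"
  shows "slice_embed I (z * w) = slice_embed I z * slice_embed I w"
  unfolding slice_embed_mult_left unfolding slice_embed_alt
  by (simp add: distrib_left imag_sphere_square[OF assms] algebra_simps)

text \<open>
  The embedding is continuous and multiplicative, so it maps the exponential series to the exponential series.
\<close>

lemma clifford_exp_slice_embed:
  assumes "I \<in> imag_sphere"
  shows "clifford_exp (slice_embed I z) = slice_embed I (exp z)"
proof -
  have pow: "slice_embed I (z ^ k) = slice_embed I z ^ k" for k
    by (induction k) (simp_all add: slice_embed_mult[OF assms], simp add: slice_embed_def)
  have "clifford_exp (slice_embed I z) = (\<Sum>k. slice_embed I (z ^ k /\<^sub>R fact k))"
    unfolding clifford_exp_def
    by (simp add: pow linear_scale[OF bounded_linear.linear[OF bounded_linear_slice_embed]])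
  also have "\<dots> = slice_embed I (exp z)"
    unfolding exp_def by (rule bounded_linear.suminf[OF bounded_linear_slice_embed summable_exp_generic, symmetric])
  finally show ?thesis .
qed

text \<open>
  The complexification of the real functional \<open>coeff _ A\<close> with respect to the complex structure given by left
  multiplication by \<open>I\<close>, that is \<open>a\<^sub>A - i (I a)\<^sub>A\<close>. The sign makes it complex-linear; see \<open>slice_coord_mult\<close>.
\<close>

definition slice_coord :: "'n :: {finite, linorder} clifford \<Rightarrow> 'n set \<Rightarrow> 'n clifford \<Rightarrow> complex" where
  "slice_coord I A a = Complex (coeff a A) (- coeff (I * a) A)"

lemma slice_coord_eqI: "(\<And>A. slice_coord I A a = slice_coord I A b) \<Longrightarrow> a = b"
  by (simp add: clifford_eq_iff slice_coord_def)

lemma bounded_linear_slice_coord: "bounded_linear (slice_coord I A)"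
  unfolding linear_conv_bounded_linear[symmetric]
  by (rule linearI) (simp_all add: slice_coord_def complex_eq_iff distrib_left)

lemma slice_coord_mult:
  assumes "I \<in> imag_sphere"
  shows "slice_coord I A (slice_embed I z * a) = z * slice_coord I A a"
proof -
  have "I * (I * a) = - a"
    by (simp add: imag_sphere_square[OF assms] flip: mult.assoc)
  then show ?thesis
    by (simp add: slice_embed_mult_left slice_coord_def complex_eq_iff distrib_left algebra_simps)
qed

text \<open>
  The norm is not submultiplicative in general, but multiplication is bilinear in finite dimension. The
  constant depends on the algebra only, so estimates derived from it are uniform in \<open>I\<close>.
\<close>

lemma clifford_mult_bounded:
  obtains K where "1 \<le> K" "\<And>a b :: 'n :: {finite, linorder} clifford. norm (a * b) \<le> K * norm a * norm b"
proof -
  have "bilinear ((*) :: 'n clifford \<Rightarrow> 'n clifford \<Rightarrow> 'n clifford)"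
    unfolding bilinear_def by (auto intro!: linearI simp: algebra_simps)
  from bilinear_bounded[OF this] obtain K where K: "\<And>a b :: 'n clifford. norm (a * b) \<le> K * norm a * norm b"
    by blast
  have "norm (a * b) \<le> max 1 K * norm a * norm b" for a b :: "'n clifford"
    by (rule order.trans[OF K]) (intro mult_right_mono, auto)
  then show ?thesis
    using that[of "max 1 K"] by auto
qed

lemma norm_slice_coord_square:
  fixes I a :: "'n :: {finite, linorder} clifford"
  assumes K: "1 \<le> K" "\<And>a b :: 'n clifford. norm (a * b) \<le> K * norm a * norm b" and I: "I \<in> imag_sphere"
  shows "(norm (slice_coord I A a))\<^sup>2 \<le> (1 + K\<^sup>2) * (norm a)\<^sup>2"
proof -
  have co: "(coeff b A)\<^sup>2 \<le> (norm b)\<^sup>2" for b :: "'n clifford"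
    using member_le_sum[of A UNIV "\<lambda>A. (coeff b A)\<^sup>2"] by (simp add: norm_clifford_def sum_nonneg)
  have "norm (I * a) \<le> K * norm a"
    using K(2)[of I a] imag_sphere_orthonormal(2)[OF I] by simp
  then have "(norm (I * a))\<^sup>2 \<le> (K * norm a)\<^sup>2"
    by (rule power_mono) simp
  then show ?thesis
    using co[of a] co[of "I * a"] by (simp add: slice_coord_def cmod_power2 power_mult_distrib distrib_right)
qed

lemma norm_le_sum_slice_coord:
  fixes a :: "'n :: {finite, linorder} clifford"
  shows "norm a \<le> (\<Sum>A\<in>UNIV. norm (slice_coord I A a))"
proof -
  have "norm a \<le> (\<Sum>A\<in>UNIV. \<bar>coeff a A\<bar>)"
    using L2_set_le_sum_abs[of "coeff a" UNIV] by (simp add: norm_clifford_def L2_set_def)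
  also have "\<dots> \<le> (\<Sum>A\<in>UNIV. norm (slice_coord I A a))"
    by (intro sum_mono order.trans[OF _ abs_Re_le_cmod]) (simp add: slice_coord_def)
  finally show ?thesis .
qed

lemma integrable_slice_embed_mult:
  fixes G :: "real \<Rightarrow> 'n :: {finite, linorder} clifford"
  assumes G: "integrable lborel G" and [measurable]: "c \<in> borel_measurable borel" and c: "\<And>u. norm (c u) \<le> M"
  shows "integrable lborel (\<lambda>u. slice_embed I (c u) * G u)"
proof -
  have scale: "integrable lborel (\<lambda>u. r u *\<^sub>R H u)"
    if H: "integrable lborel H" and [measurable]: "r \<in> borel_measurable borel" and r: "\<And>u. \<bar>r u\<bar> \<le> M"
    for r and H :: "real \<Rightarrow> 'n clifford"
  proof (rule Bochner_Integration.integrable_bound)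
    show "integrable lborel (\<lambda>u. M *\<^sub>R H u)"
      using H by auto
    show "AE u in lborel. norm (r u *\<^sub>R H u) \<le> norm (M *\<^sub>R H u)"
      using r by (intro AE_I2) (auto intro!: mult_right_mono order.trans[OF r])
    show "(\<lambda>u. r u *\<^sub>R H u) \<in> borel_measurable lborel"
      using H by measurable
  qed
  have "bounded_linear ((*) I)"
    unfolding linear_conv_bounded_linear[symmetric] by (rule linearI) (simp_all add: distrib_left)
  then have "integrable lborel (\<lambda>u. I * G u)"
    by (rule integrable_bounded_linear[OF _ G])
  then show ?thesis
    unfolding slice_embed_mult_left
    by (intro Bochner_Integration.integrable_add scale G)
       (auto intro: order.trans[OF abs_Re_le_cmod c] order.trans[OF abs_Im_le_cmod c])
qed

lemma slice_coord_integral_exp: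
  fixes G :: "real \<Rightarrow> 'n :: {finite, linorder} clifford"
  assumes I: "I \<in> imag_sphere" and G: "integrable lborel G"
    and cm: "c \<in> borel_measurable borel" and c: "\<And>u. norm (c u) \<le> M"
  shows "slice_coord I A (LBINT u. slice_embed I (c u) * G u) = (LBINT u. c u * slice_coord I A (G u))"
  using integral_bounded_linear[OF bounded_linear_slice_coord[of I A] integrable_slice_embed_mult[OF G cm c, of I]]
  by (simp add: slice_coord_mult[OF I])

section \<open>The Clifford Fourier transform in coordinates\<close>

text \<open>
  The kernel \<open>e\<^bsup>-Iuw\<^esup>\<close> acts from the left, and the coordinates are complex-linear for that action. This is where
  the transform has to be the left-sided one.
\<close>

lemma slice_coord_clifford_fourier_L1:
  assumes I: "I \<in> imag_sphere" and G: "integrable lborel G"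
  shows "slice_coord I A (clifford_fourier_L1 I G w) = fourier_L1 (\<lambda>u. slice_coord I A (G u)) w"
proof -
  have "- (I * of_real (u * w)) = slice_embed I (- (\<i> * of_real (u * w)))" for u
    by (simp add: slice_embed_def)
  then have "clifford_exp (- (I * of_real (u * w))) = slice_embed I (exp (- (\<i> * of_real (u * w))))" for u
    by (simp only: clifford_exp_slice_embed[OF I])
  then show ?thesis
    unfolding clifford_fourier_L1_def fourier_L1_def
      linear_scale[OF bounded_linear.linear[OF bounded_linear_slice_coord]]
    using slice_coord_integral_exp[OF I G, where c = "\<lambda>u. exp (- (\<i> * of_real (u * w)))" and M = 1 and A = A]
    by simp
qed

lemma L2_fun_bounded_linear:
  assumes T: "bounded_linear T" and g: "L2_fun g"
  shows "L2_fun (\<lambda>x. T (g x))"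
proof -
  obtain M where M: "\<And>x. norm (T x) \<le> norm x * M"
    using bounded_linear.bounded[OF T] by blast
  have [measurable]: "g \<in> borel_measurable borel"
    using g by (simp add: L2_fun_def)
  have Tm [measurable]: "T \<in> borel_measurable borel"
    by (intro borel_measurable_continuous_onI linear_continuous_on T)
  have "integrable lborel (\<lambda>x. (norm (T (g x)))\<^sup>2)"
  proof (rule Bochner_Integration.integrable_bound)
    show "integrable lborel (\<lambda>x. M\<^sup>2 * (norm (g x))\<^sup>2)"
      using g by (auto simp: L2_fun_def)
    show "AE x in lborel. norm ((norm (T (g x)))\<^sup>2) \<le> norm (M\<^sup>2 * (norm (g x))\<^sup>2)"
    proof (rule AE_I2)
      fix x
      have "(norm (T (g x)))\<^sup>2 \<le> (norm (g x) * M)\<^sup>2"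
        by (intro power_mono M) simp
      then show "norm ((norm (T (g x)))\<^sup>2) \<le> norm (M\<^sup>2 * (norm (g x))\<^sup>2)"
        by (simp add: power_mult_distrib mult.commute)
    qed
  qed measurable
  then show ?thesis
    by (simp add: L2_fun_def)
qed

lemma L2_tendsto_bounded_linear:
  assumes T: "bounded_linear T" and lim: "L2_tendsto G g"
    and "\<And>n. L2_fun (G n)" "L2_fun g"
  shows "L2_tendsto (\<lambda>n x. T (G n x)) (\<lambda>x. T (g x))"
proof -
  obtain M where M: "\<And>x. norm (T x) \<le> norm x * M"
    using bounded_linear.bounded[OF T] by blast
  have [measurable]: "g \<in> borel_measurable borel" "G n \<in> borel_measurable borel" for n
    using assms by (auto simp: L2_fun_def)
  have le: "(\<integral>\<^sup>+x. ennreal ((norm (T (G n x) - T (g x)))\<^sup>2) \<partial>lborel) \<le> ennreal (M\<^sup>2) * (\<integral>\<^sup>+x. ennreal ((norm (G n x - g x))\<^sup>2) \<partial>lborel)" for n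
  proof -
    have "(\<integral>\<^sup>+x. ennreal ((norm (T (G n x) - T (g x)))\<^sup>2) \<partial>lborel) \<le> (\<integral>\<^sup>+x. ennreal (M\<^sup>2) * ennreal ((norm (G n x - g x))\<^sup>2) \<partial>lborel)"
    proof (rule nn_integral_mono)
      fix x
      have "(norm (T (G n x - g x)))\<^sup>2 \<le> (norm (G n x - g x) * M)\<^sup>2"
        by (intro power_mono M) simp
      then show "ennreal ((norm (T (G n x) - T (g x)))\<^sup>2) \<le> ennreal (M\<^sup>2) * ennreal ((norm (G n x - g x))\<^sup>2)"
        by (simp add: linear_diff[OF bounded_linear.linear[OF T]] power_mult_distrib mult.commute flip: ennreal_mult)
    qed
    also have "\<dots> = ennreal (M\<^sup>2) * (\<integral>\<^sup>+x. ennreal ((norm (G n x - g x))\<^sup>2) \<partial>lborel)"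
      by (rule nn_integral_cmult) measurable
    finally show ?thesis .
  qed
  have "(\<lambda>n. ennreal (M\<^sup>2) * (\<integral>\<^sup>+x. ennreal ((norm (G n x - g x))\<^sup>2) \<partial>lborel)) \<longlonglongrightarrow> ennreal (M\<^sup>2) * 0"
    using lim unfolding L2_tendsto_def by (intro ennreal_tendsto_cmult) auto
  then have lim0: "(\<lambda>n. ennreal (M\<^sup>2) * (\<integral>\<^sup>+x. ennreal ((norm (G n x - g x))\<^sup>2) \<partial>lborel)) \<longlonglongrightarrow> 0"
    by simp
  show ?thesis
    unfolding L2_tendsto_def
    by (rule tendsto_sandwich[OF always_eventually always_eventually tendsto_const lim0])
       (simp_all only: le zero_le simp_thms)
qed

lemma nn_integral_clifford_fourier_L1_le:
  fixes G :: "real \<Rightarrow> 'n :: {finite, linorder} clifford"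
  assumes K: "1 \<le> K" "\<And>a b :: 'n clifford. norm (a * b) \<le> K * norm a * norm b"
    and I: "I \<in> imag_sphere" and G: "integrable lborel G"
  shows "(\<integral>\<^sup>+w. ennreal ((norm (clifford_fourier_L1 I G w))\<^sup>2) \<partial>lborel)
    \<le> of_nat (CARD('n set)) * (ennreal (1 + K\<^sup>2) * (\<integral>\<^sup>+x. ennreal ((norm (G x))\<^sup>2) \<partial>lborel))"
proof -
  have [measurable]: "G \<in> borel_measurable borel"
    using G by auto
  have [measurable]: "slice_coord I A \<in> borel_measurable borel" for A
    by (intro borel_measurable_continuous_onI linear_continuous_on bounded_linear_slice_coord)
  let ?c = "\<lambda>A u. slice_coord I A (G u)"
  have "(\<integral>\<^sup>+w. ennreal ((norm (clifford_fourier_L1 I G w))\<^sup>2) \<partial>lborel) \<le> (\<integral>\<^sup>+w. (\<Sum>A\<in>UNIV. ennreal ((norm (fourier_L1 (?c A) w))\<^sup>2)) \<partial>lborel)"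
  proof (rule nn_integral_mono)
    fix w
    have "(coeff (clifford_fourier_L1 I G w) A)\<^sup>2 \<le> (norm (fourier_L1 (?c A) w))\<^sup>2" for A
      unfolding slice_coord_clifford_fourier_L1[OF I G, symmetric] by (simp add: slice_coord_def cmod_power2)
    then have "(norm (clifford_fourier_L1 I G w))\<^sup>2 \<le> (\<Sum>A\<in>UNIV. (norm (fourier_L1 (?c A) w))\<^sup>2)"
      by (simp add: norm_clifford_def sum_nonneg sum_mono)
    then show "ennreal ((norm (clifford_fourier_L1 I G w))\<^sup>2) \<le> (\<Sum>A\<in>UNIV. ennreal ((norm (fourier_L1 (?c A) w))\<^sup>2))"
      by (subst sum_ennreal) (auto intro: ennreal_leI)
  qed
  also have "\<dots> = (\<Sum>A\<in>UNIV. \<integral>\<^sup>+w. ennreal ((norm (fourier_L1 (?c A) w))\<^sup>2) \<partial>lborel)"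
    by (rule nn_integral_sum) measurable
  also have "\<dots> \<le> (\<Sum>A\<in>(UNIV :: 'n set set). ennreal (1 + K\<^sup>2) * (\<integral>\<^sup>+x. ennreal ((norm (G x))\<^sup>2) \<partial>lborel))"
  proof (rule sum_mono)
    fix A
    have "(\<integral>\<^sup>+w. ennreal ((norm (fourier_L1 (?c A) w))\<^sup>2) \<partial>lborel) \<le> (\<integral>\<^sup>+x. ennreal ((norm (?c A x))\<^sup>2) \<partial>lborel)"
      by (intro fourier_L1_Plancherel_le integrable_bounded_linear[OF bounded_linear_slice_coord G])
    also have "\<dots> \<le> (\<integral>\<^sup>+x. ennreal (1 + K\<^sup>2) * ennreal ((norm (G x))\<^sup>2) \<partial>lborel)"
    proof (rule nn_integral_mono)
      fix x
      have "ennreal ((norm (?c A x))\<^sup>2) \<le> ennreal ((1 + K\<^sup>2) * (norm (G x))\<^sup>2)"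
        by (intro ennreal_leI norm_slice_coord_square[OF K I])
      also have "\<dots> = ennreal (1 + K\<^sup>2) * ennreal ((norm (G x))\<^sup>2)"
        by (rule ennreal_mult) auto
      finally show "ennreal ((norm (?c A x))\<^sup>2) \<le> ennreal (1 + K\<^sup>2) * ennreal ((norm (G x))\<^sup>2)" .
    qed
    also have "\<dots> = ennreal (1 + K\<^sup>2) * (\<integral>\<^sup>+x. ennreal ((norm (G x))\<^sup>2) \<partial>lborel)"
      by (rule nn_integral_cmult) measurable
    finally show "(\<integral>\<^sup>+w. ennreal ((norm (fourier_L1 (?c A) w))\<^sup>2) \<partial>lborel) \<le> ennreal (1 + K\<^sup>2) * (\<integral>\<^sup>+x. ennreal ((norm (G x))\<^sup>2) \<partial>lborel)" .
  qed
  finally show ?thesis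
    by simp
qed

lemma L2_fun_clifford_fourier_L1:
  fixes H :: "real \<Rightarrow> 'n :: {finite, linorder} clifford"
  assumes I: "I \<in> imag_sphere" and H: "integrable lborel H" "L2_fun H"
  shows "L2_fun (clifford_fourier_L1 I H)"
proof -
  obtain K where K: "1 \<le> K" "\<And>a b :: 'n clifford. norm (a * b) \<le> K * norm a * norm b"
    by (rule clifford_mult_bounded) blast
  have [measurable]: "fourier_L1 (\<lambda>u. slice_coord I A (H u)) \<in> borel_measurable borel" for A
    using integrable_bounded_linear[OF bounded_linear_slice_coord H(1)] by (intro fourier_L1_measurable) auto
  have "coeff (clifford_fourier_L1 I H w) A = Re (fourier_L1 (\<lambda>u. slice_coord I A (H u)) w)" for w A
    unfolding slice_coord_clifford_fourier_L1[OF I H(1), symmetric] by (simp add: slice_coord_def)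
  then have "clifford_fourier_L1 I H = (\<lambda>w. \<Sum>A\<in>UNIV. Re (fourier_L1 (\<lambda>u. slice_coord I A (H u)) w) *\<^sub>R blade A)"
    by (simp add: fun_eq_iff clifford_eq_iff coeff_sum if_distrib cong: if_cong)
  then have "clifford_fourier_L1 I H \<in> borel_measurable borel"
    by simp
  moreover have "(\<integral>\<^sup>+w. ennreal ((norm (clifford_fourier_L1 I H w))\<^sup>2) \<partial>lborel) < \<infinity>"
    using H(2) by (intro le_less_trans[OF nn_integral_clifford_fourier_L1_le[OF K I H(1)]])
      (simp add: L2_fun_iff_nn_integral ennreal_mult_less_top power_less_top_ennreal)
  ultimately show ?thesis
    by (simp add: L2_fun_iff_nn_integral)
qed

lemma L2_truncation:
  fixes g :: "real \<Rightarrow> 'b :: euclidean_space"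
  assumes g: "L2_fun g" and e: "0 < e"
  shows "\<exists>r::real. (\<integral>\<^sup>+x. ennreal ((norm (g x - indicator {-r..r} x *\<^sub>R g x))\<^sup>2) \<partial>lborel) \<le> ennreal e"
proof -
  have [measurable]: "g \<in> borel_measurable borel"
    using g by (simp add: L2_fun_def)
  have "(\<lambda>n. \<integral>\<^sup>+x. ennreal ((norm (g x - indicator {-real n..real n} x *\<^sub>R g x))\<^sup>2) \<partial>lborel) \<longlonglongrightarrow> (\<integral>\<^sup>+x. 0 \<partial>(lborel :: real measure))"
  proof (rule nn_integral_dominated_convergence[where w = "\<lambda>x. ennreal ((norm (g x))\<^sup>2)"])
    show "AE x in lborel. (\<lambda>n. ennreal ((norm (g x - indicator {-real n..real n} x *\<^sub>R g x))\<^sup>2)) \<longlonglongrightarrow> 0"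
    proof (rule AE_I2)
      fix x :: real
      obtain N :: nat where N: "\<bar>x\<bar> \<le> real N"
        using real_arch_simple by blast
      have "eventually (\<lambda>n. ennreal ((norm (g x - indicator {-real n..real n} x *\<^sub>R g x))\<^sup>2) = 0) sequentially"
        using eventually_ge_at_top[of N] by eventually_elim (use N in \<open>auto simp: indicator_def\<close>)
      then show "(\<lambda>n. ennreal ((norm (g x - indicator {-real n..real n} x *\<^sub>R g x))\<^sup>2)) \<longlonglongrightarrow> 0"
        by (rule tendsto_eventually)
    qed
    show "AE x in lborel. ennreal ((norm (g x - indicator {-real n..real n} x *\<^sub>R g x))\<^sup>2) \<le> ennreal ((norm (g x))\<^sup>2)" for n
      by (intro AE_I2) (auto simp: indicator_def)
    show "(\<integral>\<^sup>+x. ennreal ((norm (g x))\<^sup>2) \<partial>lborel) < \<infinity>"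
      using g by (simp add: L2_fun_iff_nn_integral)
  qed measurable
  then have "(\<lambda>n. \<integral>\<^sup>+x. ennreal ((norm (g x - indicator {-real n..real n} x *\<^sub>R g x))\<^sup>2) \<partial>lborel) \<longlonglongrightarrow> 0"
    by simp
  from order_tendstoD(2)[OF this, of "ennreal e"] e
  have "eventually (\<lambda>n. (\<integral>\<^sup>+x. ennreal ((norm (g x - indicator {-real n..real n} x *\<^sub>R g x))\<^sup>2) \<partial>lborel) < ennreal e) sequentially"
    by simp
  then show ?thesis
    using less_imp_le by (auto simp: eventually_sequentially)
qed

text \<open>
  The truncations of \<open>g\<close> to intervals are integrable and, with the intervals chosen large enough, converge to \<open>g\<close> at
  a geometric rate. By Plancherel's inequality in each coordinate, so do their transforms.
\<close>

lemma is_clifford_fourier_exists: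
  fixes g :: "real \<Rightarrow> 'n :: {finite, linorder} clifford"
  assumes I: "I \<in> imag_sphere" and g: "L2_fun g"
  shows "\<exists>h. is_clifford_fourier I g h"
proof -
  obtain K where K: "1 \<le> K" "\<And>a b :: 'n clifford. norm (a * b) \<le> K * norm a * norm b"
    by (rule clifford_mult_bounded) blast
  have [measurable]: "g \<in> borel_measurable borel"
    using g by (simp add: L2_fun_def)
  let ?N = "\<lambda>f. \<integral>\<^sup>+x. ennreal ((norm (f x :: 'n clifford))\<^sup>2) \<partial>(lborel :: real measure)"
  have "\<forall>k. \<exists>r::real. ?N (\<lambda>x. g x - indicator {-r..r} x *\<^sub>R g x) \<le> ennreal ((1 / 4) ^ k)"
    by (intro allI L2_truncation[OF g]) simp
  then obtain r :: "nat \<Rightarrow> real" where r: "\<And>k. ?N (\<lambda>x. g x - indicator {- (r k)..r k} x *\<^sub>R g x) \<le> ennreal ((1 / 4) ^ k)"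
    by metis
  define G where "G k x = indicator {- (r k)..r k} x *\<^sub>R g x" for k :: nat and x
  have Gm [measurable]: "G k \<in> borel_measurable borel" for k
    unfolding G_def by measurable
  have GL2: "L2_fun (G k)" for k
  proof -
    have "?N (G k) \<le> ?N g"
      by (intro nn_integral_mono) (auto simp: G_def indicator_def)
    then show ?thesis
      using g by (auto simp: L2_fun_iff_nn_integral)
  qed
  have GL1: "integrable lborel (G k)" for k
    by (rule integrable_if_L2_AE_supported[OF GL2, where B = "r k"]) (auto simp: G_def indicator_def)
  have Gg: "L2_tendsto G g"
    unfolding L2_tendsto_def
  proof (rule tendsto_sandwich[OF always_eventually always_eventually tendsto_const])
    have "(\<lambda>k. ennreal ((1 / 4) ^ k)) \<longlonglongrightarrow> ennreal 0"
      by (intro tendsto_ennrealI LIMSEQ_power_zero) simp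
    then show "(\<lambda>k. ennreal ((1 / 4) ^ k)) \<longlonglongrightarrow> 0" by simp
    show "\<forall>k. ?N (\<lambda>x. G k x - g x) \<le> ennreal ((1 / 4) ^ k)"
      using r by (simp add: G_def norm_minus_commute)
  qed simp
  let ?c = "of_nat (CARD('n set)) * ennreal (1 + K\<^sup>2)"
  have "\<exists>h. L2_fun h \<and> L2_tendsto (\<lambda>k. clifford_fourier_L1 I (G k)) h"
  proof (rule L2_Riesz_Fischer_geometric)
    show "L2_fun (clifford_fourier_L1 I (G k))" for k
      by (intro L2_fun_clifford_fourier_L1 I GL1 GL2)
    show "?c * 4 < \<infinity>"
      by (simp add: ennreal_mult_less_top power_less_top_ennreal)
    fix m n :: nat assume mn: "m \<le> n"
    have "clifford_fourier_L1 I (G n) w - clifford_fourier_L1 I (G m) w = clifford_fourier_L1 I (\<lambda>x. G n x - G m x) w" for w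
    proof (rule slice_coord_eqI[of I])
      fix A
      have intA: "integrable lborel (\<lambda>u. exp (- (\<i> * of_real (u * w))) * slice_coord I A (G k u))" for k
        by (intro integrable_exp_i_mult integrable_bounded_linear[OF bounded_linear_slice_coord GL1])
      show "slice_coord I A (clifford_fourier_L1 I (G n) w - clifford_fourier_L1 I (G m) w) = slice_coord I A (clifford_fourier_L1 I (\<lambda>x. G n x - G m x) w)"
        unfolding linear_diff[OF bounded_linear.linear[OF bounded_linear_slice_coord]]
          slice_coord_clifford_fourier_L1[OF I GL1] slice_coord_clifford_fourier_L1[OF I Bochner_Integration.integrable_diff[OF GL1 GL1]]
        unfolding fourier_L1_def
        using Bochner_Integration.integral_diff[OF intA[of n] intA[of m]]
        by (simp add: right_diff_distrib scaleR_diff_right)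
    qed
    then have diff: "?N (\<lambda>w. clifford_fourier_L1 I (G n) w - clifford_fourier_L1 I (G m) w) = ?N (clifford_fourier_L1 I (\<lambda>x. G n x - G m x))"
      by simp
    have "?N (\<lambda>x. G n x - G m x) \<le> 2 * ?N (\<lambda>x. g x - G m x) + 2 * ?N (\<lambda>x. (g x - G m x) - (G n x - G m x))"
      by (rule nn_integral_norm_square_triangle) measurable
    also have "\<dots> \<le> 2 * ennreal ((1 / 4) ^ m) + 2 * ennreal ((1 / 4) ^ m)"
    proof (intro add_mono mult_left_mono)
      show "?N (\<lambda>x. g x - G m x) \<le> ennreal ((1 / 4) ^ m)"
        using r[of m] by (simp add: G_def)
      have "?N (\<lambda>x. (g x - G m x) - (G n x - G m x)) \<le> ennreal ((1 / 4) ^ n)"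
        using r[of n] by (simp add: G_def)
      also have "\<dots> \<le> ennreal ((1 / 4) ^ m)"
        using mn by (intro ennreal_leI power_decreasing) auto
      finally show "?N (\<lambda>x. (g x - G m x) - (G n x - G m x)) \<le> ennreal ((1 / 4) ^ m)" .
    qed auto
    also have "2 * ennreal ((1 / 4) ^ m) + 2 * ennreal ((1 / 4) ^ m) = 4 * ennreal ((1 / 4) ^ m)"
      by (simp flip: distrib_right)
    finally have "of_nat (CARD('n set)) * (ennreal (1 + K\<^sup>2) * ?N (\<lambda>x. G n x - G m x))
        \<le> of_nat (CARD('n set)) * (ennreal (1 + K\<^sup>2) * (4 * ennreal ((1 / 4) ^ m)))"
      by (intro mult_left_mono) auto
    then have "?N (clifford_fourier_L1 I (\<lambda>x. G n x - G m x)) \<le> of_nat (CARD('n set)) * (ennreal (1 + K\<^sup>2) * (4 * ennreal ((1 / 4) ^ m)))"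
      by (rule order.trans[OF nn_integral_clifford_fourier_L1_le[OF K I Bochner_Integration.integrable_diff[OF GL1 GL1]]])
    then show "?N (\<lambda>w. clifford_fourier_L1 I (G n) w - clifford_fourier_L1 I (G m) w) \<le> ?c * 4 * ennreal ((1 / 4) ^ m)"
      unfolding diff by (simp only: mult.assoc)
  qed
  then show ?thesis
    unfolding is_clifford_fourier_def using GL1 GL2 Gg by blast
qed

lemma L2_fourier_pair_slice_coord:
  fixes g :: "real \<Rightarrow> 'n :: {finite, linorder} clifford"
  assumes I: "I \<in> imag_sphere" and g: "L2_fun g" and h: "is_clifford_fourier I g h"
  shows "L2_fourier_pair (\<lambda>x. slice_coord I A (g x)) (\<lambda>w. slice_coord I A (h w))"
proof -
  obtain G where G: "\<And>k. integrable lborel (G k)" "\<And>k. L2_fun (G k)" "L2_tendsto G g"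
      "L2_tendsto (\<lambda>k. clifford_fourier_L1 I (G k)) h" and hL2: "L2_fun h"
    using h by (auto simp: is_clifford_fourier_def)
  note bl = bounded_linear_slice_coord[of I A]
  have "L2_tendsto (\<lambda>k w. slice_coord I A (clifford_fourier_L1 I (G k) w)) (\<lambda>w. slice_coord I A (h w))"
    by (rule L2_tendsto_bounded_linear[OF bl G(4) L2_fun_clifford_fourier_L1[OF I G(1,2)] hL2])
  then have "L2_tendsto (\<lambda>k. fourier_L1 (\<lambda>u. slice_coord I A (G k u))) (\<lambda>w. slice_coord I A (h w))"
    by (simp add: slice_coord_clifford_fourier_L1[OF I G(1)])
  moreover have "L2_tendsto (\<lambda>k x. slice_coord I A (G k x)) (\<lambda>x. slice_coord I A (g x))"
    by (rule L2_tendsto_bounded_linear[OF bl G(3,2) g])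
  ultimately show ?thesis
    unfolding L2_fourier_pair_def
    using L2_fun_bounded_linear[OF bl g] L2_fun_bounded_linear[OF bl hL2] L2_fun_bounded_linear[OF bl G(2)]
      integrable_bounded_linear[OF bl G(1)]
    by (intro conjI exI[of _ "\<lambda>k x. slice_coord I A (G k x)"]) auto
qed

section \<open>Slice monogenic functions of exponential type\<close>

text \<open>
  The complement of the essential support is a union of possibly uncountably many open sets on each of which \<open>h\<close>
  vanishes almost everywhere. By Lindelof's theorem countably many of them suffice, so \<open>h\<close> vanishes almost
  everywhere on the union.
\<close>

lemma ess_support_subset_iff:
  assumes "closed S"
  shows "ess_support h \<subseteq> S \<longleftrightarrow> (AE w in lborel. w \<notin> S \<longrightarrow> h w = 0)"
proof
  assume "AE w in lborel. w \<notin> S \<longrightarrow> h w = 0"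
  then show "ess_support h \<subseteq> S"
    using assms by (auto simp: ess_support_def open_Compl intro!: exI[of _ "- S"])
next
  assume sub: "ess_support h \<subseteq> S"
  let ?W = "{W. open W \<and> (AE w in lborel. w \<in> W \<longrightarrow> h w = 0)}"
  obtain C where C: "C \<subseteq> ?W" "countable C" "\<Union>C = \<Union>?W"
    by (rule Lindelof[of ?W]) auto
  have "AE w in lborel. \<forall>W\<in>C. w \<in> W \<longrightarrow> h w = 0"
    using C by (subst AE_ball_countable) auto
  then show "AE w in lborel. w \<notin> S \<longrightarrow> h w = 0"
  proof eventually_elim
    case (elim w)
    show ?case
    proof
      assume "w \<notin> S"
      then have "w \<in> \<Union>?W"
        using sub by (auto simp: ess_support_def)
      then show "h w = 0"
        using elim C(3) by blast
    qed
  qed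
qed

lemma slice_embed_in_paravectors:
  assumes "I \<in> imag_sphere"
  shows "slice_embed I z \<in> paravectors"
proof -
  obtain x where "I = (\<Sum>i\<in>UNIV. x i *\<^sub>R gen i)"
    using assms by (auto simp: imag_sphere_def)
  then have "slice_embed I z = of_real (Re z) + (\<Sum>i\<in>UNIV. (Im z * x i) *\<^sub>R gen i)"
    by (simp add: slice_embed_alt of_real_def scaleR_sum_right)
  then show ?thesis
    by (auto simp: paravectors_def)
qed

text \<open>
  The splitting of a slice monogenic function into holomorphic components. The equation says \<open>D\<^sub>i = I D\<^sub>1\<close> for
  the real partial derivatives along a slice, so the real derivative is right multiplication of the slice variable by
  the fixed element \<open>D\<^sub>1\<close>; its coordinates are complex-linear.
\<close>

lemma slice_monogenic_imp_holomorphic: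
  fixes f :: "'n :: {finite, linorder} clifford \<Rightarrow> 'n clifford"
  assumes f: "left_slice_monogenic_on paravectors f" and I: "I \<in> imag_sphere"
  shows "(\<lambda>z. slice_coord I A (f (slice_embed I z))) holomorphic_on UNIV"
proof (rule holomorphic_onI)
  fix z :: complex
  have sq: "I * I = - 1"
    by (rule imag_sphere_square[OF I])
  have "f differentiable (at (slice_embed I z) within paravectors)"
    using f slice_embed_in_paravectors[OF I] by (auto simp: left_slice_monogenic_on_def differentiable_on_def)
  then obtain D where D: "(f has_derivative D) (at (slice_embed I z) within paravectors)"
    by (auto simp: differentiable_def)
  define F where "F w = f (slice_embed I w)" for w
  have linD: "linear D"
    using D by (rule has_derivative_linear)
  have F: "(F has_derivative (\<lambda>w. D (slice_embed I w))) (at z)"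
  proof -
    have "(slice_embed I has_derivative slice_embed I) (at z within UNIV)"
      by (rule bounded_linear_imp_has_derivative[OF bounded_linear_slice_embed])
    moreover have "(f has_derivative D) (at (slice_embed I z) within range (slice_embed I))"
      by (rule has_derivative_subset[OF D]) (use slice_embed_in_paravectors[OF I] in auto)
    ultimately have "(f \<circ> slice_embed I has_derivative D \<circ> slice_embed I) (at z within UNIV)"
      by (rule diff_chain_within)
    then show ?thesis
      by (simp add: F_def[abs_def] o_def)
  qed
  have line: "vector_derivative (\<lambda>s. F (p s)) (at r) = D (slice_embed I c)"
    if p: "(p has_vector_derivative c) (at r)" and z: "p r = z" for p c r
  proof (rule vector_derivative_at)
    have "(F \<circ> p has_derivative (\<lambda>w. D (slice_embed I w)) \<circ> (\<lambda>s. s *\<^sub>R c)) (at r)"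
      using p F z by (intro diff_chain_at) (auto simp: has_vector_derivative_def)
    then show "((\<lambda>s. F (p s)) has_vector_derivative D (slice_embed I c)) (at r)"
      by (simp add: has_vector_derivative_def o_def linear_scale[OF linD]
          linear_scale[OF bounded_linear.linear[OF bounded_linear_slice_embed]])
  qed
  have emb: "f (of_real s + I * of_real t) = F (Complex s t)" for s t
    by (simp add: F_def slice_embed_def)
  have "vector_derivative (\<lambda>s. F (Complex s (Im z))) (at (Re z)) = D (slice_embed I 1)"
    by (rule line) (auto simp: Complex_eq complex_eq_iff intro!: derivative_eq_intros has_vector_derivative_real_field)
  moreover have "vector_derivative (\<lambda>t. F (Complex (Re z) t)) (at (Im z)) = D (slice_embed I \<i>)"
    by (rule line) (auto simp: Complex_eq complex_eq_iff intro!: derivative_eq_intros has_vector_derivative_real_field)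
  moreover have "(1 / 2) *\<^sub>R (vector_derivative (\<lambda>s. F (Complex s (Im z))) (at (Re z))
      + I * vector_derivative (\<lambda>t. F (Complex (Re z) t)) (at (Im z))) = 0"
  proof -
    have "of_real (Re z) + I * of_real (Im z) \<in> paravectors"
      using slice_embed_in_paravectors[OF I, of z] by (simp add: slice_embed_def)
    then show ?thesis
      using f I unfolding left_slice_monogenic_on_def emb[symmetric] by blast
  qed
  ultimately have CR: "D (slice_embed I 1) + I * D (slice_embed I \<i>) = 0"
    by simp
  define d where "d = D (slice_embed I 1)"
  have "I * d = D (slice_embed I \<i>)"
  proof -
    have "I * (d + I * D (slice_embed I \<i>)) = 0"
      using CR by (simp add: d_def)
    then have "I * d + (I * I) * D (slice_embed I \<i>) = 0"
      by (simp add: distrib_left mult.assoc)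
    then show ?thesis
      by (simp add: sq)
  qed
  then have Dw: "D (slice_embed I w) = slice_embed I w * d" for w
  proof -
    have "D (slice_embed I w) = Re w *\<^sub>R d + Im w *\<^sub>R D (slice_embed I \<i>)"
      by (simp add: slice_embed_alt d_def linear_add[OF linD] linear_scale[OF linD])
    then show ?thesis
      using \<open>I * d = D (slice_embed I \<i>)\<close> by (simp add: slice_embed_mult_left)
  qed
  have "((\<lambda>z. slice_coord I A (F z)) has_derivative (\<lambda>w. slice_coord I A (D (slice_embed I w)))) (at z)"
    by (rule bounded_linear.has_derivative[OF bounded_linear_slice_coord F])
  then have "((\<lambda>z. slice_coord I A (F z)) has_field_derivative slice_coord I A d) (at z)"
    by (simp add: Dw slice_coord_mult[OF I] has_field_derivative_def mult_commute_abs)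
  then show "(\<lambda>z. slice_coord I A (f (slice_embed I z))) field_differentiable (at z within UNIV)"
    by (auto simp: F_def field_differentiable_def)
qed

lemma of_real_eq_slice_embed: "of_real x = slice_embed I (of_real x)"
  by (simp add: slice_embed_def)

lemma is_clifford_fourier_clifford_fourier:
  assumes "I \<in> imag_sphere" "L2_fun g"
  shows "is_clifford_fourier I g (clifford_fourier I g)"
  unfolding clifford_fourier_def using is_clifford_fourier_exists[OF assms] by (rule someI_ex)

context
  fixes f :: "'n :: {finite, linorder} clifford \<Rightarrow> 'n clifford"
  assumes f: "left_slice_monogenic_on paravectors f" and L2: "L2_fun (\<lambda>x :: real. f (of_real x))"
begin

lemma slice_pair:
  assumes I: "I \<in> imag_sphere"
  shows "L2_fourier_pair (\<lambda>x. slice_coord I A (f (slice_embed I (of_real x))))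
    (\<lambda>w. slice_coord I A (clifford_fourier I (\<lambda>x. f (of_real x)) w))"
  using L2_fourier_pair_slice_coord[OF I L2 is_clifford_fourier_clifford_fourier[OF I L2], of A]
  by (simp add: of_real_eq_slice_embed[of _ I])

lemma growth_imp_band_limited:
  assumes I: "I \<in> imag_sphere" and B: "0 < B"
    and growth: "\<And>z. norm (f (slice_embed I z)) \<le> C * exp (B * norm z)"
  shows "AE w in lborel. w \<notin> {- B..B} \<longrightarrow> clifford_fourier I (\<lambda>x. f (of_real x)) w = 0"
proof -
  let ?h = "clifford_fourier I (\<lambda>x. f (of_real x))"
  have "AE w in lborel. w \<notin> {- B..B} \<longrightarrow> slice_coord I A (?h w) = 0" for A
  proof -
    obtain M where M: "0 < M" "\<And>a. norm (slice_coord I A a) \<le> norm a * M"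
      using bounded_linear.pos_bounded[OF bounded_linear_slice_coord] by blast
    show ?thesis
    proof (rule Paley_Wiener_support[OF slice_monogenic_imp_holomorphic[OF f I] _ B slice_pair[OF I]])
      fix z
      have "norm (slice_coord I A (f (slice_embed I z))) \<le> norm (f (slice_embed I z)) * M"
        by (rule M(2))
      also have "\<dots> \<le> (C * exp (B * norm z)) * M"
        using M(1) by (intro mult_right_mono growth) simp
      finally show "norm (slice_coord I A (f (slice_embed I z))) \<le> (C * M) * exp (B * norm z)"
        by (simp add: mult_ac)
    qed
  qed
  then have "AE w in lborel. \<forall>A\<in>UNIV. w \<notin> {- B..B} \<longrightarrow> slice_coord I A (?h w) = 0"
    by (intro AE_finite_allI) auto
  then show ?thesis
  proof eventually_elim
    case (elim w)
    show ?case
    proof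
      assume "w \<notin> {- B..B}"
      then show "?h w = 0"
        using elim by (intro slice_coord_eqI[of I]) (simp add: linear_0[OF bounded_linear.linear[OF bounded_linear_slice_coord]])
    qed
  qed
qed

lemma band_limited_slice_coord:
  assumes I: "I \<in> imag_sphere"
    and supp: "AE w in lborel. w \<notin> {- B..B} \<longrightarrow> clifford_fourier I (\<lambda>x. f (of_real x)) w = 0"
  shows "AE w in lborel. w \<notin> {- B..B} \<longrightarrow> slice_coord I A (clifford_fourier I (\<lambda>x. f (of_real x)) w) = 0"
  using supp by eventually_elim (simp add: linear_0[OF bounded_linear.linear[OF bounded_linear_slice_coord]])

lemma band_limited_representation:
  assumes I: "I \<in> imag_sphere"
    and supp: "AE w in lborel. w \<notin> {- B..B} \<longrightarrow> clifford_fourier I (\<lambda>x. f (of_real x)) w = 0"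
  shows "f (of_real u + I * of_real v) = (1 / sqrt (2 * pi)) *\<^sub>R
    (LBINT w:{-B..B}. clifford_exp (I * (of_real u + I * of_real v) * of_real w) * clifford_fourier I (\<lambda>x. f (of_real x)) w)"
proof (rule slice_coord_eqI[of I])
  fix A
  let ?h = "clifford_fourier I (\<lambda>x. f (of_real x))"
  define z where "z = Complex u v"
  \<comment> \<open>cutting off the kernel keeps it bounded, so that the coordinates may be taken under the integral\<close>
  define c where "c w = (if w \<in> {- B..B} then exp (\<i> * z * of_real w) else 0)" for w
  have emb: "of_real u + I * of_real v = slice_embed I z"
    by (simp add: slice_embed_def z_def)
  have cm: "c \<in> borel_measurable borel"
    unfolding c_def by measurable
  have cb: "norm (c w) \<le> exp (\<bar>B\<bar> * \<bar>v\<bar>)" for w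
  proof (cases "w \<in> {- B..B}")
    case True
    then have "\<bar>v * w\<bar> \<le> \<bar>v\<bar> * \<bar>B\<bar>"
      unfolding abs_mult by (intro mult_left_mono) auto
    then have "- (v * w) \<le> \<bar>B\<bar> * \<bar>v\<bar>"
      by (simp add: mult.commute)
    with True show ?thesis
      by (simp add: c_def z_def)
  qed (auto simp: c_def)
  have h: "integrable lborel ?h"
    using is_clifford_fourier_clifford_fourier[OF I L2]
    by (intro integrable_if_L2_AE_supported[OF _ supp]) (simp add: is_clifford_fourier_def)
  have "I * slice_embed I z * of_real w = slice_embed I (\<i> * z * of_real w)" for w
  proof -
    have "slice_embed I \<i> = I"
      by (simp add: slice_embed_def)
    then show ?thesis
      using of_real_eq_slice_embed[of w I] by (simp add: slice_embed_mult[OF I])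
  qed
  then have "indicator {- B..B} w *\<^sub>R (clifford_exp (I * slice_embed I z * of_real w) * ?h w) = slice_embed I (c w) * ?h w" for w
    by (simp add: clifford_exp_slice_embed[OF I] c_def indicator_def linear_0[OF bounded_linear.linear[OF bounded_linear_slice_embed]])
  then have "slice_coord I A (LBINT w:{-B..B}. clifford_exp (I * slice_embed I z * of_real w) * ?h w)
      = (LBINT w. c w * slice_coord I A (?h w))"
    unfolding set_lebesgue_integral_def by (simp add: slice_coord_integral_exp[OF I h cm cb])
  also have "\<dots> = (LBINT w. exp (\<i> * z * of_real w) * slice_coord I A (?h w))"
  proof (rule integral_cong_AE)
    have [measurable]: "(\<lambda>w. slice_coord I A (?h w)) \<in> borel_measurable borel"
      using integrable_bounded_linear[OF bounded_linear_slice_coord h] by auto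
    show "(\<lambda>w. c w * slice_coord I A (?h w)) \<in> borel_measurable lborel"
      using cm by measurable
    show "(\<lambda>w. exp (\<i> * z * of_real w) * slice_coord I A (?h w)) \<in> borel_measurable lborel"
      by measurable
    show "AE w in lborel. c w * slice_coord I A (?h w) = exp (\<i> * z * of_real w) * slice_coord I A (?h w)"
      using band_limited_slice_coord[OF I supp, of A] by eventually_elim (auto simp: c_def)
  qed
  also have "(1 / sqrt (2 * pi)) *\<^sub>R \<dots> = slice_coord I A (f (slice_embed I z))"
    by (rule Paley_Wiener_representation[OF slice_monogenic_imp_holomorphic[OF f I] slice_pair[OF I] band_limited_slice_coord[OF I supp], symmetric])
  finally show "slice_coord I A (f (of_real u + I * of_real v)) = slice_coord I A ((1 / sqrt (2 * pi)) *\<^sub>R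
    (LBINT w:{-B..B}. clifford_exp (I * (of_real u + I * of_real v) * of_real w) * ?h w))"
    by (simp add: emb linear_scale[OF bounded_linear.linear[OF bounded_linear_slice_coord]])
qed

text \<open>
  The constant is chosen before \<open>I\<close>. In each coordinate the representation formula bounds the function by the
  \<open>L\<^sup>1\<close> norm of the transform, which is estimated through \<open>|h| \<le> 1 + |h|\<^sup>2\<close> on \<open>[-B, B]\<close>; the
  \<open>L\<^sup>2\<close> norm of \<open>h\<close> in turn is bounded by that of \<open>f\<close> on the real axis, the same for all \<open>I\<close>.
\<close>

lemma band_limited_imp_growth:
  assumes B: "0 < B"
  shows "\<exists>C. \<forall>I\<in>imag_sphere. (AE w in lborel. w \<notin> {- B..B} \<longrightarrow> clifford_fourier I (\<lambda>x. f (of_real x)) w = 0) \<longrightarrow>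
    (\<forall>z. norm (f (slice_embed I z)) \<le> C * exp (B * norm z))"
proof -
  obtain K where K: "1 \<le> K" "\<And>a b :: 'n clifford. norm (a * b) \<le> K * norm a * norm b"
    by (rule clifford_mult_bounded) blast
  define N where "N = (LBINT x. (norm (f (of_real x)))\<^sup>2)"
  define C where "C = 2 * B + 4 * ((1 + K\<^sup>2) * N)"
  have "norm (f (slice_embed I z)) \<le> of_nat (CARD('n set)) * C * exp (B * norm z)"
    if I: "I \<in> imag_sphere" and supp: "AE w in lborel. w \<notin> {- B..B} \<longrightarrow> clifford_fourier I (\<lambda>x. f (of_real x)) w = 0" for I z
  proof -
    have "norm (slice_coord I A (f (slice_embed I z))) \<le> C * exp (B * norm z)" for A
    proof -
      let ?g = "\<lambda>x. slice_coord I A (f (slice_embed I (of_real x)))"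
      let ?h = "\<lambda>w. slice_coord I A (clifford_fourier I (\<lambda>x. f (of_real x)) w)"
      have p: "L2_fourier_pair ?g ?h"
        by (rule slice_pair[OF I])
      then have gh: "integrable lborel (\<lambda>x. (norm (?g x))\<^sup>2)" "integrable lborel (\<lambda>w. (norm (?h w))\<^sup>2)" "L2_fun ?h"
        by (auto simp: L2_fourier_pair_def L2_fun_def)
      note supp' = band_limited_slice_coord[OF I supp, of A]
      have h: "integrable lborel ?h"
        by (rule integrable_if_L2_AE_supported[OF gh(3) supp'])
      have ind: "integrable lborel (indicator {- B..B} :: real \<Rightarrow> real)"
        by (intro integrable_real_indicator) (auto simp: emeasure_lborel_Icc_eq)
      have "ennreal (LBINT w. (norm (?h w))\<^sup>2) \<le> ennreal (4 * (LBINT x. (norm (?g x))\<^sup>2))"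
        using L2_fourier_pair_norm_bound[OF p] gh by (simp add: nn_integral_eq_integral ennreal_mult)
      then have "(LBINT w. (norm (?h w))\<^sup>2) \<le> 4 * (LBINT x. (norm (?g x))\<^sup>2)"
        by (subst (asm) ennreal_le_iff) auto
      also have "(LBINT x. (norm (?g x))\<^sup>2) \<le> (LBINT x. (1 + K\<^sup>2) * (norm (f (of_real x)))\<^sup>2)"
        using L2 gh(1) norm_slice_coord_square[OF K I]
        by (intro integral_mono) (auto simp: L2_fun_def of_real_eq_slice_embed[of _ I, symmetric])
      finally have hN: "(LBINT w. (norm (?h w))\<^sup>2) \<le> 4 * ((1 + K\<^sup>2) * N)"
        by (simp add: N_def)
      have rep: "slice_coord I A (f (slice_embed I z)) = (1 / sqrt (2 * pi)) *\<^sub>R (LBINT w. exp (\<i> * z * of_real w) * ?h w)"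
        by (rule Paley_Wiener_representation[OF slice_monogenic_imp_holomorphic[OF f I] p supp'])
      have "sqrt 1 \<le> sqrt (2 * pi)"
        using pi_gt3 by (intro real_sqrt_le_mono) simp
      then have "norm (slice_coord I A (f (slice_embed I z))) \<le> norm (LBINT w. exp (\<i> * z * of_real w) * ?h w)"
        unfolding rep norm_scaleR by (intro mult_left_le_one_le) auto
      also have "\<dots> \<le> (LBINT w. norm (exp (\<i> * z * of_real w) * ?h w))"
        by (rule integral_norm_bound)
      also have "\<dots> \<le> (LBINT w. exp (B * norm z) * (indicator {- B..B} w + (norm (?h w))\<^sup>2))"
      proof (rule integral_mono_AE)
        show dom: "integrable lborel (\<lambda>w. exp (B * norm z) * (indicator {- B..B} w + (norm (?h w))\<^sup>2))"
          by (intro integrable_mult_right Bochner_Integration.integrable_add ind gh)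
        show le: "AE w in lborel. norm (exp (\<i> * z * of_real w) * ?h w) \<le> exp (B * norm z) * (indicator {- B..B} w + (norm (?h w))\<^sup>2)"
          using supp'
        proof eventually_elim
          case (elim w)
          show ?case
          proof (cases "w \<in> {- B..B}")
            case True
            have "\<bar>Im z * w\<bar> \<le> norm z * B"
              unfolding abs_mult using True B by (intro mult_mono abs_Im_le_cmod) auto
            then have "norm (exp (\<i> * z * of_real w)) \<le> exp (B * norm z)"
              by (simp add: mult.commute)
            moreover have "norm (?h w) \<le> indicator {- B..B} w + (norm (?h w))\<^sup>2"
              using True sum_squares_bound[of 1 "norm (?h w)"] norm_ge_zero[of "?h w"] by (simp del: norm_ge_zero)
            ultimately show ?thesis
              unfolding norm_mult by (intro mult_mono) auto
          next
            case False
            then show ?thesis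
              using elim by simp
          qed
        qed
        show "integrable lborel (\<lambda>w. norm (exp (\<i> * z * of_real w) * ?h w))"
        proof (rule Bochner_Integration.integrable_bound[OF dom])
          have [measurable]: "?h \<in> borel_measurable borel"
            using h by auto
          show "(\<lambda>w. norm (exp (\<i> * z * of_real w) * ?h w)) \<in> borel_measurable lborel"
            by measurable
          show "AE w in lborel. norm (norm (exp (\<i> * z * of_real w) * ?h w)) \<le> norm (exp (B * norm z) * (indicator {- B..B} w + (norm (?h w))\<^sup>2))"
            using le by eventually_elim (simp del: norm_mult)
        qed
      qed
      also have "\<dots> = exp (B * norm z) * (2 * B + (LBINT w. (norm (?h w))\<^sup>2))"
        using B ind gh(2) by simp
      also have "\<dots> \<le> exp (B * norm z) * C"
        unfolding C_def using hN by (intro mult_left_mono) auto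
      finally show ?thesis
        by (simp add: mult.commute)
    qed
    then have "(\<Sum>A\<in>UNIV. norm (slice_coord I A (f (slice_embed I z)))) \<le> of_nat (CARD('n set)) * (C * exp (B * norm z))"
      by (rule sum_bounded_above)
    then show ?thesis
      using norm_le_sum_slice_coord[of "f (slice_embed I z)" I] by (simp add: mult.assoc)
  qed
  then show ?thesis
    by blast
qed

end

theorem theorem3p12:
  fixes f :: "'n :: {finite, linorder} clifford \<Rightarrow> 'n clifford" and B :: real
  assumes "left_slice_monogenic_on paravectors f"
    and "L2_fun (\<lambda>x :: real. f (of_real x))"
    and "B > 0"
  shows
    "let growth = (\<exists>C :: real. \<forall>I\<in>imag_sphere. \<forall>u v :: real.
           norm (f (of_real u + I * of_real v)) \<le> C * exp (B * norm (of_real u + I * of_real v)));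
         bandlimited = (\<forall>I\<in>imag_sphere.
           ess_support (clifford_fourier I (\<lambda>x. f (of_real x))) \<subseteq> {-B..B})
     in (growth \<longleftrightarrow> bandlimited) \<and>
        (growth \<or> bandlimited \<longrightarrow>
          (\<forall>I\<in>imag_sphere. \<forall>u v :: real.
            f (of_real u + I * of_real v) =
              (1 / sqrt (2 * pi)) *\<^sub>R
                (LBINT w:{-B..B}. clifford_exp (I * (of_real u + I * of_real v) * of_real w) *
                   clifford_fourier I (\<lambda>x. f (of_real x)) w)))"
proof -
  define growth where "growth \<longleftrightarrow> (\<exists>C :: real. \<forall>I\<in>imag_sphere. \<forall>u v :: real.
    norm (f (of_real u + I * of_real v)) \<le> C * exp (B * norm (of_real u + I * of_real v)))"
  define band where "band \<longleftrightarrow> (\<forall>I\<in>imag_sphere. ess_support (clifford_fourier I (\<lambda>x. f (of_real x))) \<subseteq> {-B..B})"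
  have emb: "of_real (Re z) + I * of_real (Im z) = slice_embed I z" for I :: "'n clifford" and z
    by (simp add: slice_embed_def)
  have growth: "growth \<longleftrightarrow> (\<exists>C. \<forall>I\<in>imag_sphere. \<forall>z. norm (f (slice_embed I z)) \<le> C * exp (B * norm z))"
  proof -
    have "(\<forall>u v :: real. norm (f (of_real u + I * of_real v)) \<le> C * exp (B * norm (of_real u + I * of_real v)))
      \<longleftrightarrow> (\<forall>z. norm (f (slice_embed I z)) \<le> C * exp (B * norm z))" if "I \<in> imag_sphere" for I C
      unfolding norm_slice_embed[OF that, symmetric] slice_embed_def by (metis complex.sel)
    then show ?thesis
      unfolding growth_def by (intro ex_cong1 ball_cong) auto
  qed
  have band: "band \<longleftrightarrow> (\<forall>I\<in>imag_sphere. AE w in lborel. w \<notin> {- B..B} \<longrightarrow> clifford_fourier I (\<lambda>x. f (of_real x)) w = 0)"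
    unfolding band_def by (simp add: ess_support_subset_iff)
  have "growth \<longleftrightarrow> band"
  proof
    assume growth
    then show band
      unfolding growth band using growth_imp_band_limited[OF assms(1,2) _ assms(3)] by blast
  next
    assume band
    then show growth
      unfolding growth band using band_limited_imp_growth[OF assms] by meson
  qed
  moreover have "\<forall>I\<in>imag_sphere. \<forall>u v :: real. f (of_real u + I * of_real v) = (1 / sqrt (2 * pi)) *\<^sub>R
      (LBINT w:{-B..B}. clifford_exp (I * (of_real u + I * of_real v) * of_real w) * clifford_fourier I (\<lambda>x. f (of_real x)) w)"
    if band
    using that unfolding band by (intro ballI allI band_limited_representation[OF assms(1,2)]) auto
  ultimately show ?thesis
    unfolding Let_def growth_def[symmetric] band_def[symmetric] by blast
qed

end
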